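(* Let $s\in(\frac12,1)$, $\varepsilon>0$ and $T>0$. There exist constants $C>0$ and $\beta\in(0,1)$ such that for every $f\in L^\infty(Q_T)$ and every $u_T\in\mathcal{C}^{2s+\varepsilon}(\mathbb{T}^d)$, with $C$ and $\beta$ independent of $u$ and $f$, the solution $u$ of $$\begin{cases}-\partial_t u+(-\Delta)^s u+f(x,t)=0 & \text{in } Q_T,\\ u(x,T)=u_T(x) & \text{in } \mathbb{T}^d\end{cases}$$ satisfies $$\|Du\|_{\mathcal{C}^{\beta,\frac{\beta}{2s}}(Q_T)}\le C\left(\|f\|_\infty+\|u_T\|_{\mathcal{C}^{2s+\varepsilon}}\right).$$
   Context: $\mathbb{T}^d=\mathbb{R}^d/\mathbb{Z}^d$, $Q_T=\mathbb{T}^d\times[0,T]$. The fractional Laplacian is $(-\Delta)^s u(x)=(2\pi)^{2s}\sum_{k\in\mathbb{Z}^d}|k|^{2s}\widehat u(k)e^{2\pi i k\cdot x}$, $\widehat u(k)=\int_{\mathbb{T}^d}u(x)e^{-2\pi i k\cdot x}dx$. $D$ is the gradient in $x$. The solution is the unique one with $u\in L^p(0,T;H^{2s}_p(\mathbb{T}^d))$ for all large finite $p$, where $H_p^{\sigma}(\mathbb{T}^d)$ is the Bessel potential space with norm $\|(I-\Delta)^{\sigma/2}u\|_{L^p}$. For $k\ge0$ an integer and $\beta\in(0,1]$, $\mathcal{C}^{k+\beta}(\mathbb{T}^d)$ is the space of $\mathcal{C}^k$ functions whose derivatives of order $k$ are $\beta$-H\"older, with the usual norm. For $\alpha,\gamma\in(0,1)$,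 $\mathcal{C}^{\alpha,\gamma}(Q_T)$ is the space of continuous functions with finite seminorm $\sup_t[v(\cdot,t)]_{\mathcal{C}^\alpha}+\sup_x[v(x,\cdot)]_{\mathcal{C}^\gamma}$; its norm is the sup norm plus this seminorm. *)

theory Defs
  imports "HOL-Analysis.Analysis" "HOL-Probability.Essential_Supremum"
begin

text \<open>
  Functions on the torus are represented by \<open>\<int>\<^sup>d\<close>-periodic functions on \<^typ>\<open>real ^ 'd\<close>,
  and integrals over the torus are integrals over the unit cube. Functions on
  \<open>Q\<^sub>T\<close> are curried (space first, then time); only times in \<open>[0,T]\<close> matter.
  Norms take values in \<^typ>\<open>ennreal\<close>, so that a finite norm expresses membership in the space.
\<close>

definition lattice_vec :: "int ^ 'd \<Rightarrow> real ^ 'd" where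
  "lattice_vec k = (\<chi> i. real_of_int (k $ i))"

definition torus_periodic :: "(real ^ 'd \<Rightarrow> 'b) \<Rightarrow> bool" where
  "torus_periodic g \<longleftrightarrow> (\<forall>x k. g (x + lattice_vec k) = g x)"

definition torus_measure :: "(real ^ 'd) measure" where
  "torus_measure = lebesgue_on (cbox 0 (\<chi> i. 1))"

definition cylinder_measure :: "real \<Rightarrow> ((real ^ 'd) \<times> real) measure" where
  "cylinder_measure T = lebesgue_on (cbox 0 (\<chi> i. 1) \<times> {0..T})"


subsection \<open>Fourier multipliers\<close>

definition fourier_coeff :: "(real ^ 'd \<Rightarrow> real) \<Rightarrow> int ^ 'd \<Rightarrow> complex" where
  "fourier_coeff u k =
     (LINT x|torus_measure. complex_of_real (u x) * exp (- 2 * pi * \<i> * complex_of_real (lattice_vec k \<bullet> x)))"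

text \<open>
  \<open>g = (\<Sum>k. m(k) u\<^sup>^(k) e\<^sup>2\<^sup>\<pi>\<^sup>i\<^sup>k\<^sup>x)\<close> as periodic distributions, for integrable \<open>u\<close> and \<open>g\<close>.
  The function \<open>g\<close> is determined by \<open>u\<close> up to a null set.
\<close>
definition multiplier_image ::
    "(int ^ 'd \<Rightarrow> real) \<Rightarrow> (real ^ 'd \<Rightarrow> real) \<Rightarrow> (real ^ 'd \<Rightarrow> real) \<Rightarrow> bool" where
  "multiplier_image m u g \<longleftrightarrow>
     integrable torus_measure u \<and> integrable torus_measure g \<and>
     (\<forall>k. fourier_coeff g k = complex_of_real (m k) * fourier_coeff u k)"

definition is_frac_laplacian :: "real \<Rightarrow> (real ^ 'd \<Rightarrow> real) \<Rightarrow> (real ^ 'd \<Rightarrow> real) \<Rightarrow> bool" where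
  "is_frac_laplacian s u g \<longleftrightarrow>
     multiplier_image (\<lambda>k. (2 * pi) powr (2 * s) * norm (lattice_vec k) powr (2 * s)) u g"

text \<open>\<open>g = (I - \<Delta>)\<^bsup>\<sigma>/2\<^esup> u\<close>; the symbol of \<open>-\<Delta>\<close> is \<open>4\<pi>\<^sup>2|k|\<^sup>2\<close>.\<close>
definition is_bessel_potential :: "real \<Rightarrow> (real ^ 'd \<Rightarrow> real) \<Rightarrow> (real ^ 'd \<Rightarrow> real) \<Rightarrow> bool" where
  "is_bessel_potential \<sigma> u g \<longleftrightarrow>
     multiplier_image (\<lambda>k. (1 + 4 * pi\<^sup>2 * (norm (lattice_vec k))\<^sup>2) powr (\<sigma> / 2)) u g"

text \<open>
  The \<open>p\<close>-th power of the norm \<open>\<parallel>(I - \<Delta>)\<^bsup>\<sigma>/2\<^esup> u\<parallel>\<close> in \<open>L\<^sup>p\<close>. The infimum runs over the representatives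
  of one class modulo null sets, on which the integral is constant; it is infinite if
  \<open>(I - \<Delta>)\<^bsup>\<sigma>/2\<^esup> u\<close> is not an integrable function.
\<close>
definition bessel_norm_pow :: "real \<Rightarrow> real \<Rightarrow> (real ^ 'd \<Rightarrow> real) \<Rightarrow> ennreal" where
  "bessel_norm_pow \<sigma> p u =
     (INF g \<in> {g. is_bessel_potential \<sigma> u g}. \<integral>\<^sup>+ x. ennreal (\<bar>g x\<bar> powr p) \<partial>torus_measure)"

text \<open>
  \<open>u \<in> L\<^sup>p(0,T; H\<^sup>\<sigma>\<^sub>p)\<close>. Since \<open>H\<^sup>\<sigma>\<^sub>p\<close> is separable for finite \<open>p\<close>, strong measurability in time
  amounts to joint measurability of a representative on \<open>Q\<^sub>T\<close>.
\<close>
definition in_Lp_bessel :: "real \<Rightarrow> real \<Rightarrow> real \<Rightarrow> (real ^ 'd \<Rightarrow> real \<Rightarrow> real) \<Rightarrow> bool" where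
  "in_Lp_bessel T \<sigma> p u \<longleftrightarrow>
     (\<lambda>(x, t). u x t) \<in> borel_measurable (cylinder_measure T) \<and>
     (AE t in lebesgue_on {0..T}. bessel_norm_pow \<sigma> p (\<lambda>x. u x t) < \<infinity>) \<and>
     (\<integral>\<^sup>+ t. bessel_norm_pow \<sigma> p (\<lambda>x. u x t) \<partial>lebesgue_on {0..T}) < \<infinity>"


subsection \<open>Function spaces\<close>

definition Linf_norm :: "real \<Rightarrow> (real ^ 'd \<Rightarrow> real \<Rightarrow> real) \<Rightarrow> ennreal" where
  "Linf_norm T f = esssup (cylinder_measure T) (\<lambda>(x, t). ennreal \<bar>f x t\<bar>)"

definition in_Linf :: "real \<Rightarrow> (real ^ 'd \<Rightarrow> real \<Rightarrow> real) \<Rightarrow> bool" where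
  "in_Linf T f \<longleftrightarrow>
     (\<forall>t \<in> {0..T}. torus_periodic (\<lambda>x. f x t)) \<and>
     (\<lambda>(x, t). f x t) \<in> borel_measurable (cylinder_measure T) \<and>
     Linf_norm T f < \<infinity>"

text \<open>
  For periodic functions and \<open>S = UNIV\<close> this agrees with the seminorm for the torus
  distance, since the quotient is largest for the closest representatives.
\<close>
definition holder_seminorm ::
    "real \<Rightarrow> 'a::metric_space set \<Rightarrow> ('a \<Rightarrow> 'b::real_normed_vector) \<Rightarrow> ennreal" where
  "holder_seminorm \<alpha> S g =
     (SUP (x, y) \<in> {(x, y). x \<in> S \<and> y \<in> S \<and> x \<noteq> y}. ennreal (norm (g x - g y) / dist x y powr \<alpha>))"

definition partial_deriv :: "'d::finite \<Rightarrow> (real ^ 'd \<Rightarrow> real) \<Rightarrow> real ^ 'd \<Rightarrow> real" where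
  "partial_deriv i g x = frechet_derivative g (at x) (axis i 1)"

fun iter_partial :: "'d::finite list \<Rightarrow> (real ^ 'd \<Rightarrow> real) \<Rightarrow> real ^ 'd \<Rightarrow> real" where
  "iter_partial [] g = g"
| "iter_partial (i # js) g = iter_partial js (partial_deriv i g)"

fun is_Ck :: "nat \<Rightarrow> (real ^ 'd \<Rightarrow> real) \<Rightarrow> bool" where
  "is_Ck 0 g \<longleftrightarrow> continuous_on UNIV g"
| "is_Ck (Suc k) g \<longleftrightarrow> (\<forall>x. g differentiable (at x)) \<and> (\<forall>i. is_Ck k (partial_deriv i g))"

definition Ck_holder_norm :: "nat \<Rightarrow> real \<Rightarrow> (real ^ 'd \<Rightarrow> real) \<Rightarrow> ennreal" where
  "Ck_holder_norm k \<beta> g =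
     (SUP js \<in> {js. length js \<le> k}. SUP x. ennreal \<bar>iter_partial js g x\<bar>) +
     (SUP js \<in> {js. length js = k}. holder_seminorm \<beta> UNIV (iter_partial js g))"

text \<open>
  A real order \<open>\<sigma> > 0\<close> is written as \<open>\<sigma> = k + \<beta>\<close> with an integer \<open>k \<ge> 0\<close> and \<open>0 < \<beta> \<le> 1\<close>;
  in particular integer orders give Lipschitz derivatives of order \<open>\<sigma> - 1\<close>.
\<close>
definition holder_order :: "real \<Rightarrow> nat" where
  "holder_order \<sigma> = nat (\<lceil>\<sigma>\<rceil> - 1)"

definition holder_norm :: "real \<Rightarrow> (real ^ 'd \<Rightarrow> real) \<Rightarrow> ennreal" where
  "holder_norm \<sigma> g = Ck_holder_norm (holder_order \<sigma>) (\<sigma> - real (holder_order \<sigma>)) g"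

definition in_holder :: "real \<Rightarrow> (real ^ 'd \<Rightarrow> real) \<Rightarrow> bool" where
  "in_holder \<sigma> g \<longleftrightarrow>
     torus_periodic g \<and> is_Ck (holder_order \<sigma>) g \<and> holder_norm \<sigma> g < \<infinity>"

definition parabolic_holder_norm ::
    "real \<Rightarrow> real \<Rightarrow> real \<Rightarrow> (real ^ 'd \<Rightarrow> real \<Rightarrow> 'b::real_normed_vector) \<Rightarrow> ennreal" where
  "parabolic_holder_norm T \<alpha> \<gamma> v =
     (SUP (x, t) \<in> UNIV \<times> {0..T}. ennreal (norm (v x t))) +
     ((SUP t \<in> {0..T}. holder_seminorm \<alpha> UNIV (\<lambda>x. v x t)) +
      (SUP x. holder_seminorm \<gamma> {0..T} (v x)))"

definition in_parabolic_holder ::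
    "real \<Rightarrow> real \<Rightarrow> real \<Rightarrow> (real ^ 'd \<Rightarrow> real \<Rightarrow> 'b::real_normed_vector) \<Rightarrow> bool" where
  "in_parabolic_holder T \<alpha> \<gamma> v \<longleftrightarrow>
     (\<forall>t \<in> {0..T}. torus_periodic (\<lambda>x. v x t)) \<and>
     continuous_on (UNIV \<times> {0..T}) (\<lambda>(x, t). v x t) \<and>
     parabolic_holder_norm T \<alpha> \<gamma> v < \<infinity>"


subsection \<open>Solutions of the terminal value problem\<close>

text \<open>
  \<open>u \<in> L\<^sup>p(0,T; H\<^bsup>2s\<^esup>\<^sub>p)\<close> for all large finite \<open>p\<close>. The function \<open>v\<close> is the weak time derivative of
  \<open>u\<close>; the integral identity says both that \<open>v = \<partial>\<^sub>t u\<close> and that \<open>u(T) = u\<^sub>T\<close> in the sense of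
  traces. The equation \<open>- \<partial>\<^sub>t u + (-\<Delta>)\<^sup>s u + f = 0\<close> holds almost everywhere.
\<close>
definition is_solution ::
    "real \<Rightarrow> real \<Rightarrow> (real ^ 'd \<Rightarrow> real \<Rightarrow> real) \<Rightarrow> (real ^ 'd \<Rightarrow> real) \<Rightarrow> (real ^ 'd \<Rightarrow> real \<Rightarrow> real) \<Rightarrow> bool"
  where
  "is_solution s T f uT u \<longleftrightarrow>
     (\<forall>t \<in> {0..T}. torus_periodic (\<lambda>x. u x t)) \<and>
     (\<forall>\<^sub>F p in at_top. in_Lp_bessel T (2 * s) p u) \<and>
     (\<exists>v. integrable (cylinder_measure T) (\<lambda>(x, t). v x t) \<and>
          (AE (x, t) in cylinder_measure T. u x t = uT x - (LINT \<tau>|lebesgue_on {t..T}. v x \<tau>)) \<and>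
          (AE t in lebesgue_on {0..T}. \<exists>g. is_frac_laplacian s (\<lambda>x. u x t) g \<and>
             (AE x in torus_measure. - v x t + g x + f x t = 0)))"

text \<open>
  Solutions are classes modulo null sets; pointwise statements refer to the continuous representative.
\<close>
definition is_continuous_rep ::
    "real \<Rightarrow> (real ^ 'd \<Rightarrow> real \<Rightarrow> real) \<Rightarrow> (real ^ 'd \<Rightarrow> real \<Rightarrow> real) \<Rightarrow> bool" where
  "is_continuous_rep T u w \<longleftrightarrow>
     (\<forall>t \<in> {0..T}. torus_periodic (\<lambda>x. w x t)) \<and>
     continuous_on (UNIV \<times> {0..T}) (\<lambda>(x, t). w x t) \<and>
     (AE (x, t) in cylinder_measure T. w x t = u x t)"

end

theory Submission
  imports Defs "HOL-Probability.Probability" "HOL-Real_Asymp.Real_Asymp"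
begin

text \<open>
  Why the estimate holds. In the Fourier variable of the torus the equation is a family of scalar
  linear equations, so the solution must be given by Duhamel's formula: \<open>u(t)\<close> is \<open>P(T-t) u\<^sub>T\<close>
  minus the integral of \<open>P(\<tau>) f(t+\<tau>)\<close> over \<open>0 \<le> \<tau> \<le> T-t\<close>, where \<open>P\<close> is the semigroup of the
  fractional Laplacian. By subordination, \<open>P(t) g(x)\<close> is the mean value of \<open>g(x - c Y)\<close> with
  \<open>c = t\<^bsup>1/(2s)\<^esup>\<close> and a random vector \<open>Y = \<surd>(2S) Z\<close>, where \<open>Z\<close> is a standard Gaussian vector and
  \<open>S > 0\<close> is an independent variable with Laplace transform \<open>exp (- \<lambda>\<^sup>s)\<close>. Everything that is needed
  about \<open>P\<close> can be read off from this formula.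

  Regularity is measured by first-order expansions (\<open>taylor\<close>) with a remainder of order
  \<open>a = 1 + \<beta>\<close>, where \<open>1 < a < 2s\<close>. Such an expansion survives averaging; for a bounded function
  it gives a bounded \<open>\<beta>\<close>-Hoelder gradient, and together with a time modulus of order \<open>a/(2s)\<close> of the function itself
  it gives, by interpolation, a time modulus of order \<open>\<beta>/(2s)\<close> of the gradient. Thus gradients
  never have to be differentiated or moved through the semigroup, and three facts suffice.

  First, \<open>P(\<tau>)\<close> maps functions bounded by \<open>M\<close> to functions whose expansion has the constant
  \<open>M K \<tau>\<^bsup>-a/(2s)\<^esup>\<close>: increments of \<open>P(\<tau>) g\<close> can be transferred to the Gaussian density, and the
  negative moments of \<open>S\<close> are finite (\<open>stable_kernel_exists\<close>). As \<open>a < 2s\<close> this is integrable in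
  \<open>\<tau>\<close>, which bounds the Duhamel integral (\<open>src_taylor\<close>); the terminal datum has an expansion by
  itself (\<open>in_holder_taylor\<close>) and \<open>P\<close> preserves it. Second, \<open>Y\<close> is centred with a finite moment of
  order \<open>a\<close>, so \<open>P(h)\<close> moves a function with an expansion by at most a multiple of \<open>h\<^bsup>a/(2s)\<^esup>\<close>
  (\<open>heat_close\<close>), and the flow property gives the time modulus (\<open>mild_time\<close>). Third, an integrable
  function on the torus is determined by its Fourier coefficients (\<open>fourier_uniqueness\<close>); this
  yields the flow property as well as the identity between the given solution and Duhamel's formula
  (\<open>solution_eq_mild\<close>).
\<close>

section \<open>Functions with a Hoelder continuous gradient\<close>

text \<open>
  For \<open>1 < a \<le> 2\<close> this means, up to the value of the constant, that \<open>V\<close> is the gradient of \<open>w\<close>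
  and is Hoelder continuous of order \<open>a - 1\<close>. The formulation without
  derivatives is stable under averaging over a parameter, and all estimates below are carried out
  for it.
\<close>
definition taylor :: "real \<Rightarrow> real \<Rightarrow> ('a::euclidean_space \<Rightarrow> real) \<Rightarrow> ('a \<Rightarrow> 'a) \<Rightarrow> bool" where
  "taylor a M w V \<longleftrightarrow> (\<forall>x h. \<bar>w (x + h) - w x - V x \<bullet> h\<bar> \<le> M * norm h powr a)"

lemma taylorD: "taylor a M w V \<Longrightarrow> \<bar>w (x + h) - w x - V x \<bullet> h\<bar> \<le> M * norm h powr a"
  by (simp add: taylor_def)

lemma taylor_mono: "taylor a M w V \<Longrightarrow> M \<le> M' \<Longrightarrow> taylor a M' w V"
  unfolding taylor_def by (meson mult_right_mono order_trans powr_ge_zero)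

lemma taylor_const_nonneg:
  fixes w :: "'a::euclidean_space \<Rightarrow> real"
  assumes "taylor a M w V"
  shows "0 \<le> M"
proof -
  obtain b :: 'a where "b \<in> Basis" using nonempty_Basis by blast
  then show ?thesis using taylorD[OF assms, of 0 b] by simp
qed

lemma taylor_diff:
  assumes "taylor a M w V" "taylor a M' w' V'"
  shows "taylor a (M + M') (\<lambda>x. w x - w' x) (\<lambda>x. V x - V' x)"
  unfolding taylor_def
proof (intro allI)
  fix x h
  show "\<bar>w (x + h) - w' (x + h) - (w x - w' x) - (V x - V' x) \<bullet> h\<bar> \<le> (M + M') * norm h powr a"
    using taylorD[OF assms(1), of x h] taylorD[OF assms(2), of x h]
    by (simp add: inner_diff_left algebra_simps)
qed

lemma taylor_gderiv:
  fixes w :: "'a::euclidean_space \<Rightarrow> real"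
  assumes T: "taylor a M w V" and a: "1 < a"
  shows "GDERIV w x :> V x"
proof -
  have "((\<lambda>h. (w (x + h) - w x - V x \<bullet> h) / norm h) \<longlongrightarrow> 0) (at 0)"
  proof (rule Lim_null_comparison)
    show "\<forall>\<^sub>F h in at 0. norm ((w (x + h) - w x - V x \<bullet> h) / norm h) \<le> M * norm h powr (a - 1)"
      unfolding eventually_at_filter
    proof (intro always_eventually allI impI)
      fix h :: 'a assume "h \<noteq> 0"
      then show "norm ((w (x + h) - w x - V x \<bullet> h) / norm h) \<le> M * norm h powr (a - 1)"
        using taylorD[OF T, of x h] by (simp add: divide_simps powr_diff)
    qed
    have "((\<lambda>h::'a. norm h powr (a - 1)) \<longlongrightarrow> norm (0::'a) powr (a - 1)) (at 0)"
      using a by (intro tendsto_powr' tendsto_intros) auto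
    then show "((\<lambda>h::'a. M * norm h powr (a - 1)) \<longlongrightarrow> 0) (at 0)"
      using tendsto_mult_right_zero[of _ "at (0::'a)" M] by simp
  qed
  then have "((\<lambda>y. (w y - w x - V x \<bullet> (y - x)) / norm (y - x)) \<longlongrightarrow> 0) (at x)"
    by (intro LIM_offset_zero_cancel[where a = x]) simp
  then have "((\<lambda>y. norm (w y - w x - (y - x) \<bullet> V x) / norm (y - x)) \<longlongrightarrow> 0) (at x)"
    using tendsto_norm_zero by (fastforce simp: inner_commute)
  then show ?thesis
    unfolding gderiv_def has_derivative_iff_norm by (intro conjI bounded_linear_inner_left)
qed

lemma norm_le_of_inner_le:
  fixes v :: "'a::euclidean_space"
  assumes d: "0 < d" and le: "\<And>k. norm k = d \<Longrightarrow> v \<bullet> k \<le> B * d"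
  shows "norm v \<le> B"
proof (cases "v = 0")
  case True
  obtain b :: 'a where "b \<in> Basis" using nonempty_Basis by blast
  then have "v \<bullet> (d *\<^sub>R b) \<le> B * d" using d by (intro le) simp
  with True d show ?thesis by (simp add: zero_le_mult_iff)
next
  case False
  have "v \<bullet> ((d / norm v) *\<^sub>R v) \<le> B * d" using False d by (intro le) simp
  moreover have "v \<bullet> ((d / norm v) *\<^sub>R v) = d * norm v"
    using False by (simp add: power2_norm_eq_inner[symmetric] power2_eq_square)
  ultimately show ?thesis using d by (simp add: mult.commute)
qed

text \<open>
  The increment \<open>k\<close> from \<open>x + h\<close> can be expanded at \<open>x + h\<close>, or at \<open>x\<close> as the difference of the
  increments \<open>h + k\<close> and \<open>h\<close>. For \<open>|k| = |h|\<close> all three remainders have the order \<open>|h|\<^sup>a\<close>.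
\<close>
lemma taylor_gradient_holder:
  fixes w :: "'a::euclidean_space \<Rightarrow> real"
  assumes T: "taylor a M w V" and a: "1 < a" "a \<le> 2"
  shows "norm (V y - V x) \<le> 6 * M * dist y x powr (a - 1)"
proof (cases "y = x")
  case False
  define h where "h = y - x"
  define d where "d = norm h"
  have d: "0 < d" using False by (simp add: d_def h_def)
  have M: "0 \<le> M" using taylor_const_nonneg[OF T] .
  have "norm (V (x + h) - V x) \<le> 6 * M * d powr (a - 1)"
  proof (rule norm_le_of_inner_le[OF d])
    fix k :: 'a assume k: "norm k = d"
    have "norm (h + k) \<le> 2 * d" using norm_triangle_ineq[of h k] k by (simp add: d_def)
    then have "norm (h + k) powr a \<le> (2 * d) powr a" using a by (intro powr_mono2) auto
    also have "\<dots> = 2 powr a * d powr a" using d by (simp add: powr_mult)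
    also have "\<dots> \<le> 2 powr 2 * d powr a" using a by (intro mult_right_mono powr_mono) auto
    finally have "M * norm (h + k) powr a \<le> M * (4 * d powr a)" using M by (intro mult_left_mono) auto
    then have "(V (x + h) - V x) \<bullet> k \<le> 6 * M * d powr a"
      using taylorD[OF T, of x h] taylorD[OF T, of "x + h" k] taylorD[OF T, of x "h + k"] k
      by (simp add: inner_diff_left inner_add_right d_def algebra_simps)
    also have "d powr a = d powr (a - 1) * d" using d by (simp add: powr_diff)
    finally show "(V (x + h) - V x) \<bullet> k \<le> 6 * M * d powr (a - 1) * d" by (simp add: mult.assoc)
  qed
  then show ?thesis by (simp add: h_def d_def dist_norm)
qed (simp)

text \<open>
  The scale \<open>d\<close> at which the expansion is tested is free: \<open>d = 1\<close> gives a bound of the gradient,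
  small \<open>d\<close> gives an interpolation inequality.
\<close>
lemma taylor_gradient_bound:
  fixes w :: "'a::euclidean_space \<Rightarrow> real"
  assumes T: "taylor a M w V" and B: "\<And>x. \<bar>w x\<bar> \<le> B" and d: "0 < d"
  shows "norm (V x) \<le> (2 * B + M * d powr a) / d"
proof (rule norm_le_of_inner_le[OF d])
  fix k :: 'a assume "norm k = d"
  then show "V x \<bullet> k \<le> (2 * B + M * d powr a) / d * d"
    using taylorD[OF T, of x k] B[of x] B[of "x + k"] d by simp
qed

text \<open>
  The interpolation inequality for the difference of two functions. With \<open>w\<close>, \<open>w'\<close> the values of
  one function at two times it turns a time modulus of the function into one of the gradient.
\<close>
lemma taylor_gradient_close:
  fixes w :: "'a::euclidean_space \<Rightarrow> real"
  assumes "taylor a M w V" "taylor a M w' V'"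
    and D: "\<And>x. \<bar>w x - w' x\<bar> \<le> D * d powr a" and d: "0 < d"
  shows "norm (V x - V' x) \<le> 2 * (M + D) * d powr (a - 1)"
proof -
  have "norm (V x - V' x) \<le> (2 * (D * d powr a) + (M + M) * d powr a) / d"
    by (rule taylor_gradient_bound[OF taylor_diff[OF assms(1,2)] D d])
  also have "\<dots> = 2 * (M + D) * d powr (a - 1)"
    using d by (simp add: powr_diff field_simps)
  finally show ?thesis .
qed

lemma taylor_continuous:
  fixes w :: "'a::euclidean_space \<Rightarrow> real"
  assumes "taylor a M w V" "1 < a"
  shows "continuous_on S w"
  using taylor_gderiv[OF assms] unfolding gderiv_def
  by (meson continuous_at_imp_continuous_on has_derivative_continuous)

lemma continuous_on_of_powr_modulus:
  fixes F :: "'a::metric_space \<Rightarrow> 'b::metric_space"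
  assumes "0 < b" "\<And>x y. dist (F y) (F x) \<le> C * dist y x powr b"
  shows "continuous_on S F"
  unfolding continuous_on_def
proof
  fix x
  have "((\<lambda>y. dist y x powr b) \<longlongrightarrow> dist x x powr b) (at x within S)"
    using assms(1) by (intro tendsto_powr' tendsto_intros) auto
  then have "((\<lambda>y. C * dist y x powr b) \<longlongrightarrow> 0) (at x within S)"
    using tendsto_mult_right_zero[of _ "at x within S" C] by simp
  then show "(F \<longlongrightarrow> F x) (at x within S)"
    by (subst tendsto_dist_iff, rule Lim_null_comparison[rotated]) (auto intro: always_eventually assms(2))
qed

lemma taylor_gradient_continuous:
  fixes w :: "'a::euclidean_space \<Rightarrow> real"
  assumes "taylor a M w V" "1 < a" "a \<le> 2"
  shows "continuous_on S V"
  using taylor_gradient_holder[OF assms] assms(2)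
  by (intro continuous_on_of_powr_modulus[where b = "a - 1" and C = "6 * M"]) (auto simp: dist_norm)

section \<open>The stable subordinator\<close>

text \<open>
  The Taylor coefficients of \<open>1 - (1 - z)\<^sup>s\<close>. For \<open>0 < s < 1\<close> they are the weights of a probability
  distribution on the positive integers (the Sibuya distribution), which lies in the domain of
  attraction of the stable law of index \<open>s\<close>.
\<close>
definition sibuya_coeff :: "real \<Rightarrow> nat \<Rightarrow> real" where
  "sibuya_coeff s k = (if k = 0 then 0 else - ((-1) ^ k * (s gchoose k)))"

lemma sibuya_coeff_nonneg:
  assumes "0 < s" "s < 1"
  shows "0 \<le> sibuya_coeff s k"
proof (induction k)
  case (Suc k)
  have *: "(s gchoose Suc k) = (s gchoose k) * (s - real k) / real (Suc k)"
    using gbinomial_absorb_comp[of s k] gbinomial_absorption[of k s] by (simp add: field_simps)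
  have **: "(-1) ^ Suc k * (s gchoose Suc k) = ((-1) ^ k * (s gchoose k)) * (real k - s) / real (Suc k)"
    unfolding * by (simp add: field_simps)
  show ?case
  proof (cases "k = 0")
    case True then show ?thesis using assms ** by (simp add: sibuya_coeff_def)
  next
    case False
    then have "sibuya_coeff s (Suc k) = sibuya_coeff s k * (real k - s) / real (Suc k)"
      using ** by (simp add: sibuya_coeff_def field_simps)
    then show ?thesis using Suc assms False by simp
  qed
qed (simp add: sibuya_coeff_def)

text \<open>
  For \<open>z < 1\<close> this is the binomial series. As the coefficients are nonnegative, it extends to
  \<open>z = 1\<close> by monotone passage to the limit.
\<close>
lemma sibuya_sums:
  assumes "0 < s" "s < 1" "0 \<le> z" "z \<le> 1"
  shows "(\<lambda>k. sibuya_coeff s k * z ^ k) sums (1 - (1 - z) powr s)"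
proof -
  have less: "(\<lambda>k. sibuya_coeff s k * z ^ k) sums (1 - (1 - z) powr s)" if "0 \<le> z" "z < 1" for z
  proof -
    have "(\<lambda>k. (s gchoose k) * (-z) ^ k) sums ((1 - z) powr s)"
      using gen_binomial_real[of "-z" s] that by simp
    then have "(\<lambda>k. (if k = 0 then 1 else 0) - (s gchoose k) * (-z) ^ k) sums (1 - (1 - z) powr s)"
      by (intro sums_diff) (use sums_single[of 0 "\<lambda>_. 1::real"] in simp)
    also have "(\<lambda>k. (if k = 0 then 1 else 0) - (s gchoose k) * (-z) ^ k) = (\<lambda>k. sibuya_coeff s k * z ^ k)"
      by (rule ext) (simp add: sibuya_coeff_def power_minus[of z])
    finally show ?thesis .
  qed
  have nn: "0 \<le> sibuya_coeff s k" for k using sibuya_coeff_nonneg assms by blast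
  have part: "(\<Sum>k<n. sibuya_coeff s k) \<le> 1" for n
  proof (rule tendsto_upperbound)
    have "((\<lambda>z::real. \<Sum>k<n. sibuya_coeff s k * z ^ k) \<longlongrightarrow> (\<Sum>k<n. sibuya_coeff s k * 1 ^ k)) (at_left 1)"
      by (intro tendsto_intros) 
    then show "((\<lambda>z::real. \<Sum>k<n. sibuya_coeff s k * z ^ k) \<longlongrightarrow> (\<Sum>k<n. sibuya_coeff s k)) (at_left 1)" by simp
    have "(\<Sum>k<n. sibuya_coeff s k * z ^ k) \<le> 1" if "0 < z" "z < 1" for z
    proof -
      have "(\<Sum>k<n. sibuya_coeff s k * z ^ k) \<le> 1 - (1 - z) powr s"
        using sum_le_suminf[OF sums_summable[OF less[of z]], of "{..<n}"] sums_unique[OF less[of z]] that nn by auto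
      then show ?thesis using powr_ge_zero[of "1 - z" s] by linarith
    qed
    then show "\<forall>\<^sub>F z in at_left (1::real). (\<Sum>k<n. sibuya_coeff s k * z ^ k) \<le> 1"
      using eventually_at_left_field by (metis (no_types, lifting) zero_less_one)
  qed simp
  have summ: "summable (sibuya_coeff s)"
    by (rule summableI_nonneg_bounded[where x = 1]) (use nn part in auto)
  have "suminf (sibuya_coeff s) \<le> 1" by (rule suminf_le_const[OF summ]) (rule part)
  moreover have "1 \<le> suminf (sibuya_coeff s)"
  proof (rule tendsto_upperbound)
    have "((\<lambda>z::real. (1 - z) powr s) \<longlongrightarrow> (1 - 1) powr s) (at_left 1)"
      using assms by (intro tendsto_powr' tendsto_intros) (auto simp: eventually_at_filter)
    then have "((\<lambda>z::real. 1 - (1 - z) powr s) \<longlongrightarrow> 1 - 0) (at_left 1)"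
      by (intro tendsto_intros) simp
    then show "((\<lambda>z::real. 1 - (1 - z) powr s) \<longlongrightarrow> 1) (at_left 1)" by simp
    have "1 - (1 - z) powr s \<le> suminf (sibuya_coeff s)" if "0 < z" "z < 1" for z
    proof (rule sums_le[OF _ less summable_sums[OF summ]])
      show "sibuya_coeff s k * z ^ k \<le> sibuya_coeff s k" for k
        using that nn[of k] by (simp add: mult_left_le power_le_one)
    qed (use that in auto)
    then show "\<forall>\<^sub>F z in at_left (1::real). 1 - (1 - z) powr s \<le> suminf (sibuya_coeff s)"
      using eventually_at_left_field by (metis (no_types, lifting) zero_less_one)
  qed simp
  ultimately have "suminf (sibuya_coeff s) = 1" by simp
  then have "sibuya_coeff s sums 1" using summ by (simp add: sums_iff)
  then show ?thesis using less[of z] assms by (cases "z = 1") auto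
qed

lemma sibuya_pmf:
  assumes s: "0 < s" "s < 1"
  shows "\<exists>p::nat pmf. \<forall>z. 0 \<le> z \<longrightarrow> z \<le> 1 \<longrightarrow> (\<integral>\<^sup>+k. ennreal (z ^ k) \<partial>p) = ennreal (1 - (1 - z) powr s)"
proof -
  define p where "p = embed_pmf (sibuya_coeff s)"
  have nn: "0 \<le> sibuya_coeff s k" for k using sibuya_coeff_nonneg s by blast
  have sums: "(\<Sum>k. ennreal (sibuya_coeff s k * z ^ k)) = ennreal (1 - (1 - z) powr s)" if "0 \<le> z" "z \<le> 1" for z
    using sibuya_sums[OF s that] that nn by (intro suminf_ennreal_eq) auto
  have "(\<integral>\<^sup>+ k. ennreal (sibuya_coeff s k) \<partial>count_space UNIV) = 1"
    using sums[of 1] by (simp add: nn_integral_count_space_nat)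
  then have pmf: "pmf p k = sibuya_coeff s k" for k
    unfolding p_def by (intro pmf_embed_pmf nn)
  have "(\<integral>\<^sup>+k. ennreal (z ^ k) \<partial>p) = ennreal (1 - (1 - z) powr s)" if "0 \<le> z" "z \<le> 1" for z
    using sums[OF that] that nn
    by (subst nn_integral_measure_pmf) (simp add: nn_integral_count_space_nat pmf ennreal_mult'')
  then show ?thesis by blast
qed

text \<open>
  The law of the sum of \<open>n\<close> independent Sibuya variables, described by its generating function.
\<close>
lemma sibuya_sum_pmf:
  assumes s: "0 < s" "s < 1"
  shows "\<exists>p::nat pmf. \<forall>z. 0 \<le> z \<longrightarrow> z \<le> 1 \<longrightarrow> (\<integral>\<^sup>+k. ennreal (z ^ k) \<partial>p) = ennreal ((1 - (1 - z) powr s) ^ n)"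
proof (induction n)
  case 0
  show ?case by (rule exI[of _ "return_pmf 0"]) simp
next
  case (Suc n)
  obtain p where p: "\<And>z. 0 \<le> z \<Longrightarrow> z \<le> 1 \<Longrightarrow> (\<integral>\<^sup>+k. ennreal (z ^ k) \<partial>measure_pmf p) = ennreal ((1 - (1 - z) powr s) ^ n)"
    using Suc by blast
  obtain q :: "nat pmf" where q: "\<And>z. 0 \<le> z \<Longrightarrow> z \<le> 1 \<Longrightarrow> (\<integral>\<^sup>+k. ennreal (z ^ k) \<partial>measure_pmf q) = ennreal (1 - (1 - z) powr s)"
    using sibuya_pmf[OF s] by blast
  have "(\<integral>\<^sup>+k. ennreal (z ^ k) \<partial>measure_pmf (map_pmf (\<lambda>(i, j). i + j) (pair_pmf q p)))
      = ennreal ((1 - (1 - z) powr s) ^ Suc n)" if z: "0 \<le> z" "z \<le> 1" for z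
  proof -
    have "(1 - z) powr s \<le> 1" using z s by (intro powr_le1) auto
    then show ?thesis using z
    by (simp add: nn_integral_pair_pmf' power_add ennreal_mult' nn_integral_cmult nn_integral_multc p q ennreal_power)
  qed
  then show ?case by blast
qed

lemma sibuya_scaled_limit:
  fixes s l :: real
  assumes s: "0 < s" and l: "0 < l"
  shows "(\<lambda>n. (1 - (1 - exp (- l * real n powr (- 1 / s))) powr s) ^ n) \<longlonglongrightarrow> exp (- (l powr s))"
  using s l by real_asymp

lemma exp_moment_scaled_sum:
  assumes s: "0 < s" "s < 1"
  shows "\<exists>M. real_distribution M \<and> (AE x in M. 0 \<le> x) \<and>
    (\<forall>l\<ge>0. integral\<^sup>L M (\<lambda>x. exp (- l * max x 0)) = (1 - (1 - exp (- l * real n powr (- 1 / s))) powr s) ^ n)"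
proof -
  obtain p :: "nat pmf" where p: "\<And>z. 0 \<le> z \<Longrightarrow> z \<le> 1 \<Longrightarrow> (\<integral>\<^sup>+k. ennreal (z ^ k) \<partial>measure_pmf p) = ennreal ((1 - (1 - z) powr s) ^ n)"
    using sibuya_sum_pmf[OF s] by blast
  define c where "c = real n powr (- 1 / s)"
  define X where "X = (\<lambda>k::nat. c * real k)"
  define M where "M = distr (measure_pmf p) borel X"
  have [measurable]: "X \<in> borel_measurable (measure_pmf p)" by simp
  have c: "0 \<le> c" by (simp add: c_def)
  have "real_distribution M"
    unfolding M_def by (intro prob_space.real_distribution_distr measure_pmf.prob_space_axioms) simp
  moreover have "AE x in M. 0 \<le> x"
    unfolding M_def by (subst AE_distr_iff) (auto simp: X_def c)
  moreover have "integral\<^sup>L M (\<lambda>x. exp (- l * max x 0)) = (1 - (1 - exp (- l * c)) powr s) ^ n" if l: "0 \<le> l" for l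
  proof -
    have z: "0 \<le> exp (- l * c)" "exp (- l * c) \<le> 1" using l c by auto
    then have "(1 - exp (- l * c)) powr s \<le> 1" using s by (intro powr_le1) auto
    then have nn: "0 \<le> (1 - (1 - exp (- l * c)) powr s) ^ n" by simp
    have "integral\<^sup>L M (\<lambda>x. exp (- l * max x 0)) = (\<integral>k. exp (- l * c) ^ k \<partial>measure_pmf p)"
      unfolding M_def using c
      by (subst integral_distr) (auto simp: X_def max_absorb1 exp_of_nat_mult[symmetric] algebra_simps intro!: Bochner_Integration.integral_cong)
    also have "\<dots> = enn2real (\<integral>\<^sup>+k. ennreal (exp (- l * c) ^ k) \<partial>measure_pmf p)"
      by (intro integral_eq_nn_integral) auto
    also have "\<dots> = (1 - (1 - exp (- l * c)) powr s) ^ n"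
      using p[OF z] nn by simp
    finally show ?thesis .
  qed
  ultimately show ?thesis unfolding c_def by blast
qed

lemma one_minus_power_le:
  fixes y :: real
  assumes "0 \<le> y" "y \<le> 1"
  shows "1 - (1 - y) ^ n \<le> real n * y"
  using Bernoulli_inequality[of "- y" n] assms by simp

text \<open>
  Markov's inequality for \<open>1 - exp (- x / K)\<close>, which is at least \<open>1 - 1/e\<close> where \<open>x > K\<close>.
\<close>
lemma laplace_tail:
  assumes "real_distribution M" and K: "0 < K"
  shows "(1 - exp (-1)) * measure M {x. K < x} \<le> 1 - integral\<^sup>L M (\<lambda>x. exp (- (1 / K) * max x 0))"
proof -
  interpret real_distribution M by fact
  have int: "integrable M (\<lambda>x. exp (- (1 / K) * max x 0))"
    using K by (intro integrable_const_bound[where B = 1]) (auto simp: zero_le_divide_iff)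
  moreover have "integrable M (\<lambda>x. indicator {x. K < x} x :: real)"
    by (intro integrable_const_bound[where B = 1]) (auto simp: indicator_def)
  ultimately have "integral\<^sup>L M (\<lambda>x. (1 - exp (-1)) * indicator {x. K < x} x)
      \<le> integral\<^sup>L M (\<lambda>x. 1 - exp (- (1 / K) * max x 0))"
    using K by (intro integral_mono) (auto simp: indicator_def divide_simps)
  also have "\<dots> = 1 - integral\<^sup>L M (\<lambda>x. exp (- (1 / K) * max x 0))"
    using int prob_space by (subst Bochner_Integration.integral_diff) auto
  finally show ?thesis by simp
qed

text \<open>
  The sums of \<open>n\<close> Sibuya variables, divided by \<open>n\<^bsup>1/s\<^esup>\<close>, have Laplace transforms that converge to
  \<open>exp (- l\<^sup>s)\<close>. The transforms are bounded below uniformly in \<open>n\<close>, which makes the laws tight, and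
  Helly's theorem provides a weak limit. The limit has no mass on the negative axis and at \<open>0\<close>,
  since its Laplace transform vanishes at infinity. The maximum with \<open>0\<close> makes the integrand a
  bounded continuous function on the line.
\<close>
lemma stable_subordinator_exists:
  assumes s: "0 < s" "s < 1"
  shows "\<exists>M. real_distribution M \<and> (AE x in M. 0 < x) \<and>
    (\<forall>l\<ge>0. integral\<^sup>L M (\<lambda>x. exp (- l * max x 0)) = exp (- (l powr s)))"
proof -
  define L where "L = (\<lambda>n l. (1 - (1 - exp (- l * real n powr (- 1 / s))) powr s) ^ n)"
  have "\<forall>n. \<exists>M. real_distribution M \<and> (AE x in M. 0 \<le> x) \<and>
    (\<forall>l\<ge>0. integral\<^sup>L M (\<lambda>x. exp (- l * max x 0)) = L n l)"
    unfolding L_def using exp_moment_scaled_sum[OF s] by blast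
  then obtain \<mu> where \<mu>: "\<And>n. real_distribution (\<mu> n)" and nn: "\<And>n. AE x in \<mu> n. 0 \<le> x"
    and L: "\<And>n l. 0 \<le> l \<Longrightarrow> integral\<^sup>L (\<mu> n) (\<lambda>x. exp (- l * max x 0)) = L n l"
    by metis
  \<comment> \<open>This bound is uniform in the number of summands, which gives tightness.\<close>
  have L_lower: "1 - l powr s \<le> L n l" if l: "0 \<le> l" for l n
  proof (cases "n = 0")
    case False
    define y where "y = (1 - exp (- l * real n powr (- 1 / s))) powr s"
    have e: "0 \<le> 1 - exp (- l * real n powr (- 1 / s))" "1 - exp (- l * real n powr (- 1 / s)) \<le> 1"
      using l by auto
    then have y: "0 \<le> y" "y \<le> 1" unfolding y_def using s by (auto intro: powr_le1)
    have "y \<le> (l * real n powr (- 1 / s)) powr s"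
      unfolding y_def using e s exp_ge_add_one_self[of "- l * real n powr (- 1 / s)"] by (intro powr_mono2) auto
    also have "\<dots> = l powr s / real n"
      using l s False by (simp add: powr_divide powr_powr powr_minus_divide)
    finally have "real n * y \<le> l powr s" using False by (simp add: field_simps)
    then show ?thesis using one_minus_power_le[OF y, of n] by (simp add: L_def y_def)
  qed (simp add: L_def)
  have tail: "measure (\<mu> n) {x. K < x} \<le> (1 / K) powr s / (1 - exp (-1))" if K: "0 < K" for K n
  proof -
    have "(1 - exp (-1)) * measure (\<mu> n) {x. K < x} \<le> 1 - L n (1 / K)"
      using laplace_tail[OF \<mu>[of n] K] L[of "1 / K" n] K by simp
    also have "\<dots> \<le> (1 / K) powr s" using L_lower[of "1 / K" n] K by simp
    finally have "(1 - exp (-1)) * measure (\<mu> n) {x. K < x} \<le> (1 / K) powr s" .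
    then show ?thesis by (simp add: field_simps)
  qed
  have "tight \<mu>"
    unfolding tight_def
  proof (intro conjI allI impI \<mu>)
    fix \<epsilon> :: real assume \<epsilon>: "0 < \<epsilon>"
    have "((\<lambda>K::real. (1 / K) powr s / (1 - exp (-1))) \<longlongrightarrow> 0) at_top"
      using s by real_asymp
    then have "\<forall>\<^sub>F K in at_top. (1 / K) powr s / (1 - exp (-1)) < \<epsilon> \<and> (0::real) < K"
      using \<epsilon> by (intro eventually_conj order_tendstoD(2) eventually_gt_at_top)
    then obtain K :: real where K: "(1 / K) powr s / (1 - exp (-1)) < \<epsilon>" "0 < K"
      using eventually_happens trivial_limit_at_top_linorder by blast
    show "\<exists>a b. a < b \<and> (\<forall>n. 1 - \<epsilon> < measure (\<mu> n) {a<..b})"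
    proof (rule exI[of _ "-1"], rule exI[of _ K], intro conjI allI)
      fix n
      interpret real_distribution "\<mu> n" by (rule \<mu>)
      have "measure (\<mu> n) {-1<..K} = measure (\<mu> n) (UNIV - {x. K < x})"
        using nn[of n] by (intro finite_measure_eq_AE) auto
      also have "\<dots> = 1 - measure (\<mu> n) {x. K < x}"
        using prob_compl[of "{x. K < x}"] by simp
      finally show "1 - \<epsilon> < measure (\<mu> n) {-1<..K}" using tail[OF K(2), of n] K(1) by simp
    qed (use K in simp)
  qed
  then obtain r M where r: "strict_mono (r :: nat \<Rightarrow> nat)" and M: "real_distribution M"
    and conv: "weak_conv_m (\<mu> \<circ> id \<circ> r) M"
    using tight_imp_convergent_subsubsequence[of \<mu> id] by (auto simp: strict_mono_id)
  interpret real_distribution M by (rule M)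
  have Lap: "integral\<^sup>L M (\<lambda>x. exp (- l * max x 0)) = exp (- (l powr s))" if l: "0 < l" for l
  proof -
    have "(\<lambda>n. integral\<^sup>L ((\<mu> \<circ> id \<circ> r) n) (\<lambda>x. exp (- l * max x 0))) \<longlonglongrightarrow> integral\<^sup>L M (\<lambda>x. exp (- l * max x 0))"
      using l \<mu> M conv
      by (intro weak_conv_imp_integral_bdd_continuous_conv[where B = 1]) (auto simp: o_def intro!: continuous_intros)
    moreover have "(\<lambda>n. integral\<^sup>L ((\<mu> \<circ> id \<circ> r) n) (\<lambda>x. exp (- l * max x 0))) \<longlonglongrightarrow> exp (- (l powr s))"
      using LIMSEQ_subseq_LIMSEQ[OF sibuya_scaled_limit[OF s(1) l] r] L[of l] l by (simp add: L_def o_def)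
    ultimately show ?thesis by (rule LIMSEQ_unique)
  qed
  have int: "integrable M (\<lambda>x. exp (- l * max x 0))" if "0 < l" for l
    using that by (intro integrable_const_bound[where B = 1]) auto
  have "measure M {x. x \<le> 0} \<le> exp (- (l powr s))" if l: "0 < l" for l
  proof -
    have "integral\<^sup>L M (\<lambda>x. indicator {x. x \<le> 0} x) \<le> integral\<^sup>L M (\<lambda>x. exp (- l * max x 0))"
      using int[OF l] l by (intro integral_mono integrable_const_bound[where B = 1]) (auto simp: indicator_def)
    then show ?thesis using Lap[OF l] by simp
  qed
  then have "\<forall>\<^sub>F l in at_top. measure M {x. x \<le> 0} \<le> exp (- (l powr s))"
    by (intro eventually_mono[OF eventually_gt_at_top[of 0]])
  moreover have "((\<lambda>l. exp (- (l powr s))) \<longlongrightarrow> 0) at_top" using s by real_asymp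
  ultimately have "measure M {x. x \<le> 0} \<le> 0"
    by (intro tendsto_lowerbound) auto
  then have "measure M {x. x \<le> 0} = 0" by (simp add: measure_le_0_iff)
  then have "AE x in M. 0 < x"
    by (subst AE_iff_measurable[where N = "{x. x \<le> 0}"]) (auto simp: emeasure_eq_measure)
  moreover have "integral\<^sup>L M (\<lambda>x. exp (- l * max x 0)) = exp (- (l powr s))" if "0 \<le> l" for l
    using that Lap[of l] s by (cases "l = 0") (auto simp: prob_space simp del: space_eq_univ)
  ultimately show ?thesis using M by blast
qed


lemma exp_powr_integrable_bound:
  fixes s :: real
  assumes "0 < s"
  shows "\<exists>C. 0 \<le> C \<and> (\<forall>l\<ge>0. exp (- (l powr s)) \<le> C / (1 + l)\<^sup>2)"
proof -
  have "((\<lambda>l::real. (1 + l)\<^sup>2 * exp (- (l powr s))) \<longlongrightarrow> 0) at_top" using assms by real_asymp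
  then have "\<forall>\<^sub>F l in at_top. (1 + l)\<^sup>2 * exp (- (l powr s)) < (1::real)"
    by (rule order_tendstoD) simp
  then obtain L where L: "\<And>l::real. L \<le> l \<Longrightarrow> (1 + l)\<^sup>2 * exp (- (l powr s)) < 1"
    by (auto simp: eventually_at_top_linorder)
  have "exp (- (l powr s)) \<le> (1 + \<bar>L\<bar>)\<^sup>2 / (1 + l)\<^sup>2" if l: "0 \<le> l" for l
  proof (cases "L \<le> l")
    case True
    have "(1::real) \<le> (1 + \<bar>L\<bar>)\<^sup>2" by (simp add: one_le_power)
    then have "(1 + l)\<^sup>2 * exp (- (l powr s)) \<le> (1 + \<bar>L\<bar>)\<^sup>2" using L[OF True] by linarith
    then show ?thesis using l by (simp add: field_simps)
  next
    case False
    have "(1 + l)\<^sup>2 * exp (- (l powr s)) \<le> (1 + \<bar>L\<bar>)\<^sup>2 * 1"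
      using l False by (intro mult_mono power_mono) auto
    then show ?thesis using l by (simp add: field_simps)
  qed
  then show ?thesis by (intro exI[of _ "(1 + \<bar>L\<bar>)\<^sup>2"]) auto
qed

text \<open>
  By Tonelli's theorem for \<open>1 / x = \<integral> exp (- l x) dl\<close> the mean value is the integral of
  \<open>exp (- l\<^sup>s)\<close> over the half-line.
\<close>
lemma stable_subordinator_inverse_moment:
  assumes M: "real_distribution M" and pos: "AE x in M. 0 < x" and s: "0 < s"
    and Lap: "\<And>l. 0 \<le> l \<Longrightarrow> integral\<^sup>L M (\<lambda>x. exp (- l * max x 0)) = exp (- (l powr s))"
  shows "integrable M (\<lambda>x. 1 / x)"
proof -
  interpret real_distribution M by fact
  obtain C where C: "0 \<le> C" "\<And>l. 0 \<le> l \<Longrightarrow> exp (- (l powr s)) \<le> C / (1 + l)\<^sup>2"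
    using exp_powr_integrable_bound[OF s] by blast
  have inner: "(\<integral>\<^sup>+l. ennreal (exp (- l * max x 0)) * indicator {0..} l \<partial>lborel) = ennreal (1 / x)" if x: "0 < x" for x
  proof -
    have "(\<integral>\<^sup>+l. ennreal (exp (- l * x)) * indicator {0..} l \<partial>lborel) = ennreal (0 - (- exp (- 0 * x) / x))"
    proof (rule nn_integral_FTC_atLeast)
      show "((\<lambda>l. - exp (- l * x) / x) \<longlongrightarrow> 0) at_top" using x by real_asymp
    qed (use x in \<open>auto intro!: derivative_eq_intros\<close>)
    then show ?thesis using x by simp
  qed
  have "(\<integral>\<^sup>+x. ennreal (1 / x) \<partial>M) = (\<integral>\<^sup>+x. (\<integral>\<^sup>+l. ennreal (exp (- l * max x 0)) * indicator {0..} l \<partial>lborel) \<partial>M)"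
    by (intro nn_integral_cong_AE eventually_mono[OF pos] inner[symmetric])
  also have "\<dots> = (\<integral>\<^sup>+l. (\<integral>\<^sup>+x. ennreal (exp (- l * max x 0)) * indicator {0..} l \<partial>M) \<partial>lborel)"
    by (rule pair_sigma_finite.Fubini') (auto simp: pair_sigma_finite_def sigma_finite_measure_axioms sigma_finite_lborel)
  also have "\<dots> \<le> (\<integral>\<^sup>+l. ennreal (C / (1 + l)\<^sup>2) * indicator {0..} l \<partial>lborel)"
  proof (rule nn_integral_mono)
    fix l :: real
    show "(\<integral>\<^sup>+x. ennreal (exp (- l * max x 0)) * indicator {0..} l \<partial>M) \<le> ennreal (C / (1 + l)\<^sup>2) * indicator {0..} l"
    proof (cases "0 \<le> l")
      case True
      then have "(\<integral>\<^sup>+x. ennreal (exp (- l * max x 0)) \<partial>M) = ennreal (exp (- (l powr s)))"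
        by (subst nn_integral_eq_integral) (use Lap[of l] in \<open>auto intro!: integrable_const_bound[where B = 1]\<close>)
      then show ?thesis using True C by (simp add: ennreal_leI)
    qed simp
  qed
  also have "\<dots> = ennreal (0 - (- C / (1 + 0)))"
  proof (rule nn_integral_FTC_atLeast)
    show "((\<lambda>l. - C / (1 + l)) \<longlongrightarrow> 0) at_top" by real_asymp
    fix l :: real assume "0 \<le> l"
    then show "((\<lambda>l. - C / (1 + l)) has_real_derivative C / (1 + l)\<^sup>2) (at l)"
      by (auto intro!: derivative_eq_intros simp: power2_eq_square)
  qed (use C in auto)
  finally have "(\<integral>\<^sup>+x. ennreal (1 / x) \<partial>M) < \<infinity>" by (simp add: le_less_trans)
  moreover have "(\<integral>\<^sup>+x. ennreal (norm (1 / x)) \<partial>M) = (\<integral>\<^sup>+x. ennreal (1 / x) \<partial>M)"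
    using pos by (intro nn_integral_cong_AE) auto
  ultimately show ?thesis by (intro integrableI_bounded) auto
qed

text \<open>
  The tail at \<open>y\<close> is at most a multiple of \<open>y\<^bsup>-s\<^esup>\<close>, so moments of order \<open>b < s\<close> are finite by the
  layer cake formula.
\<close>
lemma stable_subordinator_moment:
  assumes M: "real_distribution M" and pos: "AE x in M. 0 < x" and s: "0 < b" "b < s"
    and Lap: "\<And>l. 0 \<le> l \<Longrightarrow> integral\<^sup>L M (\<lambda>x. exp (- l * max x 0)) = exp (- (l powr s))"
  shows "integrable M (\<lambda>x. x powr b)"
proof -
  interpret real_distribution M by fact
  define C :: real where "C = 1 / (1 - exp (-1))"
  have C: "0 < C" by (simp add: C_def)
  have tail: "measure M {x. y < x} \<le> C * y powr (- s)" if y: "0 < y" for y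
  proof -
    have "(1 - exp (-1)) * measure M {x. y < x} \<le> 1 - exp (- ((1 / y) powr s))"
      using laplace_tail[OF M y] Lap[of "1 / y"] y by simp
    also have "\<dots> \<le> (1 / y) powr s" using exp_ge_add_one_self[of "- ((1 / y) powr s)"] by linarith
    also have "\<dots> = y powr (- s)" using y by (simp add: powr_divide powr_minus_divide)
    finally show ?thesis by (simp add: C_def field_simps)
  qed
  have point: "ennreal (x powr b) \<le> 1 + (\<integral>\<^sup>+y. ennreal (b * y powr (b - 1)) * indicator {1..} y * indicator {x. y < x} x \<partial>lborel)"
    if x: "0 < x" for x
  proof (cases "1 \<le> x")
    case True
    have "(\<integral>\<^sup>+y. ennreal (b * y powr (b - 1)) * indicator {1..x} y \<partial>lborel) = ennreal (x powr b - 1 powr b)"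
      using True s by (intro nn_integral_FTC_Icc) (auto intro!: derivative_eq_intros)
    also have "(\<integral>\<^sup>+y. ennreal (b * y powr (b - 1)) * indicator {1..x} y \<partial>lborel) =
        (\<integral>\<^sup>+y. ennreal (b * y powr (b - 1)) * indicator {1..} y * indicator {x. y < x} x \<partial>lborel)"
      using AE_lborel_singleton[of x] by (intro nn_integral_cong_AE) (auto elim!: eventually_mono simp: indicator_def)
    finally show ?thesis using True s
      by (simp add: ennreal_1[symmetric] ennreal_plus[symmetric] ge_one_powr_ge_zero del: ennreal_1 ennreal_plus)
  next
    case False
    then have "x powr b \<le> 1" using x s by (intro powr_le1) auto
    then have "ennreal (x powr b) \<le> 1" by (simp add: ennreal_le_1)
    then show ?thesis by (rule order_trans) simp
  qed
  have "(\<integral>\<^sup>+x. ennreal (x powr b) \<partial>M) \<le>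
      (\<integral>\<^sup>+x. 1 + (\<integral>\<^sup>+y. ennreal (b * y powr (b - 1)) * indicator {1..} y * indicator {x. y < x} x \<partial>lborel) \<partial>M)"
    using pos by (intro nn_integral_mono_AE) (auto elim!: eventually_mono dest!: point)
  also have "\<dots> = 1 + (\<integral>\<^sup>+x. (\<integral>\<^sup>+y. ennreal (b * y powr (b - 1)) * indicator {1..} y * indicator {x. y < x} x \<partial>lborel) \<partial>M)"
    using emeasure_space_1 by (subst nn_integral_add) (auto simp: indicator_def)
  also have "(\<integral>\<^sup>+x. (\<integral>\<^sup>+y. ennreal (b * y powr (b - 1)) * indicator {1..} y * indicator {x. y < x} x \<partial>lborel) \<partial>M)
     = (\<integral>\<^sup>+y. (\<integral>\<^sup>+x. ennreal (b * y powr (b - 1)) * indicator {1..} y * indicator {x. y < x} x \<partial>M) \<partial>lborel)"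
    by (rule pair_sigma_finite.Fubini') (auto simp: pair_sigma_finite_def sigma_finite_measure_axioms sigma_finite_lborel indicator_def)
  also have "\<dots> \<le> (\<integral>\<^sup>+y. ennreal (b * C * y powr (b - s - 1)) * indicator {1..} y \<partial>lborel)"
  proof (rule nn_integral_mono)
    fix y :: real
    show "(\<integral>\<^sup>+x. ennreal (b * y powr (b - 1)) * indicator {1..} y * indicator {x. y < x} x \<partial>M)
      \<le> ennreal (b * C * y powr (b - s - 1)) * indicator {1..} y"
    proof (cases "1 \<le> y")
      case True
      have "(\<integral>\<^sup>+x. ennreal (b * y powr (b - 1)) * indicator {1..} y * indicator {x. y < x} x \<partial>M)
        = ennreal (b * y powr (b - 1)) * emeasure M {x. y < x}"
        using True by (simp add: nn_integral_cmult)
      also have "\<dots> = ennreal (b * y powr (b - 1) * measure M {x. y < x})"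
        using s by (simp add: emeasure_eq_measure ennreal_mult)
      also have "\<dots> \<le> ennreal (b * y powr (b - 1) * (C * y powr (- s)))"
        using True s tail[of y] by (intro ennreal_leI mult_left_mono) auto
      also have "b * y powr (b - 1) * (C * y powr (- s)) = b * C * y powr (b - s - 1)"
        using True by (simp add: powr_add[symmetric] algebra_simps)
      finally show ?thesis using True by simp
    qed simp
  qed
  also have "\<dots> = ennreal (0 - (b * C / (b - s) * 1 powr (b - s)))"
  proof (rule nn_integral_FTC_atLeast)
    show "((\<lambda>y. b * C / (b - s) * y powr (b - s)) \<longlongrightarrow> 0) at_top"
      by (rule tendsto_mult_right_zero) (use s in \<open>auto intro!: tendsto_neg_powr filterlim_ident\<close>)
    fix y :: real assume "1 \<le> y"
    then show "((\<lambda>y. b * C / (b - s) * y powr (b - s)) has_real_derivative b * C * y powr (b - s - 1)) (at y)"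
      using s by (auto intro!: derivative_eq_intros)
  qed (use C s in auto)
  finally have "(\<integral>\<^sup>+x. ennreal (x powr b) \<partial>M) < \<infinity>"
    by (rule le_less_trans) (auto simp: less_top[symmetric] infinity_ennreal_def)
  then show ?thesis by (intro integrableI_bounded) auto
qed

section \<open>Gaussian mixtures and their smoothing effect\<close>

definition gauss :: "'a::euclidean_space \<Rightarrow> real" where
  "gauss z = (\<Prod>b\<in>Basis. std_normal_density (z \<bullet> b))"

lemma gauss_nonneg [simp]: "0 \<le> gauss z"
  unfolding gauss_def by (intro prod_nonneg) simp

lemma gauss_measurable [measurable]: "gauss \<in> borel_measurable borel"
  unfolding gauss_def[abs_def] by measurable

lemma sum_neg_half_squares: "(\<Sum>b\<in>Basis. - (z \<bullet> b)\<^sup>2 / 2) = - (norm z)\<^sup>2 / 2"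
  unfolding power2_norm_eq_inner euclidean_inner[of z z]
  by (simp add: sum_divide_distrib sum_negf power2_eq_square)

lemma gauss_eq: "gauss (z::'a::euclidean_space) = (1 / sqrt (2 * pi)) ^ DIM('a) * exp (- (norm z)\<^sup>2 / 2)"
proof -
  have "gauss z = (1 / sqrt (2 * pi)) ^ DIM('a) * exp (\<Sum>b\<in>Basis. - (z \<bullet> b)\<^sup>2 / 2)"
    unfolding gauss_def std_normal_density_def prod.distrib by (simp add: exp_sum)
  also note sum_neg_half_squares
  finally show ?thesis .
qed

lemma gauss_minus: "gauss (- z) = gauss z"
  by (simp add: gauss_eq)

lemma gauss_add: "gauss (z + k) = gauss z * exp (- (z \<bullet> k) - (norm k)\<^sup>2 / 2)"
proof -
  have "(norm (z + k))\<^sup>2 = (norm z)\<^sup>2 + 2 * (z \<bullet> k) + (norm k)\<^sup>2"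
    by (simp add: power2_norm_eq_inner inner_add_left inner_add_right inner_commute)
  then show ?thesis
    by (simp add: gauss_eq mult_exp_exp add_divide_distrib diff_divide_distrib)
qed

lemma lborel_product_integral:
  fixes g :: "'a::euclidean_space \<Rightarrow> real \<Rightarrow> complex"
  assumes [measurable]: "\<And>b. b \<in> Basis \<Longrightarrow> g b \<in> borel_measurable borel"
    and int: "\<And>b. b \<in> Basis \<Longrightarrow> integrable lborel (g b)"
  shows "integrable lborel (\<lambda>z::'a. \<Prod>b\<in>Basis. g b (z \<bullet> b))"
    and "(\<integral>z. (\<Prod>b\<in>Basis. g b (z \<bullet> b)) \<partial>(lborel::'a measure)) = (\<Prod>b\<in>Basis. integral\<^sup>L lborel (g b))"
proof -
  interpret product_sigma_finite "\<lambda>_::'a. lborel :: real measure" by standard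
  have eq: "(\<Prod>b\<in>Basis. g b ((\<Sum>i\<in>Basis. f i *\<^sub>R i) \<bullet> b)) = (\<Prod>b\<in>Basis. g b (f b))" for f :: "'a \<Rightarrow> real"
    by (intro prod.cong) (auto simp: inner_sum_left inner_Basis if_distrib cong: if_cong)
  have I: "integrable (Pi\<^sub>M Basis (\<lambda>_. lborel)) (\<lambda>f. \<Prod>b\<in>Basis. g b (f b))"
    using int by (intro product_integrable_prod) auto
  show "integrable lborel (\<lambda>z::'a. \<Prod>b\<in>Basis. g b (z \<bullet> b))"
    using I by (subst lborel_eq, subst integrable_distr_eq) (auto simp: eq)
  show "(\<integral>z. (\<Prod>b\<in>Basis. g b (z \<bullet> b)) \<partial>(lborel::'a measure)) = (\<Prod>b\<in>Basis. integral\<^sup>L lborel (g b))"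
    using int by (subst lborel_eq, subst integral_distr) (auto simp: eq product_integral_prod)
qed

text \<open>
  Both factors are dominated by products over the coordinates; in one dimension
  \<open>exp (c |x|) \<le> exp (c x) + exp (- c x)\<close>, and each term times the normal density is a multiple of a
  shifted normal density.
\<close>
lemma gauss_exp_moment:
  "integrable lborel (\<lambda>z::'a::euclidean_space. exp (c * norm z) * gauss z)" if c: "0 \<le> c"
proof -
  have 1: "(\<integral>\<^sup>+x. ennreal (exp (c * \<bar>x\<bar>) * std_normal_density x) \<partial>lborel) < \<infinity>"
  proof -
    have *: "exp (d * x) * std_normal_density x = exp (d\<^sup>2 / 2) * normal_density d 1 x" for d x
      unfolding normal_density_def by (simp add: mult_exp_exp power2_eq_square field_simps)
    have "exp (c * \<bar>x\<bar>) \<le> exp (c * x) + exp ((-c) * x)" for x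
      by (cases "0 \<le> x") (auto intro: order_trans[OF _ add_increasing2] simp: add_increasing)
    then have le: "exp (c * \<bar>x\<bar>) * std_normal_density x \<le> exp (c\<^sup>2 / 2) * normal_density c 1 x + exp (c\<^sup>2 / 2) * normal_density (-c) 1 x" for x
      using *[of c x] *[of "-c" x] mult_right_mono[of "exp (c * \<bar>x\<bar>)" "exp (c * x) + exp ((-c) * x)" "std_normal_density x"]
      by (simp add: distrib_right)
    have "integrable lborel (\<lambda>x. exp (c * \<bar>x\<bar>) * std_normal_density x)"
    proof (rule Bochner_Integration.integrable_bound)
      show "integrable lborel (\<lambda>x. exp (c\<^sup>2 / 2) * normal_density c 1 x + exp (c\<^sup>2 / 2) * normal_density (-c) 1 x)"
        by (intro Bochner_Integration.integrable_add integrable_mult_right integrable_normal_density) simp_all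
      have "norm (exp (c * \<bar>x\<bar>) * std_normal_density x) = exp (c * \<bar>x\<bar>) * std_normal_density x" for x
        by (simp add: abs_mult)
      then show "AE x in lborel. norm (exp (c * \<bar>x\<bar>) * std_normal_density x)
         \<le> norm (exp (c\<^sup>2 / 2) * normal_density c 1 x + exp (c\<^sup>2 / 2) * normal_density (-c) 1 x)"
        using le by (intro AE_I2) (metis abs_ge_self order_trans real_norm_def)
    qed simp
    then show ?thesis by (subst nn_integral_eq_integral) (simp_all add: AE_I2)
  qed
  have le: "exp (c * norm z) * gauss z \<le> (\<Prod>b\<in>Basis. exp (c * \<bar>z \<bullet> b\<bar>) * std_normal_density (z \<bullet> b))" for z :: 'a
  proof -
    have "exp (c * norm z) \<le> exp (\<Sum>b\<in>Basis. c * \<bar>z \<bullet> b\<bar>)"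
      using norm_le_l1[of z] c by (simp add: sum_distrib_left[symmetric] mult_left_mono)
    then show ?thesis
      by (simp add: gauss_def prod.distrib exp_sum mult_right_mono prod_nonneg)
  qed
  have "(\<integral>\<^sup>+z. ennreal (exp (c * norm z) * gauss z) \<partial>(lborel :: 'a measure)) \<le>
     (\<integral>\<^sup>+z. (\<Prod>b\<in>Basis. ennreal (exp (c * \<bar>z \<bullet> b\<bar>) * std_normal_density (z \<bullet> b))) \<partial>(lborel :: 'a measure))"
    by (intro nn_integral_mono) (subst prod_ennreal, auto intro: ennreal_leI le)
  also have "\<dots> = (\<Prod>b\<in>(Basis::'a set). (\<integral>\<^sup>+x. ennreal (exp (c * \<bar>x\<bar>) * std_normal_density x) \<partial>lborel))"
    by (intro nn_integral_lborel_prod) auto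
  also have "\<dots> < \<infinity>" using 1 by (simp add: power_less_top_ennreal)
  finally show ?thesis by (intro integrableI_bounded) (auto simp: abs_mult)
qed

lemma gauss_integrable: "integrable lborel (gauss :: 'a::euclidean_space \<Rightarrow> real)"
  using gauss_exp_moment[of 0] by simp

lemma gauss_fourier:
  fixes \<theta> :: "'a::euclidean_space"
  shows "(\<integral>z. exp (\<i> * complex_of_real (\<theta> \<bullet> z)) * complex_of_real (gauss z) \<partial>lborel) = complex_of_real (exp (- (norm \<theta>)\<^sup>2 / 2))"
proof -
  have ch: "(\<integral>x. exp (\<i> * complex_of_real (t * x)) * complex_of_real (std_normal_density x) \<partial>lborel) = complex_of_real (exp (- t\<^sup>2 / 2))" for t
    using fun_cong[OF char_std_normal_distribution, of t]
    by (simp add: char_def integral_density scaleR_conv_of_real mult.commute)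
  have int: "integrable lborel (\<lambda>x. exp (\<i> * complex_of_real (t * x)) * complex_of_real (std_normal_density x))" for t
    by (rule Bochner_Integration.integrable_bound[OF integrable_normal_density[of 1 0]]) (auto simp: norm_mult)
  have "exp (\<i> * complex_of_real (\<theta> \<bullet> z)) * complex_of_real (gauss z)
    = (\<Prod>b\<in>Basis. exp (\<i> * complex_of_real ((\<theta> \<bullet> b) * (z \<bullet> b))) * complex_of_real (std_normal_density (z \<bullet> b)))" for z :: 'a
    unfolding gauss_def prod.distrib of_real_prod
    by (subst euclidean_inner[of \<theta> z]) (simp add: exp_sum sum_distrib_left)
  then have "(\<integral>z. exp (\<i> * complex_of_real (\<theta> \<bullet> z)) * complex_of_real (gauss z) \<partial>lborel)
    = (\<integral>z. (\<Prod>b\<in>Basis. exp (\<i> * complex_of_real ((\<theta> \<bullet> b) * (z \<bullet> b))) * complex_of_real (std_normal_density (z \<bullet> b))) \<partial>(lborel :: 'a measure))"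
    by (simp only:)
  also have "\<dots> = (\<Prod>b\<in>Basis. complex_of_real (exp (- (\<theta> \<bullet> b)\<^sup>2 / 2)))"
    using lborel_product_integral(2)[where 'a = 'a and g = "\<lambda>b x. exp (\<i> * complex_of_real ((\<theta> \<bullet> b) * x)) * complex_of_real (std_normal_density x)"]
    by (simp only: ch int) (simp add: borel_measurable_integrable[OF int])
  also have "\<dots> = complex_of_real (exp (\<Sum>b\<in>Basis. - (\<theta> \<bullet> b)\<^sup>2 / 2))"
    by (simp add: exp_sum)
  also note sum_neg_half_squares
  finally show ?thesis .
qed

lemma gauss_integral: "(\<integral>z. gauss z \<partial>(lborel :: 'a::euclidean_space measure)) = 1"
proof -
  have "complex_of_real (\<integral>z. gauss z \<partial>(lborel :: 'a measure)) = 1"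
    using gauss_fourier[of "0::'a"] by simp
  then show ?thesis by (simp only: of_real_eq_1_iff)
qed

lemma abs_exp_minus_linear_le: "\<bar>exp u - 1 - u\<bar> \<le> u\<^sup>2 * exp \<bar>u\<bar>" for u :: real
proof -
  obtain t where t: "\<bar>t\<bar> \<le> \<bar>u\<bar>" "exp u = (\<Sum>m<2. u ^ m / fact m) + (exp t / fact 2) * u ^ 2"
    using Maclaurin_exp_le[of u 2] by blast
  have "\<bar>exp u - 1 - u\<bar> = exp t / 2 * u\<^sup>2"
    using t by (simp add: numeral_2_eq_2 abs_mult)
  also have "\<dots> \<le> exp \<bar>u\<bar> * u\<^sup>2"
  proof (rule mult_right_mono)
    have "exp t \<le> exp \<bar>u\<bar>" using t(1) by simp
    then show "exp t / 2 \<le> exp \<bar>u\<bar>" using exp_ge_zero[of t] by linarith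
  qed simp
  finally show ?thesis by (simp add: mult.commute)
qed

text \<open>
  The constant of \<open>gauss_taylor_L1\<close>; the factor is the one of the pointwise bound for \<open>|k| \<le> 1\<close>.
\<close>
definition gauss_const :: "'a::euclidean_space itself \<Rightarrow> real" where
  "gauss_const _ = 3 * exp 2 * (\<integral>z. exp (2 * norm z) * gauss z \<partial>(lborel :: 'a measure))"

lemma lborel_integral_translate:
  fixes f :: "'a::euclidean_space \<Rightarrow> 'b::{banach, second_countable_topology}"
  assumes [measurable]: "f \<in> borel_measurable borel"
  shows "(\<integral>z. f (z + k) \<partial>lborel) = (\<integral>z. f z \<partial>lborel)"
proof -
  have "(\<integral>z. f z \<partial>lborel) = (\<integral>z. f z \<partial>(distr lborel borel ((+) k)))" by (simp add: lborel_distr_plus)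
  also have "\<dots> = (\<integral>z. f (z + k) \<partial>lborel)" by (subst integral_distr) (auto simp: add.commute)
  finally show ?thesis by simp
qed

lemma lborel_integrable_translate:
  fixes f :: "'a::euclidean_space \<Rightarrow> 'b::{banach, second_countable_topology}"
  assumes "integrable lborel f"
  shows "integrable lborel (\<lambda>z. f (z + k))"
proof -
  have "integrable (distr lborel borel ((+) k)) f" using assms by (simp add: lborel_distr_plus)
  then show ?thesis using assms by (subst (asm) integrable_distr_eq) (auto simp: add.commute)
qed

lemma gauss_taylor_integrable:
  "integrable lborel (\<lambda>z::'a::euclidean_space. gauss (z + k) - gauss z + (z \<bullet> k) * gauss z)"
  and gauss_first_moment: "integrable lborel (\<lambda>z::'a. norm z * gauss z)"
proof -
  have "norm z \<le> exp (1 * norm z)" for z :: 'a using exp_ge_add_one_self[of "norm z"] by (simp del: exp_ge_add_one_self)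
  then show *: "integrable lborel (\<lambda>z::'a. norm z * gauss z)"
    by (intro Bochner_Integration.integrable_bound[OF gauss_exp_moment[of 1]]) (auto simp: abs_mult intro!: mult_right_mono)
  have "integrable lborel (\<lambda>z::'a. gauss (z + k))"
    by (rule lborel_integrable_translate[OF gauss_integrable])
  moreover have "\<bar>z \<bullet> k\<bar> * gauss z \<le> norm k * (norm z * gauss z)" for z
    using mult_right_mono[OF Cauchy_Schwarz_ineq2[of z k] gauss_nonneg[of z]] by (simp add: mult_ac)
  then have "integrable lborel (\<lambda>z::'a. (z \<bullet> k) * gauss z)"
    by (intro Bochner_Integration.integrable_bound[OF integrable_mult_right[OF *, of "norm k"]]) (auto simp: abs_mult)
  ultimately show "integrable lborel (\<lambda>z::'a. gauss (z + k) - gauss z + (z \<bullet> k) * gauss z)"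
    using gauss_integrable by (intro Bochner_Integration.integrable_add Bochner_Integration.integrable_diff)
qed


text \<open>
  For \<open>|k| \<le> 1\<close> the quotient \<open>gauss (z + k) / gauss z\<close> is \<open>exp u\<close> with
  \<open>u = - z \<bullet> k - |k|\<^sup>2 / 2\<close>, and the second order remainder of \<open>exp\<close> gives the bound \<open>|k|\<^sup>2\<close>.
  For \<open>|k| \<ge> 1\<close> the three terms are estimated separately by \<open>|k|\<close>. Both are at most \<open>|k|\<^sup>a\<close>.
\<close>
lemma gauss_taylor_L1:
  fixes k :: "'a::euclidean_space"
  assumes a: "1 \<le> a" "a \<le> 2"
  shows "(\<integral>z. \<bar>gauss (z + k) - gauss z + (z \<bullet> k) * gauss z\<bar> \<partial>lborel) \<le> gauss_const TYPE('a) * norm k powr a"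
proof -
  define E where "E = (\<integral>z. exp (2 * norm z) * gauss z \<partial>(lborel :: 'a measure))"
  have intE: "integrable lborel (\<lambda>z::'a. exp (2 * norm z) * gauss z)" by (rule gauss_exp_moment) simp
  have G: "gauss_const TYPE('a) = 3 * exp 2 * E" by (simp add: gauss_const_def E_def)
  have "(\<integral>z. gauss z \<partial>(lborel :: 'a measure)) \<le> E"
    unfolding E_def by (intro integral_mono gauss_integrable intE) (use mult_right_mono[of 1 "exp (2 * norm _)" "gauss _"] in simp)
  then have E1: "1 \<le> E" by (simp add: gauss_integral)
  show ?thesis
  proof (cases "norm k \<le> 1")
    case True
    \<comment> \<open>The term \<open>|k|\<^sup>2 / 2\<close> of \<open>u\<close> is of second order and goes into the remainder.\<close>
    have pt: "\<bar>gauss (z + k) - gauss z + (z \<bullet> k) * gauss z\<bar> \<le> 3 * exp 2 * (norm k)\<^sup>2 * (exp (2 * norm z) * gauss z)" for z :: 'a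
    proof -
      define u where "u = - (z \<bullet> k) - (norm k)\<^sup>2 / 2"
      have "\<bar>u\<bar> \<le> \<bar>z \<bullet> k\<bar> + (norm k)\<^sup>2 / 2"
        unfolding u_def using zero_le_power2[of "norm k"] by arith
      also have "\<dots> \<le> norm z * norm k + norm k * 1"
        using Cauchy_Schwarz_ineq2[of z k] True mult_left_mono[OF True, of "norm k"] norm_ge_zero[of k]
        by (simp add: power2_eq_square del: norm_ge_zero)
      finally have u: "\<bar>u\<bar> \<le> norm k * (norm z + 1)" by (simp add: algebra_simps)
      also have "\<dots> \<le> norm z + 1" using True by (simp add: mult_left_le_one_le)
      finally have u': "\<bar>u\<bar> \<le> norm z + 1" .
      have sq: "(norm z + 1)\<^sup>2 \<le> 2 * exp (norm z + 1)"
        using exp_lower_Taylor_quadratic[of "norm z + 1"] norm_ge_zero[of z] by linarith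
      have "u\<^sup>2 \<le> (norm k * (norm z + 1))\<^sup>2" using u by (metis abs_ge_zero power2_abs power_mono)
      also have "\<dots> \<le> (norm k)\<^sup>2 * (2 * exp (norm z + 1))"
        unfolding power_mult_distrib by (intro mult_left_mono sq) simp
      finally have "u\<^sup>2 * exp \<bar>u\<bar> \<le> (norm k)\<^sup>2 * (2 * exp (norm z + 1)) * exp (norm z + 1)"
        using u' by (intro mult_mono) auto
      also have "\<dots> = 2 * exp 2 * (norm k)\<^sup>2 * exp (2 * norm z)"
        by (simp add: mult_exp_exp algebra_simps)
      finally have e: "\<bar>exp u - 1 - u\<bar> \<le> 2 * exp 2 * (norm k)\<^sup>2 * exp (2 * norm z)"
        using abs_exp_minus_linear_le[of u] by linarith
      have "1 * 1 \<le> exp 2 * exp (2 * norm z)" by (intro mult_mono) auto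
      then have "(norm k)\<^sup>2 * 1 \<le> (norm k)\<^sup>2 * (exp 2 * exp (2 * norm z))" by (intro mult_left_mono) auto
      then have "\<bar>exp u - 1 + z \<bullet> k\<bar> \<le> 3 * exp 2 * (norm k)\<^sup>2 * exp (2 * norm z)"
      proof -
        assume q: "(norm k)\<^sup>2 * 1 \<le> (norm k)\<^sup>2 * (exp 2 * exp (2 * norm z))"
        define X where "X = exp 2 * (norm k)\<^sup>2 * exp (2 * norm z)"
        have "(norm k)\<^sup>2 \<le> X" "\<bar>exp u - 1 - u\<bar> \<le> 2 * X" "0 \<le> (norm k)\<^sup>2"
          using q e by (simp_all add: X_def mult_ac)
        moreover have "exp u - 1 + z \<bullet> k = (exp u - 1 - u) - (norm k)\<^sup>2 / 2" by (simp add: u_def)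
        ultimately have "\<bar>exp u - 1 + z \<bullet> k\<bar> \<le> 3 * X" by linarith
        then show ?thesis by (simp add: X_def mult_ac)
      qed
      then have "\<bar>exp u - 1 + z \<bullet> k\<bar> * gauss z \<le> 3 * exp 2 * (norm k)\<^sup>2 * exp (2 * norm z) * gauss z"
        by (intro mult_right_mono) auto
      moreover have "gauss (z + k) - gauss z + (z \<bullet> k) * gauss z = (exp u - 1 + z \<bullet> k) * gauss z"
        unfolding gauss_add by (simp add: u_def algebra_simps)
      ultimately show ?thesis by (simp add: abs_mult mult.assoc)
    qed
    have "(\<integral>z. \<bar>gauss (z + k) - gauss z + (z \<bullet> k) * gauss z\<bar> \<partial>lborel)
        \<le> (\<integral>z. 3 * exp 2 * (norm k)\<^sup>2 * (exp (2 * norm z) * gauss z) \<partial>(lborel :: 'a measure))"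
    proof (rule integral_mono)
      show "integrable lborel (\<lambda>z. \<bar>gauss (z + k) - gauss z + (z \<bullet> k) * gauss z\<bar>)"
        by (rule integrable_abs[OF gauss_taylor_integrable])
      show "integrable lborel (\<lambda>z::'a. 3 * exp 2 * (norm k)\<^sup>2 * (exp (2 * norm z) * gauss z))"
        by (rule integrable_mult_right[OF intE])
    qed (rule pt)
    also have "\<dots> = 3 * exp 2 * E * (norm k)\<^sup>2" by (simp add: E_def)
    also have "\<dots> \<le> 3 * exp 2 * E * norm k powr a"
    proof (cases "k = 0")
      case False
      have "norm k powr 2 \<le> norm k powr a" using True False a by (intro powr_mono') auto
      then show ?thesis using False E1 by (intro mult_left_mono) (auto simp: powr_numeral)
    qed simp
    also have "\<dots> \<le> gauss_const TYPE('a) * norm k powr a"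
      unfolding G using E1 one_le_exp_iff[of 2] by (intro mult_right_mono) (auto simp del: one_le_exp_iff)
    finally show ?thesis .
  next
    case False
    have pt: "\<bar>gauss (z + k) - gauss z + (z \<bullet> k) * gauss z\<bar> \<le> gauss (z + k) + gauss z + norm k * (norm z * gauss z)" for z :: 'a
    proof -
      have "\<bar>z \<bullet> k\<bar> * gauss z \<le> norm k * (norm z * gauss z)"
        using mult_right_mono[OF Cauchy_Schwarz_ineq2[of z k] gauss_nonneg[of z]] by (simp add: mult_ac)
      then have "\<bar>(z \<bullet> k) * gauss z\<bar> \<le> norm k * (norm z * gauss z)" by (simp add: abs_mult)
      then show ?thesis using gauss_nonneg[of z] gauss_nonneg[of "z + k"] by linarith
    qed
    have intk: "integrable lborel (\<lambda>z::'a. gauss (z + k))"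
      by (rule lborel_integrable_translate[OF gauss_integrable])
    have "norm z \<le> exp (2 * norm z)" for z :: 'a
      using exp_ge_add_one_self[of "2 * norm z"] norm_ge_zero[of z] by linarith
    then have m: "(\<integral>z. norm z * gauss z \<partial>(lborel :: 'a measure)) \<le> E"
      unfolding E_def by (intro integral_mono gauss_first_moment intE) (simp add: mult_right_mono)
    have "(\<integral>z. \<bar>gauss (z + k) - gauss z + (z \<bullet> k) * gauss z\<bar> \<partial>lborel)
        \<le> (\<integral>z. gauss (z + k) + gauss z + norm k * (norm z * gauss z) \<partial>lborel)"
      by (intro integral_mono integrable_abs gauss_taylor_integrable Bochner_Integration.integrable_add integrable_mult_right gauss_first_moment gauss_integrable intk pt)
    also have "\<dots> = 1 + 1 + norm k * (\<integral>z. norm z * gauss z \<partial>(lborel :: 'a measure))"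
      by (simp only: Bochner_Integration.integral_add[OF Bochner_Integration.integrable_add[OF intk gauss_integrable] integrable_mult_right[OF gauss_first_moment]]
          Bochner_Integration.integral_add[OF intk gauss_integrable] lborel_integral_translate[OF gauss_measurable] gauss_integral integral_mult_right_zero)
    also have "\<dots> \<le> 2 * E * norm k + E * norm k"
      using False E1 m mult_mono[of 1 E 1 "norm k"] mult_left_mono[OF m, of "norm k"] by (simp add: mult.commute)
    also have "\<dots> = 3 * E * norm k powr 1" using False by simp
    also have "\<dots> \<le> 3 * E * norm k powr a" using False a E1 by (intro mult_left_mono powr_mono) auto
    also have "\<dots> \<le> gauss_const TYPE('a) * norm k powr a"
      unfolding G using E1 one_le_exp_iff[of 2] by (intro mult_right_mono) (auto simp del: one_le_exp_iff)
    finally show ?thesis .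
  qed
qed

lemma lborel_distr_uminus_euclidean: "distr lborel borel uminus = (lborel :: 'a::euclidean_space measure)"
  using lborel_affine[of "-1" "0::'a"] by (simp add: density_1)

lemma gauss_mean_zero: "(\<integral>z. gauss z *\<^sub>R z \<partial>(lborel :: 'a::euclidean_space measure)) = 0"
proof -
  have "(\<integral>z. gauss z *\<^sub>R z \<partial>(lborel :: 'a measure)) = (\<integral>z. gauss z *\<^sub>R z \<partial>(distr lborel borel uminus :: 'a measure))"
    by (simp add: lborel_distr_uminus_euclidean)
  also have "\<dots> = (\<integral>z. - (gauss z *\<^sub>R z) \<partial>(lborel :: 'a measure))"
    by (subst integral_distr) (auto simp: gauss_minus)
  also have "\<dots> = - (\<integral>z. gauss z *\<^sub>R z \<partial>(lborel :: 'a measure))" by simp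
  finally have "2 *\<^sub>R (\<integral>z. gauss z *\<^sub>R z \<partial>(lborel :: 'a measure)) = 0"
    using eq_neg_iff_add_eq_0 by (metis scaleR_2)
  then show ?thesis by simp
qed


text \<open>
  The random vector \<open>Y\<close> has the isotropic stable law of index \<open>2s\<close>; the mean of \<open>g (x - c Y)\<close> is the
  fractional heat semigroup at the time \<open>c\<^bsup>2s\<^esup>\<close>. The vector \<open>\<Psi>\<close> plays the role of the logarithmic
  derivative of the density of \<open>Y\<close>: the gradient of this mean is \<open>1/c\<close> times the mean of
  \<open>g (x - c Y) \<Psi>\<close>.
\<close>
locale stable_kernel = prob_space N for N :: "'w measure" +
  fixes Y \<Psi> :: "'w \<Rightarrow> 'a::euclidean_space" and s a K :: real
  assumes Y_meas [measurable]: "Y \<in> borel_measurable N"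
    and \<Psi>_meas [measurable]: "\<Psi> \<in> borel_measurable N"
    and exponents: "1 / 2 < s" "s < 1" "1 < a" "a < 2 * s"
    and Y_fourier: "(\<integral>\<omega>. exp (\<i> * complex_of_real (\<theta> \<bullet> Y \<omega>)) \<partial>N) = complex_of_real (exp (- (norm \<theta> powr (2 * s))))"
    and Y_moment: "integrable N (\<lambda>\<omega>. norm (Y \<omega>) powr a)"
    and Y_mean: "integrable N Y" "(\<integral>\<omega>. Y \<omega> \<partial>N) = 0"
    and \<Psi>_integrable: "integrable N \<Psi>"
    and smoothing: "\<lbrakk>f \<in> borel_measurable borel; \<And>x. \<bar>f x\<bar> \<le> M; 0 < c\<rbrakk> \<Longrightarrow>
      \<bar>(\<integral>\<omega>. f (x + h - c *\<^sub>R Y \<omega>) \<partial>N) - (\<integral>\<omega>. f (x - c *\<^sub>R Y \<omega>) \<partial>N) - ((1 / c) *\<^sub>R (\<integral>\<omega>. f (x - c *\<^sub>R Y \<omega>) *\<^sub>R \<Psi> \<omega> \<partial>N)) \<bullet> h\<bar>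
        \<le> M * (K * c powr (- a)) * norm h powr a"

definition gauss_measure :: "'a::euclidean_space measure" where
  "gauss_measure = density lborel gauss"

lemma sets_gauss_measure [measurable_cong, simp]: "sets gauss_measure = sets borel"
  by (simp add: gauss_measure_def)

lemma space_gauss_measure [simp]: "space gauss_measure = UNIV"
  by (simp add: gauss_measure_def)

lemma prob_space_gauss: "prob_space (gauss_measure :: 'a::euclidean_space measure)"
proof
  have "(\<integral>\<^sup>+z. ennreal (gauss z) \<partial>(lborel :: 'a measure)) = ennreal 1"
    by (subst nn_integral_eq_integral) (simp_all add: gauss_integrable gauss_integral)
  then show "emeasure gauss_measure (space (gauss_measure :: 'a measure)) = 1"
    by (simp add: gauss_measure_def emeasure_density)
qed

lemma integral_gauss_measure:
  fixes f :: "'a::euclidean_space \<Rightarrow> 'b::{banach, second_countable_topology}"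
  assumes "f \<in> borel_measurable borel"
  shows "(\<integral>z. f z \<partial>gauss_measure) = (\<integral>z. gauss z *\<^sub>R f z \<partial>lborel)"
    and "integrable gauss_measure f \<longleftrightarrow> integrable lborel (\<lambda>z. gauss z *\<^sub>R f z)"
  unfolding gauss_measure_def using assms by (auto simp: integral_density integrable_density)

lemma (in pair_sigma_finite) integrable_scaleR_product:
  fixes f :: "'a \<Rightarrow> real" and g :: "'b \<Rightarrow> 'c::{banach, second_countable_topology}"
  assumes f: "integrable M1 f" and g: "integrable M2 g"
  shows "integrable (M1 \<Otimes>\<^sub>M M2) (\<lambda>(x, y). f x *\<^sub>R g y)"
proof (rule Fubini_integrable)
  note [measurable] = borel_measurable_integrable[OF f] borel_measurable_integrable[OF g]
  show "(\<lambda>(x, y). f x *\<^sub>R g y) \<in> borel_measurable (M1 \<Otimes>\<^sub>M M2)" by measurable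
  show "integrable M1 (\<lambda>x. \<integral>y. norm (case (x, y) of (x, y) \<Rightarrow> f x *\<^sub>R g y) \<partial>M2)"
    using f by simp
  show "AE x in M1. integrable M2 (\<lambda>y. case (x, y) of (x, y) \<Rightarrow> f x *\<^sub>R g y)"
    using g by simp
qed

lemma (in pair_sigma_finite) integral_scaleR_product:
  fixes f :: "'a \<Rightarrow> real" and g :: "'b \<Rightarrow> 'c::{banach, second_countable_topology}"
  assumes f: "integrable M1 f" and g: "integrable M2 g"
  shows "(\<integral>(x, y). f x *\<^sub>R g y \<partial>(M1 \<Otimes>\<^sub>M M2)) = (\<integral>x. f x \<partial>M1) *\<^sub>R (\<integral>y. g y \<partial>M2)"
  using integral_fst'[OF integrable_scaleR_product[OF f g]] f g by simp

text \<open>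
  A translation of the integration variable moves the increment \<open>h\<close> of the argument of \<open>f\<close> to an
  increment \<open>k = h / r\<close> of the Gaussian density, so that \<open>f\<close> needs no regularity.
\<close>
lemma gauss_scaled_taylor:
  fixes f :: "'a::euclidean_space \<Rightarrow> real"
  assumes [measurable]: "f \<in> borel_measurable borel" and M: "\<And>x. \<bar>f x\<bar> \<le> M"
    and r: "0 < r" and a: "1 \<le> a" "a \<le> 2"
  shows "\<bar>(\<integral>z. f (x + h - r *\<^sub>R z) \<partial>gauss_measure) - (\<integral>z. f (x - r *\<^sub>R z) \<partial>gauss_measure)
     - (\<integral>z. f (x - r *\<^sub>R z) *\<^sub>R (- (1 / r)) *\<^sub>R z \<partial>gauss_measure) \<bullet> h\<bar>
    \<le> M * gauss_const TYPE('a) * (r powr (- a) * norm h powr a)"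
proof -
  define k where "k = (1 / r) *\<^sub>R h"
  have M0: "0 \<le> M" using M[of 0] by simp
  have int: "integrable lborel (\<lambda>z. g z * f (F z))"
    if "integrable lborel g" "F \<in> borel_measurable borel" for g :: "'a \<Rightarrow> real" and F
  proof (rule Bochner_Integration.integrable_bound[OF integrable_mult_right[OF that(1), of M]])
    show "(\<lambda>z. g z * f (F z)) \<in> borel_measurable lborel"
      using that by (auto dest!: borel_measurable_integrable)
    show "AE z in lborel. norm (g z * f (F z)) \<le> norm (M * g z)"
      using M M0 by (intro AE_I2) (auto simp: abs_mult mult.commute[of M] intro!: mult_left_mono)
  qed
  have gk: "integrable lborel (\<lambda>z. gauss (z + k))"
    by (rule lborel_integrable_translate[OF gauss_integrable])
  have gv: "integrable lborel (\<lambda>z::'a. (z \<bullet> k) * gauss z)"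
    using Bochner_Integration.integrable_diff[OF gauss_taylor_integrable[of k] Bochner_Integration.integrable_diff[OF gk gauss_integrable]]
    by simp
  have 1: "(\<integral>z. f (x + h - r *\<^sub>R z) \<partial>gauss_measure) = (\<integral>z. gauss (z + k) * f (x - r *\<^sub>R z) \<partial>lborel)"
  proof -
    have "(\<integral>z. f (x + h - r *\<^sub>R z) \<partial>gauss_measure) = (\<integral>z. gauss z * f (x + h - r *\<^sub>R z) \<partial>lborel)"
      by (subst integral_gauss_measure) auto
    also have "\<dots> = (\<integral>z. gauss (z + k) * f (x + h - r *\<^sub>R (z + k)) \<partial>lborel)"
      by (rule lborel_integral_translate[symmetric]) simp
    also have "\<dots> = (\<integral>z. gauss (z + k) * f (x - r *\<^sub>R z) \<partial>lborel)"
      using r by (simp add: k_def scaleR_add_right)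
    finally show ?thesis .
  qed
  have 2: "(\<integral>z. f (x - r *\<^sub>R z) \<partial>gauss_measure) = (\<integral>z. gauss z * f (x - r *\<^sub>R z) \<partial>lborel)"
    by (subst integral_gauss_measure) auto
  have gz: "integrable lborel (\<lambda>z::'a. gauss z *\<^sub>R (f (x - r *\<^sub>R z) *\<^sub>R (- (1 / r)) *\<^sub>R z))"
  proof (rule Bochner_Integration.integrable_bound[OF integrable_mult_right[OF gauss_first_moment, of "M / r"]])
    show "AE z in lborel. norm (gauss z *\<^sub>R (f (x - r *\<^sub>R z) *\<^sub>R (- (1 / r)) *\<^sub>R z)) \<le> norm (M / r * (norm z * gauss z))"
    proof (rule AE_I2)
      fix z :: 'a
      have "\<bar>f (x - r *\<^sub>R z)\<bar> * (norm z * gauss z / r) \<le> M * (norm z * gauss z / r)"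
        using M r by (intro mult_right_mono) auto
      then show "norm (gauss z *\<^sub>R (f (x - r *\<^sub>R z) *\<^sub>R (- (1 / r)) *\<^sub>R z)) \<le> norm (M / r * (norm z * gauss z))"
        using r M0 by (simp add: abs_mult mult_ac)
    qed
  qed measurable
  have 3: "(\<integral>z. f (x - r *\<^sub>R z) *\<^sub>R (- (1 / r)) *\<^sub>R z \<partial>gauss_measure) \<bullet> h = - (\<integral>z. ((z \<bullet> k) * gauss z) * f (x - r *\<^sub>R z) \<partial>lborel)"
  proof -
    have "(\<integral>z. f (x - r *\<^sub>R z) *\<^sub>R (- (1 / r)) *\<^sub>R z \<partial>gauss_measure) \<bullet> h
        = (\<integral>z. gauss z *\<^sub>R (f (x - r *\<^sub>R z) *\<^sub>R (- (1 / r)) *\<^sub>R z) \<bullet> h \<partial>lborel)"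
      by (subst integral_inner_left[OF gz], subst integral_gauss_measure) simp_all
    also have "\<dots> = (\<integral>z. - (((z \<bullet> k) * gauss z) * f (x - r *\<^sub>R z)) \<partial>lborel)"
      by (intro Bochner_Integration.integral_cong) (auto simp: k_def)
    finally show ?thesis by simp
  qed
  have "(\<integral>z. f (x + h - r *\<^sub>R z) \<partial>gauss_measure) - (\<integral>z. f (x - r *\<^sub>R z) \<partial>gauss_measure)
     - (\<integral>z. f (x - r *\<^sub>R z) *\<^sub>R (- (1 / r)) *\<^sub>R z \<partial>gauss_measure) \<bullet> h
    = (\<integral>z. (gauss (z + k) - gauss z + (z \<bullet> k) * gauss z) * f (x - r *\<^sub>R z) \<partial>lborel)"
    unfolding 1 2 3 distrib_right left_diff_distrib
    by (subst Bochner_Integration.integral_add; (subst Bochner_Integration.integral_diff)?)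
       (auto intro!: int gk gv gauss_integrable Bochner_Integration.integrable_diff)
  also have "\<bar>\<dots>\<bar> \<le> (\<integral>z. M * \<bar>gauss (z + k) - gauss z + (z \<bullet> k) * gauss z\<bar> \<partial>lborel)"
  proof (rule integral_abs_bound_integral)
    show "integrable lborel (\<lambda>z. (gauss (z + k) - gauss z + (z \<bullet> k) * gauss z) * f (x - r *\<^sub>R z))"
      by (intro int gauss_taylor_integrable) simp
    show "integrable lborel (\<lambda>z. M * \<bar>gauss (z + k) - gauss z + (z \<bullet> k) * gauss z\<bar>)"
      by (intro integrable_mult_right integrable_abs gauss_taylor_integrable)
    show "\<bar>(gauss (z + k) - gauss z + (z \<bullet> k) * gauss z) * f (x - r *\<^sub>R z)\<bar> \<le> M * \<bar>gauss (z + k) - gauss z + (z \<bullet> k) * gauss z\<bar>" for z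
      using M by (simp add: abs_mult mult.commute[of M] mult_left_mono)
  qed
  also have "\<dots> = M * (\<integral>z. \<bar>gauss (z + k) - gauss z + (z \<bullet> k) * gauss z\<bar> \<partial>lborel)" by simp
  also have "\<dots> \<le> M * (gauss_const TYPE('a) * norm k powr a)"
    by (intro mult_left_mono gauss_taylor_L1 a M0)
  also have "norm k powr a = r powr (- a) * norm h powr a"
    using r by (simp add: k_def powr_mult powr_divide powr_minus_divide)
  finally show ?thesis by (simp add: mult.assoc)
qed


text \<open>
  Reduces negative moments of order at most \<open>1\<close> to the moment of order \<open>-1\<close>.
\<close>
lemma powr_minus_le_one_plus_inverse:
  fixes x :: real
  assumes "0 < x" "0 \<le> b" "b \<le> 1"
  shows "x powr (- b) \<le> 1 + 1 / x"
proof (cases "1 \<le> x")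
  case True
  then have "x powr (- b) \<le> 1" using assms by (simp add: powr_minus_divide ge_one_powr_ge_zero)
  then show ?thesis using assms by (simp add: add_increasing2)
next
  case False
  then have "x powr (- b) \<le> x powr (- 1)" using assms by (intro powr_mono') auto
  then show ?thesis using assms by (simp add: powr_minus_divide)
qed

text \<open>
  For \<open>Y = \<surd>(2t) z\<close> with \<open>t\<close> drawn from the stable subordinator and an independent Gaussian \<open>z\<close>, the
  Gaussian Fourier transform \<open>exp (- t |\<theta>|\<^sup>2)\<close> is averaged to \<open>exp (- |\<theta>|\<^bsup>2s\<^esup>)\<close>. The remaining
  properties follow from the Gaussian ones by integration over \<open>t\<close>: smoothing costs the moment of
  \<open>\<surd>(2t)\<close> of order \<open>-a\<close>, and the moment of \<open>Y\<close> costs the one of order \<open>a < 2s\<close>.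
\<close>
lemma stable_kernel_exists:
  assumes s: "1 / 2 < s" "s < 1" and a: "1 < a" "a < 2 * s"
  shows "\<exists>(N :: (real \<times> 'a::euclidean_space) measure) Y \<Psi> K. stable_kernel N Y (\<Psi> :: _ \<Rightarrow> 'a) s a K"
proof -
  obtain \<mu> where rd: "real_distribution \<mu>" and pos: "AE t in \<mu>. 0 < t"
    and Lap: "\<And>l. 0 \<le> l \<Longrightarrow> integral\<^sup>L \<mu> (\<lambda>t. exp (- l * max t 0)) = exp (- (l powr s))"
    using stable_subordinator_exists[of s] s by auto
  interpret \<mu>: real_distribution \<mu> by (rule rd)
  interpret G: prob_space "gauss_measure :: 'a measure" by (rule prob_space_gauss)
  interpret P: pair_prob_space \<mu> "gauss_measure :: 'a measure" ..
  define N where "N = \<mu> \<Otimes>\<^sub>M (gauss_measure :: 'a measure)"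
  define R where "R = (\<lambda>t::real. sqrt (2 * t))"
  define Y :: "real \<times> 'a \<Rightarrow> 'a" where "Y = (\<lambda>(t, z). R t *\<^sub>R z)"
  define \<Psi> :: "real \<times> 'a \<Rightarrow> 'a" where "\<Psi> = (\<lambda>(t, z). (- (1 / R t)) *\<^sub>R z)"
  have [measurable]: "R \<in> borel_measurable borel" unfolding R_def by measurable
  have setsN: "sets N = sets (borel \<Otimes>\<^sub>M borel)" unfolding N_def by (intro sets_pair_measure_cong) auto
  have inv: "integrable \<mu> (\<lambda>t. 1 / t)"
    using s by (intro stable_subordinator_inverse_moment[OF rd pos _ Lap]) auto
  have Rpow: "R t powr b = 2 powr (b / 2) * t powr (b / 2)" if "0 < t" for t b
    using that by (simp add: R_def powr_half_sqrt[symmetric] powr_powr powr_mult)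
  have neg: "integrable \<mu> (\<lambda>t. R t powr (- b))" if b: "0 \<le> b" "b \<le> 2" for b
  proof (rule Bochner_Integration.integrable_bound)
    show "integrable \<mu> (\<lambda>t. 2 powr (- b / 2) * (1 + 1 / t))" using inv by simp
    show "AE t in \<mu>. norm (R t powr (- b)) \<le> norm (2 powr (- b / 2) * (1 + 1 / t))"
      using pos
    proof eventually_elim
      case (elim t)
      have "t powr (- (b / 2)) \<le> 1 + 1 / t" using elim b by (intro powr_minus_le_one_plus_inverse) auto
      then have "2 powr (- b / 2) * t powr (- (b / 2)) \<le> 2 powr (- b / 2) * (1 + 1 / t)" by (intro mult_left_mono) auto
      then show ?case using elim by (simp add: Rpow)
    qed
  qed simp
  have posm: "integrable \<mu> (\<lambda>t. R t powr b)" if b: "0 < b" "b < 2 * s" for b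
  proof (rule Bochner_Integration.integrable_bound)
    show "integrable \<mu> (\<lambda>t. 2 powr (b / 2) * t powr (b / 2))"
      using b s by (intro integrable_mult_right stable_subordinator_moment[OF rd pos _ _ Lap]) auto
    show "AE t in \<mu>. norm (R t powr b) \<le> norm (2 powr (b / 2) * t powr (b / 2))"
      using pos by eventually_elim (simp add: Rpow)
  qed simp
  have zpow: "integrable gauss_measure (\<lambda>z::'a. norm z powr b)" if b: "1 \<le> b" "b \<le> 2" for b
  proof -
    have "integrable lborel (\<lambda>z::'a. gauss z *\<^sub>R norm z powr b)"
    proof (rule Bochner_Integration.integrable_bound[OF gauss_exp_moment[of 2]])
      show "AE z in lborel. norm (gauss z *\<^sub>R norm z powr b) \<le> norm (exp (2 * norm z) * gauss (z::'a))"
      proof (rule AE_I2)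
        fix z :: 'a
        have "norm z powr b \<le> exp (norm z) powr b"
          using b exp_ge_add_one_self[of "norm z"]
          by (intro powr_mono2) (linarith, simp, linarith)
        also have "\<dots> = exp (b * norm z)" by (simp add: powr_def)
        also have "\<dots> \<le> exp (2 * norm z)" using b by (simp add: mult_right_mono)
        finally have "norm z powr b * gauss z \<le> exp (2 * norm z) * gauss z" by (intro mult_right_mono) auto
        then show "norm (gauss z *\<^sub>R norm z powr b) \<le> norm (exp (2 * norm z) * gauss (z::'a))"
          by (simp add: abs_mult mult.commute)
      qed
    qed simp_all
    then show ?thesis by (subst integral_gauss_measure) auto
  qed
  have zint: "integrable gauss_measure (\<lambda>z::'a. z)"
    using zpow[of 1] by (subst integrable_norm_iff[symmetric]) auto
  have zmean: "(\<integral>z. z \<partial>(gauss_measure :: 'a measure)) = 0"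
    by (subst integral_gauss_measure) (simp_all add: gauss_mean_zero)
  have Rint: "integrable \<mu> R"
    using posm[of 1] s by (rule_tac integrable_cong_AE_imp[where g = "\<lambda>t. R t powr 1"])
      (auto intro!: eventually_mono[OF pos] simp: R_def)
  have Rinv: "integrable \<mu> (\<lambda>t. - (1 / R t))"
    using neg[of 1] by (intro Bochner_Integration.integrable_minus, rule_tac integrable_cong_AE_imp[where g = "\<lambda>t. R t powr (- 1)"])
      (auto intro!: eventually_mono[OF pos] simp: R_def powr_minus_divide)
  define K\<mu> where "K\<mu> = (\<integral>t. R t powr (- a) \<partial>\<mu>)"
  have "stable_kernel N Y \<Psi> s a (gauss_const TYPE('a) * K\<mu>)"
  proof (intro stable_kernel.intro stable_kernel_axioms.intro)
    show "prob_space N" unfolding N_def by (rule P.prob_space_axioms)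
    show Ym [measurable]: "Y \<in> borel_measurable N" unfolding Y_def N_def by measurable
    show \<Psi>m [measurable]: "\<Psi> \<in> borel_measurable N" unfolding \<Psi>_def N_def by measurable
    show "1 / 2 < s" "s < 1" "1 < a" "a < 2 * s" by fact+
    show "(\<integral>\<omega>. exp (\<i> * complex_of_real (\<theta> \<bullet> Y \<omega>)) \<partial>N) = complex_of_real (exp (- (norm \<theta> powr (2 * s))))" for \<theta>
    proof -
      have "(\<integral>\<omega>. exp (\<i> * complex_of_real (\<theta> \<bullet> Y \<omega>)) \<partial>N) = (\<integral>t. (\<integral>z. exp (\<i> * complex_of_real (\<theta> \<bullet> Y (t, z))) \<partial>gauss_measure) \<partial>\<mu>)"
        unfolding N_def
        by (intro P.integral_fst'[symmetric] P.integrable_const_bound[where B = 1]) (use Ym in \<open>auto simp: N_def\<close>)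
      also have "\<dots> = (\<integral>t. complex_of_real (exp (- (norm \<theta>)\<^sup>2 * max t 0)) \<partial>\<mu>)"
      proof (intro integral_cong_AE eventually_mono[OF pos])
        fix t :: real assume t: "0 < t"
        have "(\<integral>z. exp (\<i> * complex_of_real (\<theta> \<bullet> Y (t, z))) \<partial>gauss_measure)
          = (\<integral>z. exp (\<i> * complex_of_real ((R t *\<^sub>R \<theta>) \<bullet> z)) * complex_of_real (gauss z) \<partial>lborel)"
          by (subst integral_gauss_measure) (auto simp: Y_def scaleR_conv_of_real mult.commute)
        also have "\<dots> = complex_of_real (exp (- (norm (R t *\<^sub>R \<theta>))\<^sup>2 / 2))" by (rule gauss_fourier)
        also have "- (norm (R t *\<^sub>R \<theta>))\<^sup>2 / 2 = - (norm \<theta>)\<^sup>2 * max t 0"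
          using t by (simp add: R_def power_mult_distrib)
        finally show "(\<integral>z. exp (\<i> * complex_of_real (\<theta> \<bullet> Y (t, z))) \<partial>gauss_measure) = complex_of_real (exp (- (norm \<theta>)\<^sup>2 * max t 0))" .
      qed (use Ym in \<open>auto simp: N_def\<close>)
      also have "\<dots> = complex_of_real (exp (- ((norm \<theta>)\<^sup>2 powr s)))"
        using Lap[of "(norm \<theta>)\<^sup>2"] by simp
      also have "(norm \<theta>)\<^sup>2 powr s = norm \<theta> powr (2 * s)"
        by (cases "\<theta> = 0") (auto simp: powr_powr powr_numeral[symmetric] simp del: powr_numeral)
      finally show ?thesis .
    qed
    show "integrable N (\<lambda>\<omega>. norm (Y \<omega>) powr a)"
    proof (rule Bochner_Integration.integrable_bound)
      show "integrable N (\<lambda>(t, z). (\<bar>R t\<bar> powr a) *\<^sub>R (norm z powr a))"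
        unfolding N_def
      proof (intro P.integrable_scaleR_product)
        show "integrable \<mu> (\<lambda>t. \<bar>R t\<bar> powr a)"
          using posm[of a] a by (rule_tac integrable_cong_AE_imp[where g = "\<lambda>t. R t powr a"])
            (auto intro!: eventually_mono[OF pos] simp: R_def)
        show "integrable gauss_measure (\<lambda>z::'a. norm z powr a)"
          using a s by (intro zpow) auto
      qed
      show "AE \<omega> in N. norm (norm (Y \<omega>) powr a) \<le> norm (case \<omega> of (t, z) \<Rightarrow> (\<bar>R t\<bar> powr a) *\<^sub>R (norm z powr a))"
      proof (rule AE_I2)
        fix \<omega> :: "real \<times> 'a"
        have "norm (Y \<omega>) powr a = \<bar>R (fst \<omega>)\<bar> powr a * norm (snd \<omega>) powr a"
          by (simp add: Y_def case_prod_beta powr_mult)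
        then show "norm (norm (Y \<omega>) powr a) \<le> norm (case \<omega> of (t, z) \<Rightarrow> (\<bar>R t\<bar> powr a) *\<^sub>R (norm z powr a))"
          by (simp add: case_prod_beta)
      qed
    qed simp
    show "integrable N Y" "(\<integral>\<omega>. Y \<omega> \<partial>N) = 0"
      unfolding N_def Y_def using Rint zint by (auto simp: P.integral_scaleR_product zmean intro: P.integrable_scaleR_product)
    show \<Psi>int: "integrable N \<Psi>"
      unfolding N_def \<Psi>_def using Rinv zint by (rule P.integrable_scaleR_product)
    fix f :: "'a \<Rightarrow> real" and M c :: real and x h :: 'a
    assume f [measurable]: "f \<in> borel_measurable borel" and M: "\<And>x. \<bar>f x\<bar> \<le> M" and c: "0 < c"
    have M0: "0 \<le> M" using M[of 0] by simp
    have intf: "integrable N (\<lambda>\<omega>. f (y - c *\<^sub>R Y \<omega>))" for y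
      unfolding N_def using M by (intro P.integrable_const_bound[where B = M]) (use Ym in \<open>auto simp: N_def\<close>)
    have int\<Psi>: "integrable N (\<lambda>\<omega>. f (x - c *\<^sub>R Y \<omega>) *\<^sub>R \<Psi> \<omega>)"
    proof (rule Bochner_Integration.integrable_bound[OF integrable_scaleR_right[OF \<Psi>int, of M]])
      show "AE \<omega> in N. norm (f (x - c *\<^sub>R Y \<omega>) *\<^sub>R \<Psi> \<omega>) \<le> norm (M *\<^sub>R \<Psi> \<omega>)"
        using M M0 by (intro AE_I2) (auto intro!: mult_right_mono)
    qed simp
    define D where "D = (\<lambda>\<omega>. f (x + h - c *\<^sub>R Y \<omega>) - f (x - c *\<^sub>R Y \<omega>) - (1 / c) * ((f (x - c *\<^sub>R Y \<omega>) *\<^sub>R \<Psi> \<omega>) \<bullet> h))"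
    have int\<Psi>': "integrable N (\<lambda>\<omega>. (f (x - c *\<^sub>R Y \<omega>) *\<^sub>R \<Psi> \<omega>) \<bullet> h)"
      using int\<Psi> by (rule integrable_inner_left)
    have intD: "integrable N D"
      unfolding D_def
      by (intro Bochner_Integration.integrable_diff intf integrable_mult_right int\<Psi>')
    have "(\<integral>\<omega>. f (x + h - c *\<^sub>R Y \<omega>) \<partial>N) - (\<integral>\<omega>. f (x - c *\<^sub>R Y \<omega>) \<partial>N) - ((1 / c) *\<^sub>R (\<integral>\<omega>. f (x - c *\<^sub>R Y \<omega>) *\<^sub>R \<Psi> \<omega> \<partial>N)) \<bullet> h
      = (\<integral>\<omega>. D \<omega> \<partial>N)"
    proof -
      have "(\<integral>\<omega>. D \<omega> \<partial>N) = (\<integral>\<omega>. f (x + h - c *\<^sub>R Y \<omega>) \<partial>N) - (\<integral>\<omega>. f (x - c *\<^sub>R Y \<omega>) \<partial>N) - (\<integral>\<omega>. (1 / c) * ((f (x - c *\<^sub>R Y \<omega>) *\<^sub>R \<Psi> \<omega>) \<bullet> h) \<partial>N)"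
        unfolding D_def
        by (simp only: Bochner_Integration.integral_diff[OF Bochner_Integration.integrable_diff[OF intf intf] integrable_mult_right[OF int\<Psi>']]
            Bochner_Integration.integral_diff[OF intf intf])
      also have "(\<integral>\<omega>. (1 / c) * ((f (x - c *\<^sub>R Y \<omega>) *\<^sub>R \<Psi> \<omega>) \<bullet> h) \<partial>N) = (1 / c) * ((\<integral>\<omega>. f (x - c *\<^sub>R Y \<omega>) *\<^sub>R \<Psi> \<omega> \<partial>N) \<bullet> h)"
        using integral_inner_left[OF int\<Psi>, of h] by (simp only: integral_mult_right_zero)
      finally show ?thesis by (simp only: inner_scaleR_left)
    qed
    also have "\<dots> = (\<integral>t. (\<integral>z. D (t, z) \<partial>gauss_measure) \<partial>\<mu>)"
      using P.integral_fst'[OF intD[unfolded N_def]] unfolding N_def by simp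
    also have "\<bar>\<dots>\<bar> \<le> (\<integral>t. M * (gauss_const TYPE('a) * c powr (- a) * norm h powr a) * R t powr (- a) \<partial>\<mu>)"
    proof (rule order_trans[OF integral_abs_bound integral_mono_AE])
      show "integrable \<mu> (\<lambda>t. \<bar>\<integral>z. D (t, z) \<partial>gauss_measure\<bar>)"
        using P.integrable_fst'[OF intD[unfolded N_def]] by simp
      show "integrable \<mu> (\<lambda>t. M * (gauss_const TYPE('a) * c powr (- a) * norm h powr a) * R t powr (- a))"
        using neg[of a] a s by simp
      show "AE t in \<mu>. \<bar>\<integral>z. D (t, z) \<partial>gauss_measure\<bar> \<le> M * (gauss_const TYPE('a) * c powr (- a) * norm h powr a) * R t powr (- a)"
        using pos P.AE_integrable_fst'[OF int\<Psi>[unfolded N_def]]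
      proof eventually_elim
        case (elim t)
        define r where "r = c * R t"
        have r: "0 < r" using elim c by (simp add: r_def R_def)
        have b: "integrable gauss_measure (\<lambda>z. f (y - r *\<^sub>R z))" for y
          using M by (intro G.integrable_const_bound[where B = M]) auto
        have i: "integrable gauss_measure (\<lambda>z. (f (x - c *\<^sub>R Y (t, z)) *\<^sub>R \<Psi> (t, z)) \<bullet> h)"
          using elim by (intro integrable_inner_left) auto
        have e: "(1 / c) * ((f (x - c *\<^sub>R Y (t, z)) *\<^sub>R \<Psi> (t, z)) \<bullet> h) = (f (x - r *\<^sub>R z) *\<^sub>R (- (1 / r)) *\<^sub>R z) \<bullet> h" for z
          by (simp add: Y_def \<Psi>_def r_def)
        have i': "integrable gauss_measure (\<lambda>z. f (x - r *\<^sub>R z) *\<^sub>R (- (1 / r)) *\<^sub>R z)"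
          using integrable_scaleR_right[OF elim(2), of "1 / c"] by (simp add: Y_def \<Psi>_def r_def mult.commute)
        have "(\<integral>z. D (t, z) \<partial>gauss_measure) = (\<integral>z. f (x + h - r *\<^sub>R z) - f (x - r *\<^sub>R z) - (f (x - r *\<^sub>R z) *\<^sub>R (- (1 / r)) *\<^sub>R z) \<bullet> h \<partial>gauss_measure)"
          unfolding D_def e by (simp add: Y_def r_def)
        also have "\<dots> = (\<integral>z. f (x + h - r *\<^sub>R z) \<partial>gauss_measure) - (\<integral>z. f (x - r *\<^sub>R z) \<partial>gauss_measure)
            - (\<integral>z. f (x - r *\<^sub>R z) *\<^sub>R (- (1 / r)) *\<^sub>R z \<partial>gauss_measure) \<bullet> h"
          using b[of "x + h"] b[of x] integrable_inner_left[OF i', of h]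
          by (simp only: Bochner_Integration.integral_diff Bochner_Integration.integrable_diff integral_inner_left[OF i'])
        also have "\<bar>\<dots>\<bar> \<le> M * gauss_const TYPE('a) * (r powr (- a) * norm h powr a)"
          using a s by (intro gauss_scaled_taylor f M r) auto
        also have "r powr (- a) = c powr (- a) * R t powr (- a)"
          using c elim by (simp add: r_def powr_mult)
        finally show ?case by (simp add: mult_ac)
      qed
    qed
    also have "\<dots> = M * (gauss_const TYPE('a) * K\<mu> * c powr (- a)) * norm h powr a"
      by (simp add: K\<mu>_def)
    finally show "\<bar>(\<integral>\<omega>. f (x + h - c *\<^sub>R Y \<omega>) \<partial>N) - (\<integral>\<omega>. f (x - c *\<^sub>R Y \<omega>) \<partial>N) - ((1 / c) *\<^sub>R (\<integral>\<omega>. f (x - c *\<^sub>R Y \<omega>) *\<^sub>R \<Psi> \<omega> \<partial>N)) \<bullet> h\<bar>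
        \<le> M * (gauss_const TYPE('a) * K\<mu> * c powr (- a)) * norm h powr a" .
  qed
  then show ?thesis by blast
qed

section \<open>Integration and Fourier coefficients on the torus\<close>

text \<open>
  The half-open cube, so that its lattice translates are a partition of the space.
\<close>
definition unit_cell :: "(real ^ 'd) set" where
  "unit_cell = {x. \<forall>i. 0 \<le> x $ i \<and> x $ i < 1}"

definition cell_measure :: "(real ^ 'd) measure" where
  "cell_measure = density lborel (indicator unit_cell)"

definition frac_vec :: "real ^ 'd \<Rightarrow> real ^ 'd" where
  "frac_vec x = (\<chi> i. frac (x $ i))"

lemma unit_cell_measurable [measurable]: "(unit_cell :: (real ^ 'd) set) \<in> sets borel"
  unfolding unit_cell_def by measurable

lemma sets_cell_measure [measurable_cong, simp]: "sets cell_measure = sets borel"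
  by (simp add: cell_measure_def)

lemma space_cell_measure [simp]: "space cell_measure = UNIV"
  by (simp add: cell_measure_def)

lemma frac_vec_measurable [measurable]: "frac_vec \<in> borel_measurable borel"
proof -
  have "(\<lambda>x::real^'d. frac_vec x \<bullet> b) \<in> borel_measurable borel" if "b \<in> Basis" for b
    using that by (auto simp: Basis_vec_def frac_vec_def inner_axis frac_def)
  then show ?thesis by (rule borel_measurable_euclidean_space[THEN iffD2, rule_format])
qed

lemma frac_vec_eq: "x \<in> unit_cell \<Longrightarrow> frac_vec x = x"
  by (auto simp: unit_cell_def frac_vec_def vec_eq_iff frac_eq)

lemma frac_vec_add_lattice: "x = frac_vec x + lattice_vec (\<chi> i. \<lfloor>x $ i\<rfloor>)"
  by (simp add: frac_vec_def lattice_vec_def vec_eq_iff frac_def)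

lemma frac_vec_lattice_shift: "frac_vec (x + lattice_vec k) = frac_vec x"
  by (simp add: frac_vec_def lattice_vec_def vec_eq_iff frac_def)

lemma torus_periodic_frac_vec: "torus_periodic g \<Longrightarrow> g (frac_vec x) = g x"
  using frac_vec_add_lattice[of x] unfolding torus_periodic_def by metis

lemma lattice_vec_simps [simp]: "lattice_vec 0 = 0" "lattice_vec (k + l) = lattice_vec k + lattice_vec l"
   "lattice_vec (- k) = - lattice_vec k"
  by (simp_all add: lattice_vec_def vec_eq_iff)

lemma AE_cbox_unit_cell: "AE x in lborel. x \<in> cbox 0 (\<chi> i. 1) \<longleftrightarrow> x \<in> (unit_cell :: (real ^ 'd) set)"
proof -
  have box: "box 0 (\<chi> i. 1) \<subseteq> (unit_cell :: (real ^ 'd) set)" "unit_cell \<subseteq> cbox 0 ((\<chi> i. 1) :: real ^ 'd)"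
    by (auto simp: unit_cell_def mem_box_cart less_imp_le)
  have "negligible (cbox 0 ((\<chi> i. 1) :: real ^ 'd) - box 0 (\<chi> i. 1))"
    using negligible_frontier_interval by blast
  then have "cbox 0 ((\<chi> i. 1) :: real ^ 'd) - box 0 (\<chi> i. 1) \<in> null_sets lebesgue"
    using negligible_iff_null_sets by blast
  then have "AE x in lebesgue. x \<notin> cbox 0 ((\<chi> i. 1) :: real ^ 'd) - box 0 (\<chi> i. 1)"
    by (rule AE_not_in)
  then show ?thesis
    unfolding AE_completion_iff by (rule eventually_mono) (use box in auto)
qed

lemma emeasure_unit_cell: "emeasure lborel (unit_cell :: (real ^ 'd) set) = 1"
proof -
  have "emeasure lborel (unit_cell :: (real ^ 'd) set) = emeasure lborel (cbox 0 ((\<chi> i. 1) :: real ^ 'd))"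
    by (rule emeasure_eq_AE) (use AE_cbox_unit_cell in auto)
  also have "\<dots> = (\<Prod>b\<in>Basis. ((\<chi> i. 1) - 0 :: real ^ 'd) \<bullet> b)"
    by (intro emeasure_lborel_cbox) (auto simp: Basis_vec_def inner_axis)
  also have "(\<Prod>b\<in>Basis. ((\<chi> i. 1) - 0 :: real ^ 'd) \<bullet> b) = 1"
    by (rule prod.neutral) (auto simp: Basis_vec_def inner_axis)
  finally show ?thesis by simp
qed

interpretation cell: prob_space "cell_measure :: (real ^ 'd) measure"
  by (rule prob_spaceI) (simp add: cell_measure_def emeasure_density emeasure_unit_cell)

lemma AE_cell_measure: "(AE x in cell_measure. P x) \<longleftrightarrow> (AE x in lborel. x \<in> unit_cell \<longrightarrow> P x)"
  unfolding cell_measure_def by (subst AE_density) (auto simp: indicator_def)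

lemma nn_integral_cell:
  "f \<in> borel_measurable borel \<Longrightarrow> (\<integral>\<^sup>+x. f x \<partial>cell_measure) = (\<integral>\<^sup>+x. f x * indicator unit_cell x \<partial>lborel)"
  unfolding cell_measure_def by (subst nn_integral_density) (auto simp: mult.commute)

lemma tiling:
  fixes x :: "real ^ 'd"
  shows "(\<integral>\<^sup>+k. indicator unit_cell (x - lattice_vec k) \<partial>count_space UNIV) = 1"
    and "(\<integral>\<^sup>+k. indicator unit_cell (x + lattice_vec k) \<partial>count_space UNIV) = 1"
proof -
  have fl: "0 \<le> y - real_of_int m \<and> y - real_of_int m < 1 \<longleftrightarrow> m = \<lfloor>y\<rfloor>" for y m
    by (auto simp: floor_eq_iff eq_commute[of m])
  have "x - lattice_vec k \<in> unit_cell \<longleftrightarrow> k \<in> {\<chi> i. \<lfloor>x $ i\<rfloor>}" for k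
    by (simp add: unit_cell_def lattice_vec_def fl vec_eq_iff del: diff_ge_0_iff_ge)
  then have "indicator unit_cell (x - lattice_vec k) = (indicator {\<chi> i. \<lfloor>x $ i\<rfloor>} k :: ennreal)" for k
    by (simp add: indicator_def)
  then show "(\<integral>\<^sup>+k. indicator unit_cell (x - lattice_vec k) \<partial>count_space UNIV) = 1" by simp
  have "indicator unit_cell (x + lattice_vec k) = (indicator {\<chi> i. - \<lfloor>x $ i\<rfloor>} k :: ennreal)" for k
  proof -
    have "x + lattice_vec k \<in> unit_cell \<longleftrightarrow> (\<forall>i. - k $ i = \<lfloor>x $ i\<rfloor>)"
      using fl[of "x $ _" "- k $ _"] by (simp add: unit_cell_def lattice_vec_def del: diff_ge_0_iff_ge)
    also have "\<dots> \<longleftrightarrow> k \<in> {\<chi> i. - \<lfloor>x $ i\<rfloor>}" by (auto simp: vec_eq_iff) (metis minus_minus)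
    finally show ?thesis by (simp add: indicator_def)
  qed
  then show "(\<integral>\<^sup>+k. indicator unit_cell (x + lattice_vec k) \<partial>count_space UNIV) = 1" by simp
qed

lemma nn_integral_lborel_translate:
  fixes f :: "'a::euclidean_space \<Rightarrow> ennreal"
  assumes [measurable]: "f \<in> borel_measurable borel"
  shows "(\<integral>\<^sup>+z. f (z + k) \<partial>lborel) = (\<integral>\<^sup>+z. f z \<partial>lborel)"
proof -
  have "(\<integral>\<^sup>+z. f z \<partial>lborel) = (\<integral>\<^sup>+z. f z \<partial>(distr lborel borel ((+) k)))" by (simp add: lborel_distr_plus)
  also have "\<dots> = (\<integral>\<^sup>+z. f (z + k) \<partial>lborel)" by (subst nn_integral_distr) (auto simp: add.commute)
  finally show ?thesis by simp
qed

text \<open>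
  The lattice translates of the unit cell and those of the shifted cell both tile the space.
  Cutting one cell along the other tiling and moving the pieces back by lattice vectors exchanges
  the two.
\<close>
lemma nn_integral_cell_translate:
  fixes h :: "real ^ 'd \<Rightarrow> ennreal"
  assumes [measurable]: "h \<in> borel_measurable borel" and per: "torus_periodic h"
  shows "(\<integral>\<^sup>+x. h (x + a) \<partial>cell_measure) = (\<integral>\<^sup>+x. h x \<partial>cell_measure)"
proof -
  let ?C = "indicator (unit_cell :: (real ^ 'd) set) :: real ^ 'd \<Rightarrow> ennreal"
  have cnt: "countable (UNIV :: (int ^ 'd) set)" by simp
  have "(\<integral>\<^sup>+x. h (x + a) \<partial>cell_measure) = (\<integral>\<^sup>+x. h (x + a) * ?C x \<partial>lborel)"
    by (simp add: nn_integral_cell)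
  also have "\<dots> = (\<integral>\<^sup>+x. h x * ?C (x - a) \<partial>lborel)"
    using nn_integral_lborel_translate[of "\<lambda>x. h x * ?C (x - a)" a] by simp
  also have "\<dots> = (\<integral>\<^sup>+x. (\<integral>\<^sup>+k. h x * ?C (x - a) * ?C (x - lattice_vec k) \<partial>count_space UNIV) \<partial>lborel)"
    by (simp add: nn_integral_cmult tiling)
  also have "\<dots> = (\<integral>\<^sup>+k. (\<integral>\<^sup>+x. h x * ?C (x - a) * ?C (x - lattice_vec k) \<partial>lborel) \<partial>count_space UNIV)"
    by (rule nn_integral_count_space_nn_integral[OF cnt]) measurable
  also have "\<dots> = (\<integral>\<^sup>+k. (\<integral>\<^sup>+x. h x * ?C x * ?C (x - a + lattice_vec k) \<partial>lborel) \<partial>count_space UNIV)"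
  proof (rule nn_integral_cong)
    fix k :: "int ^ 'd"
    have "(\<integral>\<^sup>+x. h x * ?C (x - a) * ?C (x - lattice_vec k) \<partial>lborel)
      = (\<integral>\<^sup>+x. h (x + lattice_vec k) * ?C (x + lattice_vec k - a) * ?C (x + lattice_vec k - lattice_vec k) \<partial>lborel)"
      by (rule nn_integral_lborel_translate[symmetric]) measurable
    also have "\<dots> = (\<integral>\<^sup>+x. h x * ?C x * ?C (x - a + lattice_vec k) \<partial>lborel)"
      using per by (intro nn_integral_cong) (simp add: torus_periodic_def mult_ac algebra_simps)
    finally show "(\<integral>\<^sup>+x. h x * ?C (x - a) * ?C (x - lattice_vec k) \<partial>lborel) = (\<integral>\<^sup>+x. h x * ?C x * ?C (x - a + lattice_vec k) \<partial>lborel)" .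
  qed
  also have "\<dots> = (\<integral>\<^sup>+x. (\<integral>\<^sup>+k. h x * ?C x * ?C (x - a + lattice_vec k) \<partial>count_space UNIV) \<partial>lborel)"
    by (rule nn_integral_count_space_nn_integral[OF cnt, symmetric]) measurable
  also have "\<dots> = (\<integral>\<^sup>+x. h x \<partial>cell_measure)"
    by (simp add: nn_integral_cmult tiling nn_integral_cell)
  finally show ?thesis .
qed

lemma distr_cell_translate: "distr cell_measure cell_measure (\<lambda>x. frac_vec (x + a)) = (cell_measure :: (real ^ 'd) measure)"
proof (rule measure_eqI)
  fix B :: "(real ^ 'd) set" assume "B \<in> sets (distr cell_measure cell_measure (\<lambda>x. frac_vec (x + a)))"
  then have [measurable]: "B \<in> sets borel" by simp
  have "emeasure (distr cell_measure cell_measure (\<lambda>x. frac_vec (x + a))) B = (\<integral>\<^sup>+x. indicator B (frac_vec (x + a)) \<partial>cell_measure)"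
    by (subst nn_integral_indicator[symmetric], simp, subst nn_integral_distr) auto
  also have "\<dots> = (\<integral>\<^sup>+x. indicator B (frac_vec x) \<partial>cell_measure)"
    by (rule nn_integral_cell_translate) (auto simp: torus_periodic_def frac_vec_lattice_shift)
  also have "\<dots> = (\<integral>\<^sup>+x. indicator B x \<partial>cell_measure)"
    by (intro nn_integral_cong_AE) (simp add: AE_cell_measure frac_vec_eq)
  finally show "emeasure (distr cell_measure cell_measure (\<lambda>x. frac_vec (x + a))) B = emeasure cell_measure B" by simp
qed simp

lemma integral_cell_translate:
  fixes h :: "real ^ 'd \<Rightarrow> 'b::{banach, second_countable_topology}"
  assumes [measurable]: "h \<in> borel_measurable borel" and per: "torus_periodic h"
  shows "(\<integral>x. h (x + a) \<partial>cell_measure) = (\<integral>x. h x \<partial>cell_measure)"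
proof -
  have "(\<integral>x. h x \<partial>cell_measure) = (\<integral>x. h (frac_vec (x + a)) \<partial>cell_measure)"
    by (subst distr_cell_translate[of a, symmetric], subst integral_distr) auto
  also have "\<dots> = (\<integral>x. h (x + a) \<partial>cell_measure)"
    by (simp add: torus_periodic_frac_vec[OF per])
  finally show ?thesis by simp
qed

definition character :: "int ^ 'd \<Rightarrow> real ^ 'd \<Rightarrow> complex" where
  "character k x = exp (- 2 * pi * \<i> * complex_of_real (lattice_vec k \<bullet> x))"

lemma character_measurable [measurable]: "character k \<in> borel_measurable borel"
  unfolding character_def[abs_def] by measurable

lemma norm_character [simp]: "norm (character k x) = 1"
  by (simp add: character_def)

lemma character_add: "character (k + l) x = character k x * character l x"
  by (simp add: character_def inner_add_left exp_add[symmetric] algebra_simps)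

lemma character_add_arg: "character k (x + y) = character k x * character k y"
  by (simp add: character_def inner_add_right exp_add[symmetric] algebra_simps)

lemma character_0 [simp]: "character 0 x = 1" by (simp add: character_def)

lemma character_lattice: "character k (lattice_vec l) = 1"
proof -
  have "lattice_vec k \<bullet> lattice_vec l = of_int (\<Sum>i\<in>UNIV. k $ i * l $ i)"
    by (simp add: inner_vec_def lattice_vec_def)
  then obtain n :: int where "lattice_vec k \<bullet> lattice_vec l = of_int n" by blast
  then have "character k (lattice_vec l) = exp (2 * of_int (- n) * pi * \<i>)"
    by (simp add: character_def mult_ac)
  also have "\<dots> = 1" by (subst exp_eq_1) (auto intro: exI[of _ "- n"])
  finally show ?thesis .
qed

lemma torus_periodic_character: "torus_periodic (character k)"
  by (simp add: torus_periodic_def character_add_arg character_lattice)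

definition vanishing_coeffs :: "(real ^ 'd \<Rightarrow> complex) \<Rightarrow> bool" where
  "vanishing_coeffs G \<longleftrightarrow> integrable cell_measure G \<and> (\<forall>k. (\<integral>x. G x * character k x \<partial>cell_measure) = 0)"

text \<open>
  The multipliers \<open>q\<close> that do not create Fourier coefficients. They form an algebra that contains
  the characters, hence every trigonometric polynomial, without any bookkeeping of coefficients.
\<close>
definition preserves_vanishing :: "(real ^ 'd \<Rightarrow> complex) \<Rightarrow> bool" where
  "preserves_vanishing q \<longleftrightarrow> (\<forall>G. vanishing_coeffs G \<longrightarrow> vanishing_coeffs (\<lambda>x. q x * G x))"

lemma integrable_mult_character:
  "integrable cell_measure G \<Longrightarrow> integrable cell_measure (\<lambda>x. G x * character k x)"
  by (rule Bochner_Integration.integrable_bound[of _ G]) (auto simp: norm_mult)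

lemma preserves_vanishing_const: "preserves_vanishing (\<lambda>x. c)"
  by (simp add: preserves_vanishing_def vanishing_coeffs_def mult.assoc)

lemma preserves_vanishing_character:
  fixes l :: "int ^ 'd"
  shows "preserves_vanishing (character l)"
  unfolding preserves_vanishing_def vanishing_coeffs_def
proof (intro allI impI conjI)
  fix G :: "real ^ 'd \<Rightarrow> complex" and k :: "int ^ 'd"
  assume G: "integrable cell_measure G \<and> (\<forall>k. (\<integral>x. G x * character k x \<partial>cell_measure) = 0)"
  then show "integrable cell_measure (\<lambda>x. character l x * G x)"
    using integrable_mult_character[of G l] by (simp add: mult.commute)
  have "character l x * G x * character k x = G x * character (l + k) x" for x
    by (simp add: character_add mult_ac)
  then show "(\<integral>x. character l x * G x * character k x \<partial>cell_measure) = 0"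
    using G by presburger
qed

lemma preserves_vanishing_mult:
  "preserves_vanishing p \<Longrightarrow> preserves_vanishing q \<Longrightarrow> preserves_vanishing (\<lambda>x. p x * q x)"
  by (simp add: preserves_vanishing_def mult.assoc)

lemma preserves_vanishing_add:
  fixes p q :: "real ^ 'd \<Rightarrow> complex"
  assumes "preserves_vanishing p" "preserves_vanishing q"
  shows "preserves_vanishing (\<lambda>x. p x + q x)"
  unfolding preserves_vanishing_def
proof (intro allI impI)
  fix G :: "real ^ 'd \<Rightarrow> complex" assume G: "vanishing_coeffs G"
  have "vanishing_coeffs (\<lambda>x. p x * G x)" "vanishing_coeffs (\<lambda>x. q x * G x)"
    using assms G by (auto simp: preserves_vanishing_def)
  then show "vanishing_coeffs (\<lambda>x. (p x + q x) * G x)"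
    by (simp add: vanishing_coeffs_def distrib_right integrable_mult_character)
qed

lemma preserves_vanishing_sum:
  "(\<And>i. i \<in> A \<Longrightarrow> preserves_vanishing (p i)) \<Longrightarrow> preserves_vanishing (\<lambda>x. \<Sum>i\<in>A. p i x)"
  by (induction A rule: infinite_finite_induct)
     (auto intro: preserves_vanishing_add preserves_vanishing_const)

text \<open>
  An embedding of the torus into a Euclidean space, under which polynomials become trigonometric
  polynomials.
\<close>
definition torus_embed :: "real ^ 'd \<Rightarrow> (real ^ 'd) \<times> (real ^ 'd)" where
  "torus_embed x = (\<chi> i. cos (2 * pi * x $ i), \<chi> i. sin (2 * pi * x $ i))"

lemma character_axis: "character (axis i 1) x = cis (- (2 * pi * x $ i))" "character (- axis i 1) x = cis (2 * pi * x $ i)"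
proof -
  have "lattice_vec (axis i 1) = axis i 1" by (simp add: lattice_vec_def axis_def vec_eq_iff)
  then show "character (axis i 1) x = cis (- (2 * pi * x $ i))" "character (- axis i 1) x = cis (2 * pi * x $ i)"
    by (simp_all add: character_def inner_axis' cis_conv_exp mult_ac)
qed

lemma preserves_vanishing_cos:
  fixes i :: "'d::finite"
  shows "preserves_vanishing (\<lambda>x::real^'d. complex_of_real (cos (2 * pi * x $ i)))"
proof -
  have "(\<lambda>x::real^'d. complex_of_real (cos (2 * pi * x $ i))) = (\<lambda>x. (1 / 2) * (character (axis i 1) x + character (- axis i 1) x))"
    by (rule ext) (simp add: character_axis complex_eq_iff)
  then show ?thesis
    by (simp only:) (intro preserves_vanishing_mult preserves_vanishing_const preserves_vanishing_add preserves_vanishing_character)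
qed

lemma preserves_vanishing_sin:
  fixes i :: "'d::finite"
  shows "preserves_vanishing (\<lambda>x::real^'d. complex_of_real (sin (2 * pi * x $ i)))"
proof -
  have "(\<lambda>x::real^'d. complex_of_real (sin (2 * pi * x $ i))) = (\<lambda>x. (\<i> / 2) * (character (axis i 1) x + (-1) * character (- axis i 1) x))"
    by (rule ext) (simp add: character_axis complex_eq_iff)
  then show ?thesis
    by (simp only:) (intro preserves_vanishing_mult preserves_vanishing_const preserves_vanishing_add preserves_vanishing_character)
qed

lemma preserves_vanishing_polynomial:
  fixes p :: "(real ^ 'd) \<times> (real ^ 'd) \<Rightarrow> real"
  assumes "real_polynomial_function p"
  shows "preserves_vanishing (\<lambda>x. complex_of_real (p (torus_embed x)))"
  using assms
proof induction
  case (linear f)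
  interpret bounded_linear f by fact
  have "f (torus_embed x) = (\<Sum>i\<in>UNIV. cos (2 * pi * x $ i) * f (axis i 1, 0)) + (\<Sum>i\<in>UNIV. sin (2 * pi * x $ i) * f (0, axis i 1))" for x
  proof -
    have "torus_embed x = (\<Sum>i\<in>UNIV. cos (2 * pi * x $ i) *\<^sub>R (axis i 1, 0)) + (\<Sum>i\<in>UNIV. sin (2 * pi * x $ i) *\<^sub>R (0, axis i 1))"
      unfolding torus_embed_def
      by (simp add: prod_eq_iff fst_sum snd_sum vec_eq_iff axis_def if_distrib cong: if_cong)
    then show ?thesis by (simp only: add sum scaleR real_scaleR_def)
  qed
  then show ?case
    by (auto intro!: preserves_vanishing_add preserves_vanishing_sum preserves_vanishing_mult preserves_vanishing_cos preserves_vanishing_sin preserves_vanishing_const)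
next
  case (const c)
  show ?case by (rule preserves_vanishing_const)
next
  case (add f g)
  then show ?case by (simp add: preserves_vanishing_add)
next
  case (mult f g)
  then show ?case by (simp add: preserves_vanishing_mult)
qed


lemma norm_torus_embed_le: "norm (torus_embed (x :: real ^ 'd)) \<le> 2 * real CARD('d)"
proof -
  have c: "norm (\<chi> i. cos (2 * pi * x $ i)) \<le> real CARD('d)"
    using order_trans[OF norm_le_l1_cart sum_bounded_above[of UNIV "\<lambda>i. \<bar>(\<chi> i. cos (2 * pi * x $ i)) $ i\<bar>" 1]] by simp
  have s: "norm (\<chi> i. sin (2 * pi * x $ i)) \<le> real CARD('d)"
    using order_trans[OF norm_le_l1_cart sum_bounded_above[of UNIV "\<lambda>i. \<bar>(\<chi> i. sin (2 * pi * x $ i)) $ i\<bar>" 1]] by simp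
  have "norm (torus_embed x) \<le> norm (\<chi> i. cos (2 * pi * x $ i)) + norm (\<chi> i. sin (2 * pi * x $ i))"
    unfolding torus_embed_def by (rule norm_Pair_le)
  with c s show ?thesis by linarith
qed

lemma torus_embed_continuous: "continuous_on S torus_embed"
  unfolding torus_embed_def by (intro continuous_intros)

lemma torus_embed_measurable [measurable]: "torus_embed \<in> borel_measurable borel"
  by (rule borel_measurable_continuous_onI[OF torus_embed_continuous])

lemma torus_embed_inj:
  assumes "x \<in> unit_cell" "y \<in> unit_cell" "torus_embed x = torus_embed y"
  shows "x = y"
  unfolding vec_eq_iff
proof
  fix i
  have "sin (2 * pi * x $ i) = sin (2 * pi * y $ i) \<and> cos (2 * pi * x $ i) = cos (2 * pi * y $ i)"
    using assms(3) by (auto simp: torus_embed_def vec_eq_iff)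
  then obtain n :: int where "2 * pi * x $ i = 2 * pi * y $ i + 2 * pi * of_int n"
    unfolding sin_cos_eq_iff by blast
  then have "2 * pi * x $ i = 2 * pi * (y $ i + of_int n)" by (simp add: distrib_left)
  then have n: "x $ i = y $ i + of_int n" by simp
  moreover have "0 \<le> x $ i" "x $ i < 1" "0 \<le> y $ i" "y $ i < 1" using assms by (auto simp: unit_cell_def)
  ultimately have "n = 0" by linarith
  then show "x $ i = y $ i" using n by simp
qed

text \<open>
  Polynomials in \<open>torus_embed\<close> are orthogonal to \<open>F\<close>, and by the Stone--Weierstrass theorem they
  approximate \<open>h\<close> uniformly on a ball that contains the embedded torus.
\<close>
lemma vanishing_coeffs_orthogonal_continuous:
  fixes h :: "(real ^ 'd) \<times> (real ^ 'd) \<Rightarrow> real"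
  assumes F: "vanishing_coeffs F" and h: "continuous_on UNIV h"
  shows "(\<integral>x. complex_of_real (h (torus_embed x)) * F x \<partial>cell_measure) = 0"
proof -
  define S where "S = cball (0 :: (real ^ 'd) \<times> (real ^ 'd)) (2 * real CARD('d))"
  have S: "compact S" "\<And>x. torus_embed x \<in> S" using norm_torus_embed_le by (auto simp: S_def)
  have hS: "continuous_on S h" using h continuous_on_subset by blast
  have [measurable]: "h \<in> borel_measurable borel" using h by (rule borel_measurable_continuous_onI)
  have Fint: "integrable cell_measure F" using F by (simp add: vanishing_coeffs_def)
  define I where "I = (\<integral>x. norm (F x) \<partial>cell_measure)"
  have I0: "0 \<le> I" unfolding I_def by simp
  have bd: "norm (\<integral>x. complex_of_real (h (torus_embed x)) * F x \<partial>cell_measure) \<le> e * I" if e: "0 < e" for e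
  proof -
    obtain p where p: "real_polynomial_function p" "\<And>x. x \<in> S \<Longrightarrow> \<bar>h x - p x\<bar> < e"
      using Stone_Weierstrass_real_polynomial_function[OF S(1) hS e] by blast
    have [measurable]: "p \<in> borel_measurable borel"
      using p(1) by (intro borel_measurable_continuous_onI) (auto intro: continuous_on_polymonial_function simp: real_polynomial_function_eq)
    have "vanishing_coeffs (\<lambda>x. complex_of_real (p (torus_embed x)) * F x)"
      using preserves_vanishing_polynomial[OF p(1)] F by (simp add: preserves_vanishing_def)
    then have P: "integrable cell_measure (\<lambda>x. complex_of_real (p (torus_embed x)) * F x)"
      "(\<integral>x. complex_of_real (p (torus_embed x)) * F x \<partial>cell_measure) = 0"
      unfolding vanishing_coeffs_def by (auto dest!: spec[of _ 0])
    have le: "norm (complex_of_real (h (torus_embed x) - p (torus_embed x)) * F x) \<le> e * norm (F x)" for x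
      using p(2)[OF S(2), of x] by (simp only: norm_mult norm_of_real) (intro mult_right_mono, auto)
    have D: "integrable cell_measure (\<lambda>x. complex_of_real (h (torus_embed x) - p (torus_embed x)) * F x)"
    proof (rule Bochner_Integration.integrable_bound)
      show "integrable cell_measure (\<lambda>x. e * norm (F x))" using Fint by simp
      show "AE x in cell_measure. norm (complex_of_real (h (torus_embed x) - p (torus_embed x)) * F x) \<le> norm (e * norm (F x))"
        using le e by (intro AE_I2) (metis abs_ge_self order_trans real_norm_def)
    qed (use Fint in measurable)
    have "(\<integral>x. complex_of_real (h (torus_embed x)) * F x \<partial>cell_measure)
      = (\<integral>x. complex_of_real (h (torus_embed x) - p (torus_embed x)) * F x + complex_of_real (p (torus_embed x)) * F x \<partial>cell_measure)"
      by (intro Bochner_Integration.integral_cong) (auto simp: algebra_simps)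
    also have "\<dots> = (\<integral>x. complex_of_real (h (torus_embed x) - p (torus_embed x)) * F x \<partial>cell_measure)"
      by (subst Bochner_Integration.integral_add[OF D P(1)]) (simp add: P(2))
    also have "norm \<dots> \<le> (\<integral>x. e * norm (F x) \<partial>cell_measure)"
      by (rule Bochner_Integration.integral_norm_bound_integral[OF D]) (use Fint le in auto)
    also have "\<dots> = e * I" by (simp add: I_def)
    finally show ?thesis .
  qed
  have "norm (\<integral>x. complex_of_real (h (torus_embed x)) * F x \<partial>cell_measure) \<le> 0 + e" if e: "0 < e" for e
  proof -
    have "norm (\<integral>x. complex_of_real (h (torus_embed x)) * F x \<partial>cell_measure) \<le> e / (I + 1) * I"
      using e I0 by (intro bd) simp
    also have "\<dots> \<le> e" using e I0 by (simp add: field_simps)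
    finally show ?thesis by simp
  qed
  then have "norm (\<integral>x. complex_of_real (h (torus_embed x)) * F x \<partial>cell_measure) \<le> 0" by (rule field_le_epsilon)
  then show ?thesis by simp
qed

text \<open>
  The indicator function of the compact image of \<open>K\<close> is a limit of continuous functions of the
  distance to it, and \<open>torus_embed\<close> is injective on the cell.
\<close>
lemma vanishing_coeffs_integral_compact:
  fixes K :: "(real ^ 'd) set"
  assumes F: "vanishing_coeffs F" and K: "compact K" "K \<subseteq> unit_cell"
  shows "(\<integral>x. indicator K x *\<^sub>R F x \<partial>cell_measure) = 0"
proof (cases "K = {}")
  case False
  define E where "E = torus_embed ` K"
  have "compact E" unfolding E_def by (intro compact_continuous_image K torus_embed_continuous)
  then have E: "closed E" "E \<noteq> {}" using False by (auto simp: compact_imp_closed E_def)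
  define h where "h = (\<lambda>(n::nat) y. max 0 (1 - real n * infdist y E))"
  have h01: "0 \<le> h n y" "h n y \<le> 1" for n y by (auto simp: h_def infdist_nonneg)
  have hc: "continuous_on UNIV (h n)" for n unfolding h_def by (intro continuous_intros)
  have [measurable]: "h n \<in> borel_measurable borel" for n using hc by (rule borel_measurable_continuous_onI)
  have [measurable]: "K \<in> sets borel" using K(1) by (simp add: borel_compact)
  have Fint: "integrable cell_measure F" using F by (simp add: vanishing_coeffs_def)
  have lim: "(\<lambda>n. h n (torus_embed x)) \<longlonglongrightarrow> indicator K x" if x: "x \<in> unit_cell" for x
  proof (cases "x \<in> K")
    case True
    then have "infdist (torus_embed x) E = 0" by (simp add: E_def)
    then show ?thesis using True by (simp add: h_def)
  next
    case nK: False
    have "torus_embed x \<notin> E"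
      using torus_embed_inj[OF x] K(2) nK by (auto simp: E_def)
    then have pos: "0 < infdist (torus_embed x) E" using infdist_pos_not_in_closed E by blast
    obtain n0 where n0: "1 / infdist (torus_embed x) E < real n0" using reals_Archimedean2 by blast
    have "h n (torus_embed x) = 0" if "n0 \<le> n" for n
    proof -
      have "1 / infdist (torus_embed x) E \<le> real n" using n0 that by linarith
      then have "1 \<le> real n * infdist (torus_embed x) E" using pos by (simp add: field_simps)
      then show ?thesis by (simp add: h_def)
    qed
    then show ?thesis using nK by (intro tendsto_eventually) (auto simp: eventually_sequentially)
  qed
  have "(\<lambda>n. \<integral>x. complex_of_real (h n (torus_embed x)) * F x \<partial>cell_measure) \<longlonglongrightarrow> (\<integral>x. indicator K x *\<^sub>R F x \<partial>cell_measure)"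
  proof (rule integral_dominated_convergence[where w = "\<lambda>x. norm (F x)"])
    show "AE x in cell_measure. (\<lambda>n. complex_of_real (h n (torus_embed x)) * F x) \<longlonglongrightarrow> indicator K x *\<^sub>R F x"
      unfolding AE_cell_measure
    proof (intro AE_I2 impI)
      fix x :: "real ^ 'd" assume "x \<in> unit_cell"
      from tendsto_scaleR[OF lim[OF this] tendsto_const[of "F x"]]
      show "(\<lambda>n. complex_of_real (h n (torus_embed x)) * F x) \<longlonglongrightarrow> indicator K x *\<^sub>R F x"
        by (simp add: scaleR_conv_of_real)
    qed
    show "AE x in cell_measure. norm (complex_of_real (h n (torus_embed x)) * F x) \<le> norm (F x)" for n
      using h01 by (intro AE_I2) (simp add: norm_mult mult_left_le_one_le)
  qed (use Fint in \<open>auto intro: borel_measurable_integrable\<close>)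
  moreover have "(\<integral>x. complex_of_real (h n (torus_embed x)) * F x \<partial>cell_measure) = 0" for n
    by (rule vanishing_coeffs_orthogonal_continuous[OF F hc])
  ultimately show ?thesis by (simp add: LIMSEQ_const_iff)
qed simp

lemma borel_inner_compact:
  fixes A :: "(real ^ 'd) set"
  assumes [measurable]: "A \<in> sets borel" and A: "A \<subseteq> unit_cell" and e: "0 < e"
  obtains K where "compact K" "K \<subseteq> A" "emeasure lborel (A - K) < ennreal e"
proof -
  have "A \<in> sets lebesgue" by simp
  then obtain K where K: "closed K" "K \<subseteq> A" "emeasure lebesgue (A - K) < ennreal e"
    using sets_lebesgue_inner_closed e by metis
  have "unit_cell \<subseteq> cbox 0 ((\<chi> i. 1) :: real ^ 'd)" by (auto simp: unit_cell_def mem_box_cart less_imp_le)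
  then have "bounded K" using bounded_cbox bounded_subset K(2) A by (metis subset_trans)
  then have "compact K" using K(1) by (simp add: compact_eq_bounded_closed)
  moreover have "emeasure lborel (A - K) < ennreal e"
    using K(1,3) by (subst (asm) emeasure_completion) (auto simp: main_part_sets)
  ultimately show thesis using K(2) that by blast
qed

text \<open>
  The set where \<open>F\<close> is positive can be exhausted by compact sets, over each of which the integral
  of \<open>F\<close> vanishes; so these compact sets are null sets.
\<close>
lemma vanishing_coeffs_nonpos:
  fixes F :: "real ^ 'd \<Rightarrow> real"
  assumes F: "vanishing_coeffs (\<lambda>x. complex_of_real (F x))" and [measurable]: "F \<in> borel_measurable borel"
  shows "AE x in cell_measure. F x \<le> 0"
proof -
  define A where "A = {x \<in> unit_cell. 0 < F x}"
  have [measurable]: "A \<in> sets borel" unfolding A_def by measurable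
  have Fint: "integrable cell_measure F" using F by (simp add: vanishing_coeffs_def complex_of_real_integrable_eq)
  have small: "emeasure lborel A \<le> ennreal e" if e: "0 < e" for e
  proof -
    obtain K where K: "compact K" "K \<subseteq> A" "emeasure lborel (A - K) < ennreal e"
      using borel_inner_compact[of A e] e by (auto simp: A_def)
    have [measurable]: "K \<in> sets borel" using K(1) by (simp add: borel_compact)
    have "complex_of_real (\<integral>x. indicator K x * F x \<partial>cell_measure) = (\<integral>x. indicator K x *\<^sub>R complex_of_real (F x) \<partial>cell_measure)"
      by (simp add: scaleR_conv_of_real flip: integral_complex_of_real)
    also have "\<dots> = 0" using K by (intro vanishing_coeffs_integral_compact F) (auto simp: A_def)
    finally have z: "(\<integral>x. indicator K x * F x \<partial>cell_measure) = 0" by simp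
    have "integrable cell_measure (\<lambda>x. indicator K x * F x)"
      using integrable_mult_indicator[of K cell_measure F] Fint by simp
    moreover have nonneg: "0 \<le> indicator K x * F x" for x
      using K(2) by (auto simp: A_def indicator_def)
    ultimately have "AE x in cell_measure. indicator K x * F x = 0"
      using z integral_nonneg_eq_0_iff_AE[of cell_measure "\<lambda>x. indicator K x * F x"] nonneg by simp
    then have "AE x in lborel. x \<notin> K"
      unfolding AE_cell_measure by (rule eventually_mono) (use K(2) in \<open>auto simp: A_def indicator_def\<close>)
    then have "emeasure lborel K = 0" by (subst (asm) AE_iff_measurable[OF _ refl]) auto
    have "emeasure lborel A \<le> emeasure lborel (K \<union> (A - K))" by (intro emeasure_mono) auto
    also have "\<dots> \<le> emeasure lborel K + emeasure lborel (A - K)" by (intro emeasure_subadditive) auto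
    finally show ?thesis using \<open>emeasure lborel K = 0\<close> K(3) by simp
  qed
  have "emeasure lborel A \<le> 0"
    by (rule ennreal_le_epsilon) (simp only: add_0 small)
  then have "A \<in> null_sets lborel" by (intro null_setsI) simp_all
  then have "AE x in lborel. x \<notin> A" by (rule AE_not_in)
  then show ?thesis unfolding AE_cell_measure by (rule eventually_mono) (auto simp: A_def)
qed

lemma fourier_uniqueness:
  fixes F :: "real ^ 'd \<Rightarrow> real"
  assumes "integrable cell_measure F" and F: "\<And>k. (\<integral>x. complex_of_real (F x) * character k x \<partial>cell_measure) = 0"
  shows "AE x in cell_measure. F x = 0"
proof -
  have [measurable]: "F \<in> borel_measurable borel" using borel_measurable_integrable[OF assms(1)] by simp
  have 1: "vanishing_coeffs (\<lambda>x. complex_of_real (F x))" using assms by (simp add: vanishing_coeffs_def)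
  have 2: "vanishing_coeffs (\<lambda>x. complex_of_real (- F x))" using assms by (simp add: vanishing_coeffs_def)
  have "AE x in cell_measure. F x \<le> 0" by (rule vanishing_coeffs_nonpos[OF 1]) simp
  moreover have "AE x in cell_measure. - F x \<le> 0" by (rule vanishing_coeffs_nonpos[OF 2]) simp
  ultimately show ?thesis by eventually_elim auto
qed

section \<open>The semigroup of the fractional Laplacian\<close>

text \<open>
  The Fourier coefficients with respect to the Borel measure \<open>cell_measure\<close>; they are the ones to
  which Fubini's theorem applies.
\<close>
definition fcoef :: "(real ^ 'd \<Rightarrow> real) \<Rightarrow> int ^ 'd \<Rightarrow> complex" where
  "fcoef g k = (\<integral>x. complex_of_real (g x) * character k x \<partial>cell_measure)"

text \<open>
  Lebesgue measure on an interval, extended by \<open>0\<close>; as a finite measure on the whole line it can be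
  used in product measures.
\<close>
definition ivl :: "real \<Rightarrow> real measure" where
  "ivl L = density lborel (indicator {0..L})"

lemma sets_ivl [measurable_cong, simp]: "sets (ivl L) = sets borel"
  by (simp add: ivl_def)

lemma space_ivl [simp]: "space (ivl L) = UNIV"
  by (simp add: ivl_def)

lemma finite_measure_ivl: "finite_measure (ivl L)"
proof
  have "emeasure (ivl L) UNIV = emeasure lborel {0..L}"
    by (simp add: ivl_def emeasure_density)
  then show "emeasure (ivl L) (space (ivl L)) \<noteq> \<infinity>" by (simp add: emeasure_lborel_Icc_eq)
qed

interpretation ivl: finite_measure "ivl L" for L by (rule finite_measure_ivl)

lemma measure_ivl: "0 \<le> L \<Longrightarrow> measure (ivl L) UNIV = L"
  by (simp add: measure_def ivl_def emeasure_density)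

lemma AE_ivl: "(AE \<tau> in ivl L. P \<tau>) \<longleftrightarrow> (AE \<tau> in lborel. 0 \<le> \<tau> \<and> \<tau> \<le> L \<longrightarrow> P \<tau>)"
  unfolding ivl_def by (subst AE_density) (auto simp: indicator_def)

lemma AE_ivl_pos: "AE \<tau> in ivl L. 0 < \<tau> \<and> \<tau> \<le> L"
  unfolding AE_ivl using AE_lborel_singleton[of 0] by eventually_elim auto

lemma integral_ivl:
  fixes F :: "real \<Rightarrow> 'b::{banach, second_countable_topology}"
  assumes "F \<in> borel_measurable borel"
  shows "(\<integral>\<tau>. F \<tau> \<partial>ivl L) = (\<integral>\<tau>. indicator {0..L} \<tau> *\<^sub>R F \<tau> \<partial>lborel)"
    and "integrable (ivl L) F \<longleftrightarrow> integrable lborel (\<lambda>\<tau>. indicator {0..L} \<tau> *\<^sub>R F \<tau>)"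
proof -
  have eq: "ivl L = density lborel (\<lambda>\<tau>. ennreal (indicator {0..L} \<tau>))"
    unfolding ivl_def by (simp add: ennreal_indicator)
  show "(\<integral>\<tau>. F \<tau> \<partial>ivl L) = (\<integral>\<tau>. indicator {0..L} \<tau> *\<^sub>R F \<tau> \<partial>lborel)"
    unfolding eq using assms by (subst integral_density) auto
  show "integrable (ivl L) F \<longleftrightarrow> integrable lborel (\<lambda>\<tau>. indicator {0..L} \<tau> *\<^sub>R F \<tau>)"
    unfolding eq using assms by (subst integrable_density) auto
qed

lemma integral_ivl_split:
  fixes F :: "real \<Rightarrow> 'b::{banach, second_countable_topology}"
  assumes F: "integrable (ivl (h + L)) F" and h: "0 \<le> h" "0 \<le> L" and [measurable]: "F \<in> borel_measurable borel"
  shows "(\<integral>\<tau>. F \<tau> \<partial>ivl (h + L)) = (\<integral>\<tau>. F \<tau> \<partial>ivl h) + (\<integral>\<tau>. F (h + \<tau>) \<partial>ivl L)"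
proof -
  have I: "integrable lborel (\<lambda>\<tau>. indicator {0..h + L} \<tau> *\<^sub>R F \<tau>)" using F by (simp add: integral_ivl)
  have I1: "integrable lborel (\<lambda>\<tau>. indicator {0..h} \<tau> *\<^sub>R F \<tau>)"
    by (rule Bochner_Integration.integrable_bound[OF I]) (use h in \<open>auto simp: indicator_def\<close>)
  have I2: "integrable lborel (\<lambda>\<tau>. indicator {h..h + L} \<tau> *\<^sub>R F \<tau>)"
    by (rule Bochner_Integration.integrable_bound[OF I]) (use h in \<open>auto simp: indicator_def\<close>)
  have "(\<integral>\<tau>. F \<tau> \<partial>ivl (h + L)) = (\<integral>\<tau>. indicator {0..h} \<tau> *\<^sub>R F \<tau> + indicator {h..h + L} \<tau> *\<^sub>R F \<tau> \<partial>lborel)"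
    unfolding integral_ivl(1)[OF assms(4)]
  proof (rule integral_cong_AE)
    show "AE \<tau> in lborel. indicator {0..h + L} \<tau> *\<^sub>R F \<tau> = indicator {0..h} \<tau> *\<^sub>R F \<tau> + indicator {h..h + L} \<tau> *\<^sub>R F \<tau>"
      using AE_lborel_singleton[of h] by eventually_elim (use h in \<open>auto simp: indicator_def\<close>)
  qed simp_all
  also have "\<dots> = (\<integral>\<tau>. F \<tau> \<partial>ivl h) + (\<integral>\<tau>. indicator {h..h + L} \<tau> *\<^sub>R F \<tau> \<partial>lborel)"
    by (subst Bochner_Integration.integral_add[OF I1 I2]) (simp add: integral_ivl)
  also have "(\<integral>\<tau>. indicator {h..h + L} \<tau> *\<^sub>R F \<tau> \<partial>lborel) = (\<integral>\<tau>. indicator {h..h + L} (\<tau> + h) *\<^sub>R F (\<tau> + h) \<partial>lborel)"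
    by (rule lborel_integral_translate[symmetric]) simp
  also have "\<dots> = (\<integral>\<tau>. indicator {0..L} \<tau> *\<^sub>R F (h + \<tau>) \<partial>lborel)"
    by (intro Bochner_Integration.integral_cong) (auto simp: indicator_def add.commute)
  also have "\<dots> = (\<integral>\<tau>. F (h + \<tau>) \<partial>ivl L)"
    by (subst integral_ivl) simp_all
  finally show ?thesis .
qed

lemma integrable_ivl_powr:
  assumes p: "0 \<le> p" "p < 1" and L: "0 \<le> L"
  shows "integrable (ivl L) (\<lambda>\<tau>. \<tau> powr (- p))" "(\<integral>\<tau>. \<tau> powr (- p) \<partial>ivl L) = L powr (1 - p) / (1 - p)"
proof -
  have "((\<lambda>\<tau>. \<tau> powr (- p)) has_integral (L powr (- p + 1) / (- p + 1))) {0..L}"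
    using p L by (intro has_integral_powr_from_0) auto
  then have "((\<lambda>\<tau>. if \<tau> \<in> {0..L} then \<tau> powr (- p) else 0) has_integral (L powr (1 - p) / (1 - p))) UNIV"
    by (subst has_integral_restrict_UNIV) (simp add: algebra_simps)
  also have "(\<lambda>\<tau>. if \<tau> \<in> {0..L} then \<tau> powr (- p) else 0) = (\<lambda>\<tau>. indicator {0..L} \<tau> * \<tau> powr (- p))"
    by (auto simp: indicator_def)
  finally have "(\<integral>\<^sup>+\<tau>. ennreal (indicator {0..L} \<tau> * \<tau> powr (- p)) \<partial>lborel) = ennreal (L powr (1 - p) / (1 - p))"
    by (intro nn_integral_has_integral_lborel) auto
  then have "has_bochner_integral lborel (\<lambda>\<tau>. indicator {0..L} \<tau> * \<tau> powr (- p)) (L powr (1 - p) / (1 - p))"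
    using p by (intro has_bochner_integral_nn_integral) auto
  then show "integrable (ivl L) (\<lambda>\<tau>. \<tau> powr (- p))" "(\<integral>\<tau>. \<tau> powr (- p) \<partial>ivl L) = L powr (1 - p) / (1 - p)"
    by (auto simp: integral_ivl has_bochner_integral_iff)
qed

lemma abs_integral_le_integral:
  fixes F G :: "'w \<Rightarrow> real"
  assumes "integrable P F" "integrable P G" "\<And>\<omega>. \<bar>F \<omega>\<bar> \<le> G \<omega>"
  shows "\<bar>\<integral>\<omega>. F \<omega> \<partial>P\<bar> \<le> (\<integral>\<omega>. G \<omega> \<partial>P)"
  by (rule order_trans[OF integral_abs_bound integral_mono]) (use assms in auto)

lemma abs_integral_le_bound:
  fixes F :: "'w \<Rightarrow> real"
  assumes "finite_measure P" "F \<in> borel_measurable P" "\<And>\<omega>. \<bar>F \<omega>\<bar> \<le> M"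
  shows "integrable P F" "\<bar>\<integral>\<omega>. F \<omega> \<partial>P\<bar> \<le> M * measure P (space P)"
proof -
  interpret finite_measure P by fact
  show I: "integrable P F" using assms by (intro integrable_const_bound[where B = M]) auto
  have "\<bar>\<integral>\<omega>. F \<omega> \<partial>P\<bar> \<le> (\<integral>\<omega>. M \<partial>P)"
    by (rule abs_integral_le_integral[OF I]) (use assms in auto)
  then show "\<bar>\<integral>\<omega>. F \<omega> \<partial>P\<bar> \<le> M * measure P (space P)" by (simp add: mult.commute)
qed

text \<open>
  The expansion is linear in the function, so it can be integrated over a parameter together with
  its constant.
\<close>
lemma taylor_average:
  fixes W :: "'w \<Rightarrow> 'a::euclidean_space \<Rightarrow> real" and V :: "'w \<Rightarrow> 'a \<Rightarrow> 'a"
  assumes W: "\<And>x. integrable P (\<lambda>\<omega>. W \<omega> x)" and V: "\<And>x. integrable P (\<lambda>\<omega>. V \<omega> x)" and A: "integrable P A"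
    and T: "AE \<omega> in P. taylor a (A \<omega>) (W \<omega>) (V \<omega>)"
  shows "taylor a (\<integral>\<omega>. A \<omega> \<partial>P) (\<lambda>x. \<integral>\<omega>. W \<omega> x \<partial>P) (\<lambda>x. \<integral>\<omega>. V \<omega> x \<partial>P)"
  unfolding taylor_def
proof (intro allI)
  fix x h :: 'a
  have I: "integrable P (\<lambda>\<omega>. W \<omega> (x + h) - W \<omega> x - V \<omega> x \<bullet> h)"
    by (intro Bochner_Integration.integrable_diff W integrable_inner_left V)
  have "(\<integral>\<omega>. W \<omega> (x + h) \<partial>P) - (\<integral>\<omega>. W \<omega> x \<partial>P) - (\<integral>\<omega>. V \<omega> x \<partial>P) \<bullet> h = (\<integral>\<omega>. W \<omega> (x + h) - W \<omega> x - V \<omega> x \<bullet> h \<partial>P)"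
    by (simp only: integral_inner_left[OF V] Bochner_Integration.integral_diff[OF Bochner_Integration.integrable_diff[OF W W] integrable_inner_left[OF V]]
        Bochner_Integration.integral_diff[OF W W])
  also have "\<bar>\<dots>\<bar> \<le> (\<integral>\<omega>. \<bar>W \<omega> (x + h) - W \<omega> x - V \<omega> x \<bullet> h\<bar> \<partial>P)" by (rule integral_abs_bound)
  also have "\<dots> \<le> (\<integral>\<omega>. A \<omega> * norm h powr a \<partial>P)"
  proof (rule integral_mono_AE)
    show "AE \<omega> in P. \<bar>W \<omega> (x + h) - W \<omega> x - V \<omega> x \<bullet> h\<bar> \<le> A \<omega> * norm h powr a"
      using T by eventually_elim (rule taylorD)
  qed (use I A in auto)
  also have "\<dots> = (\<integral>\<omega>. A \<omega> \<partial>P) * norm h powr a" by simp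
  finally show "\<bar>(\<integral>\<omega>. W \<omega> (x + h) \<partial>P) - (\<integral>\<omega>. W \<omega> x \<partial>P) - (\<integral>\<omega>. V \<omega> x \<partial>P) \<bullet> h\<bar> \<le> (\<integral>\<omega>. A \<omega> \<partial>P) * norm h powr a" .
qed

lemma taylor_shift: "taylor a A g V \<Longrightarrow> taylor a A (\<lambda>x. g (x - y)) (\<lambda>x. V (x - y))"
  unfolding taylor_def by (metis add_diff_eq diff_add_eq)

locale torus_kernel = stable_kernel N Y \<Psi> s a K
  for N :: "'w measure" and Y \<Psi> :: "'w \<Rightarrow> real ^ 'd" and s a K :: real
begin

definition heat :: "real \<Rightarrow> (real ^ 'd \<Rightarrow> real) \<Rightarrow> real ^ 'd \<Rightarrow> real" where
  "heat c g x = (\<integral>\<omega>. g (x - c *\<^sub>R Y \<omega>) \<partial>N)"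

text \<open>
  The eigenvalues of the fractional Laplacian.
\<close>
definition symbol :: "int ^ 'd \<Rightarrow> real" where
  "symbol k = (2 * pi) powr (2 * s) * norm (lattice_vec k) powr (2 * s)"

text \<open>
  The length scale at the time \<open>\<tau>\<close>: the kernel of the semigroup is the law of \<open>\<kappa> \<tau> *\<^sub>R Y\<close>.
\<close>
definition \<kappa> :: "real \<Rightarrow> real" where "\<kappa> \<tau> = \<tau> powr (1 / (2 * s))"

lemma s_pos: "0 < s" using exponents by simp

lemma a_le_2: "a \<le> 2" using exponents by simp

lemma \<kappa>_measurable [measurable]: "\<kappa> \<in> borel_measurable borel" unfolding \<kappa>_def[abs_def] by measurable

lemma \<kappa>_pos: "0 < \<tau> \<Longrightarrow> 0 < \<kappa> \<tau>" by (simp add: \<kappa>_def)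

lemma \<kappa>_nonneg: "0 \<le> \<kappa> \<tau>" by (simp add: \<kappa>_def)

lemma \<kappa>_powr: "0 < \<tau> \<Longrightarrow> \<kappa> \<tau> powr b = \<tau> powr (b / (2 * s))"
  by (simp add: \<kappa>_def powr_powr)

lemma \<kappa>_powr_2s: "0 \<le> \<tau> \<Longrightarrow> \<kappa> \<tau> powr (2 * s) = \<tau>"
  using s_pos by (cases "\<tau> = 0") (auto simp: \<kappa>_def powr_powr)

lemma heat_measurable [measurable]:
  assumes [measurable]: "g \<in> borel_measurable borel"
  shows "heat c g \<in> borel_measurable borel"
  unfolding heat_def[abs_def] by measurable

lemma heat_integrable:
  assumes [measurable]: "g \<in> borel_measurable borel" and M: "\<And>x. \<bar>g x\<bar> \<le> M"
  shows "integrable N (\<lambda>\<omega>. g (x - c *\<^sub>R Y \<omega>))" "\<bar>heat c g x\<bar> \<le> M"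
  using abs_integral_le_bound[OF finite_measure_axioms, of "\<lambda>\<omega>. g (x - c *\<^sub>R Y \<omega>)" M] M prob_space
  by (auto simp: heat_def)

lemma heat_periodic: "torus_periodic g \<Longrightarrow> torus_periodic (heat c g)"
  unfolding torus_periodic_def heat_def by (simp add: diff_add_eq[symmetric])

lemma heat_smoothing:
  assumes [measurable]: "g \<in> borel_measurable borel" and M: "\<And>x. \<bar>g x\<bar> \<le> M" and c: "0 < c"
  shows "taylor a (M * (K * c powr (- a))) (heat c g) (\<lambda>x. (1 / c) *\<^sub>R (\<integral>\<omega>. g (x - c *\<^sub>R Y \<omega>) *\<^sub>R \<Psi> \<omega> \<partial>N))"
  unfolding taylor_def heat_def using smoothing[OF assms(1) M c] by blast

lemma heat_taylor:
  assumes g [measurable]: "g \<in> borel_measurable borel" and B: "\<And>x. \<bar>g x\<bar> \<le> B" and T: "taylor a A g V"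
  shows "taylor a A (heat c g) (\<lambda>x. \<integral>\<omega>. V (x - c *\<^sub>R Y \<omega>) \<partial>N)"
proof -
  have [measurable]: "V \<in> borel_measurable borel"
    using taylor_gradient_continuous[OF T exponents(3) a_le_2] by (rule borel_measurable_continuous_onI)
  have "taylor a (\<integral>\<omega>. A \<partial>N) (\<lambda>x. \<integral>\<omega>. g (x - c *\<^sub>R Y \<omega>) \<partial>N) (\<lambda>x. \<integral>\<omega>. V (x - c *\<^sub>R Y \<omega>) \<partial>N)"
  proof (rule taylor_average)
    show "integrable N (\<lambda>\<omega>. V (x - c *\<^sub>R Y \<omega>))" for x
      using taylor_gradient_bound[OF T B, of 1]
      by (intro integrable_const_bound[where B = "2 * B + A"]) auto
    show "integrable N (\<lambda>\<omega>. g (x - c *\<^sub>R Y \<omega>))" for x by (rule heat_integrable(1)[OF g B])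
  qed (use T in \<open>auto intro: taylor_shift\<close>)
  then show ?thesis unfolding heat_def[abs_def] by (simp add: prob_space)
qed

definition moment :: real where "moment = (\<integral>\<omega>. norm (Y \<omega>) powr a \<partial>N)"

lemma moment_nonneg: "0 \<le> moment" unfolding moment_def by simp

text \<open>
  Since \<open>Y\<close> has mean \<open>0\<close>, the linear term of the expansion of \<open>g\<close> at \<open>x\<close> drops out and only the
  remainder, of order \<open>|c Y|\<^sup>a\<close>, is averaged.
\<close>
lemma heat_close:
  assumes g [measurable]: "g \<in> borel_measurable borel" and B: "\<And>x. \<bar>g x\<bar> \<le> B" and T: "taylor a A g V" and c: "0 \<le> c"
  shows "\<bar>heat c g x - g x\<bar> \<le> A * (c powr a * moment)"
proof -
  have Yint: "integrable N (\<lambda>\<omega>. V x \<bullet> (- c *\<^sub>R Y \<omega>))"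
    using Y_mean(1) by (intro integrable_inner_right integrable_scaleR_right)
  have zero: "(\<integral>\<omega>. V x \<bullet> (- c *\<^sub>R Y \<omega>) \<partial>N) = 0"
    using integral_inner_right[of "V x" N "\<lambda>\<omega>. - c *\<^sub>R Y \<omega>"] Y_mean by simp
  have I: "integrable N (\<lambda>\<omega>. g (x - c *\<^sub>R Y \<omega>) - g x - V x \<bullet> (- c *\<^sub>R Y \<omega>))"
    by (intro Bochner_Integration.integrable_diff heat_integrable(1)[OF g B] Yint) simp
  have "heat c g x - g x = (\<integral>\<omega>. g (x - c *\<^sub>R Y \<omega>) - g x - V x \<bullet> (- c *\<^sub>R Y \<omega>) \<partial>N)"
  proof -
    have "(\<integral>\<omega>. g (x - c *\<^sub>R Y \<omega>) - g x - V x \<bullet> (- c *\<^sub>R Y \<omega>) \<partial>N) = (\<integral>\<omega>. g (x - c *\<^sub>R Y \<omega>) - g x \<partial>N) - 0"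
      unfolding zero[symmetric]
      by (intro Bochner_Integration.integral_diff Bochner_Integration.integrable_diff heat_integrable(1)[OF g B] Yint) simp
    also have "(\<integral>\<omega>. g (x - c *\<^sub>R Y \<omega>) - g x \<partial>N) = heat c g x - (\<integral>\<omega>. g x \<partial>N)"
      unfolding heat_def by (intro Bochner_Integration.integral_diff heat_integrable(1)[OF g B]) simp
    finally show ?thesis by (simp add: prob_space)
  qed
  also have "\<bar>\<dots>\<bar> \<le> (\<integral>\<omega>. A * (c powr a * norm (Y \<omega>) powr a) \<partial>N)"
  proof (rule abs_integral_le_integral[OF I])
    show "integrable N (\<lambda>\<omega>. A * (c powr a * norm (Y \<omega>) powr a))" using Y_moment by simp
    fix \<omega>
    show "\<bar>g (x - c *\<^sub>R Y \<omega>) - g x - V x \<bullet> (- c *\<^sub>R Y \<omega>)\<bar> \<le> A * (c powr a * norm (Y \<omega>) powr a)"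
      using taylorD[OF T, of x "- c *\<^sub>R Y \<omega>"] c by (simp add: powr_mult)
  qed
  also have "\<dots> = A * (c powr a * moment)" by (simp add: moment_def)
  finally show ?thesis .
qed

lemma character_Y:
  "0 \<le> c \<Longrightarrow> (\<integral>\<omega>. character k (c *\<^sub>R Y \<omega>) \<partial>N) = complex_of_real (exp (- (c powr (2 * s) * symbol k)))"
proof -
  assume c: "0 \<le> c"
  have "(\<integral>\<omega>. character k (c *\<^sub>R Y \<omega>) \<partial>N) = (\<integral>\<omega>. exp (\<i> * complex_of_real ((- (2 * pi * c) *\<^sub>R lattice_vec k) \<bullet> Y \<omega>)) \<partial>N)"
    by (simp add: character_def mult_ac)
  also have "\<dots> = complex_of_real (exp (- (norm (- (2 * pi * c) *\<^sub>R lattice_vec k :: real ^ 'd) powr (2 * s))))"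
    by (rule Y_fourier)
  also have "norm (- (2 * pi * c) *\<^sub>R lattice_vec k :: real ^ 'd) powr (2 * s) = c powr (2 * s) * symbol k"
    using c by (simp add: symbol_def powr_mult mult_ac)
  finally show ?thesis .
qed

text \<open>
  Convolution with the law of \<open>c Y\<close> multiplies Fourier coefficients by its Fourier transform; the
  integral over the cell is invariant under the translation by \<open>c Y\<close>.
\<close>
lemma fcoef_heat:
  assumes g [measurable]: "g \<in> borel_measurable borel" and B: "\<And>x. \<bar>g x\<bar> \<le> B" and per: "torus_periodic g" and c: "0 \<le> c"
  shows "fcoef (heat c g) k = complex_of_real (exp (- (c powr (2 * s) * symbol k))) * fcoef g k"
proof -
  interpret P: pair_prob_space "cell_measure :: (real ^ 'd) measure" N ..
  have bnd: "norm (complex_of_real (g y) * character k x) \<le> B" for x y using B[of y] by (simp add: norm_mult)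
  have "fcoef (heat c g) k = (\<integral>x. (\<integral>\<omega>. complex_of_real (g (x - c *\<^sub>R Y \<omega>)) * character k x \<partial>N) \<partial>cell_measure)"
    by (simp add: fcoef_def heat_def)
  also have "\<dots> = (\<integral>\<omega>. (\<integral>x. complex_of_real (g (x - c *\<^sub>R Y \<omega>)) * character k x \<partial>cell_measure) \<partial>N)"
    by (rule P.Fubini_integral[symmetric], rule P.integrable_const_bound[where B = B]) (use bnd in auto)
  also have "\<dots> = (\<integral>\<omega>. character k (c *\<^sub>R Y \<omega>) * fcoef g k \<partial>N)"
  proof (intro Bochner_Integration.integral_cong refl)
    fix \<omega>
    define G where "G = (\<lambda>x. complex_of_real (g x) * character k x)"
    have "torus_periodic G"
      using per torus_periodic_character[of k] by (simp add: torus_periodic_def G_def)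
    moreover have [measurable]: "G \<in> borel_measurable borel" unfolding G_def by measurable
    ultimately have "(\<integral>x. G (x + (- c *\<^sub>R Y \<omega>)) \<partial>cell_measure) = fcoef g k"
      unfolding fcoef_def G_def[symmetric] by (intro integral_cell_translate) auto
    moreover have "complex_of_real (g (x - c *\<^sub>R Y \<omega>)) * character k x = character k (c *\<^sub>R Y \<omega>) * G (x + (- c *\<^sub>R Y \<omega>))" for x
      using character_add_arg[of k "x - c *\<^sub>R Y \<omega>" "c *\<^sub>R Y \<omega>"] by (simp add: G_def)
    ultimately show "(\<integral>x. complex_of_real (g (x - c *\<^sub>R Y \<omega>)) * character k x \<partial>cell_measure) = character k (c *\<^sub>R Y \<omega>) * fcoef g k"
      by simp
  qed
  also have "\<dots> = complex_of_real (exp (- (c powr (2 * s) * symbol k))) * fcoef g k"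
    using c by (simp add: character_Y)
  finally show ?thesis .
qed

end

section \<open>Mild solutions\<close>

text \<open>
  A point where \<open>g\<close> does not vanish is moved to the centre of the cell by a translation, which
  preserves the integral of \<open>|g|\<close>; near the centre almost everywhere and everywhere agree.
\<close>
lemma continuous_periodic_AE_zero:
  fixes g :: "real ^ 'd \<Rightarrow> real"
  assumes g: "continuous_on UNIV g" and per: "torus_periodic g" and AE: "AE x in cell_measure. g x = 0"
  shows "g x = 0"
proof (rule ccontr)
  assume nz: "g x \<noteq> 0"
  have [measurable]: "g \<in> borel_measurable borel" using g by (rule borel_measurable_continuous_onI)
  \<comment> \<open>The translation that moves the centre of the cell to \<open>x\<close>.\<close>
  define a where "a = x - (\<chi> i. 1 / 2)"
  have per': "torus_periodic (\<lambda>x. ennreal \<bar>g x\<bar>)" using per by (simp add: torus_periodic_def)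
  have "(\<integral>\<^sup>+y. ennreal \<bar>g (y + a)\<bar> \<partial>cell_measure) = (\<integral>\<^sup>+y. ennreal \<bar>g y\<bar> \<partial>cell_measure)"
    by (rule nn_integral_cell_translate[OF _ per']) measurable
  also have "\<dots> = (\<integral>\<^sup>+y. 0 \<partial>(cell_measure :: (real ^ 'd) measure))"
    by (rule nn_integral_cong_AE) (use AE in \<open>auto elim: eventually_mono\<close>)
  finally have "(\<integral>\<^sup>+y. ennreal \<bar>g (y + a)\<bar> \<partial>cell_measure) = 0" by simp
  then have "AE y in cell_measure. ennreal \<bar>g (y + a)\<bar> = 0" by (subst (asm) nn_integral_0_iff_AE) auto
  then have *: "AE y in lborel. y \<in> unit_cell \<longrightarrow> g (y + a) = 0" by (simp add: AE_cell_measure)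
  define S where "S = {y \<in> box 0 (\<chi> i. 1). g (y + a) \<noteq> 0}"
  have "continuous_on UNIV (\<lambda>y. g (y + a))" by (rule continuous_on_compose2[OF g]) (auto intro: continuous_intros)
  then have "open {y. g (y + a) \<noteq> 0}" by (rule open_Collect_neq) (rule continuous_on_const)
  then have "open S" unfolding S_def using open_Int[OF open_box] by (simp add: Collect_conj_eq)
  moreover have "(\<chi> i. 1 / 2) \<in> S" using nz by (simp add: S_def a_def mem_box_cart)
  moreover have "AE y in lborel. y \<notin> S"
    using * by (rule eventually_mono) (auto simp: S_def unit_cell_def mem_box_cart less_imp_le)
  then have "AE y in lebesgue. y \<notin> S" by (rule AE_completion)
  then have "negligible S"
    using \<open>open S\<close> by (subst negligible_iff_null_sets, subst AE_iff_null_sets) auto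
  ultimately show False using open_not_negligible by blast
qed

lemma continuous_periodic_eqI:
  fixes g g' :: "real ^ 'd \<Rightarrow> real"
  assumes "continuous_on UNIV g" "continuous_on UNIV g'" "torus_periodic g" "torus_periodic g'"
    and int: "integrable cell_measure g" "integrable cell_measure g'"
    and "\<And>k. fcoef g k = fcoef g' k"
  shows "g x = g' x"
proof -
  have "AE x in cell_measure. g x - g' x = 0"
  proof (rule fourier_uniqueness)
    show "integrable cell_measure (\<lambda>x. g x - g' x)" using int by simp
    fix k
    have i: "integrable cell_measure (\<lambda>x. complex_of_real (h x) * character k x)" if "integrable cell_measure h" for h :: "real ^ 'd \<Rightarrow> real"
      using that by (intro integrable_mult_character) (simp add: complex_of_real_integrable_eq)
    show "(\<integral>x. complex_of_real (g x - g' x) * character k x \<partial>cell_measure) = 0"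
      using assms(7)[of k] i[OF int(1)] i[OF int(2)]
      by (simp add: fcoef_def left_diff_distrib)
  qed
  then have "g x - g' x = 0"
    by (intro continuous_periodic_AE_zero[where g = "\<lambda>x. g x - g' x"])
       (use assms in \<open>auto intro!: continuous_intros simp: torus_periodic_def\<close>)
  then show ?thesis by simp
qed

lemma fcoef_bound:
  fixes g :: "real ^ 'd \<Rightarrow> real"
  assumes "g \<in> borel_measurable borel" "\<And>x. \<bar>g x\<bar> \<le> M"
  shows "norm (fcoef g k) \<le> M" "integrable cell_measure (\<lambda>x. complex_of_real (g x) * character k x)"
proof -
  show I: "integrable cell_measure (\<lambda>x. complex_of_real (g x) * character k x)"
    using assms by (intro cell.integrable_const_bound[where B = M]) (auto simp: norm_mult)
  have "norm (fcoef g k) \<le> (\<integral>x. norm (complex_of_real (g x) * character k x) \<partial>cell_measure)"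
    unfolding fcoef_def by (rule integral_norm_bound)
  also have "\<dots> \<le> (\<integral>x. M \<partial>(cell_measure :: (real ^ 'd) measure))"
    by (rule integral_mono[OF integrable_norm[OF I]]) (simp_all add: norm_mult assms)
  finally show "norm (fcoef g k) \<le> M" using cell.prob_space[where 'd = 'd] by simp
qed

context torus_kernel
begin

lemma K_nonneg: "0 \<le> K"
proof -
  obtain b :: "real ^ 'd" where "b \<in> Basis" using nonempty_Basis by blast
  then show ?thesis
    using taylor_const_nonneg[OF heat_smoothing[of "\<lambda>_. 1" 1 1]] by simp
qed

text \<open>
  Smoothing at the time \<open>\<tau>\<close> costs \<open>\<kappa> \<tau> powr (- a) = \<tau> powr (- decay)\<close>.
\<close>
definition decay :: real where "decay = a / (2 * s)"

lemma decay: "0 < decay" "decay < 1" using exponents by (auto simp: decay_def field_simps)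

text \<open>
  \<open>K\<close> times the integral of \<open>\<tau> powr (- decay)\<close> from \<open>0\<close> to \<open>L\<close>.
\<close>
definition smooth_const :: "real \<Rightarrow> real" where "smooth_const L = K * (L powr (1 - decay) / (1 - decay))"

lemma smooth_const_mono: "0 \<le> L \<Longrightarrow> L \<le> L' \<Longrightarrow> smooth_const L \<le> smooth_const L'"
  unfolding smooth_const_def using decay K_nonneg by (intro mult_left_mono divide_right_mono powr_mono2) auto

end

text \<open>
  The data of the terminal value problem after passing to a bounded periodic Borel representative of
  the source, with the terminal datum described by its first-order expansion.
\<close>
locale duhamel = torus_kernel N Y \<Psi> s a K
  for N :: "'w measure" and Y \<Psi> :: "'w \<Rightarrow> real ^ 'd" and s a K :: real +
  fixes f :: "real ^ 'd \<Rightarrow> real \<Rightarrow> real" and uT :: "real ^ 'd \<Rightarrow> real" and U :: "real ^ 'd \<Rightarrow> real ^ 'd"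
    and M A B T :: real
  assumes f_meas [measurable]: "case_prod f \<in> borel_measurable (borel \<Otimes>\<^sub>M borel)"
    and f_bound: "\<bar>f x t\<bar> \<le> M"
    and f_per: "torus_periodic (\<lambda>x. f x t)"
    and uT_per: "torus_periodic uT"
    and uT_bound: "\<bar>uT x\<bar> \<le> B"
    and uT_taylor: "taylor a A uT U"
    and T_pos: "0 < T"
begin

lemma uT_meas [measurable]: "uT \<in> borel_measurable borel"
  using taylor_continuous[OF uT_taylor exponents(3)] by (rule borel_measurable_continuous_onI)

lemma M_nonneg: "0 \<le> M" using f_bound[of 0 0] by simp
lemma B_nonneg: "0 \<le> B" using uT_bound[of 0] by simp

definition src :: "real \<Rightarrow> real \<Rightarrow> real ^ 'd \<Rightarrow> real" where
  "src t L x = (\<integral>\<tau>. heat (\<kappa> \<tau>) (\<lambda>y. f y (t + \<tau>)) x \<partial>ivl L)"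

lemma heat_source_measurable [measurable]: "(\<lambda>(x, \<tau>). heat (\<kappa> \<tau>) (\<lambda>y. f y (t + \<tau>)) x) \<in> borel_measurable (borel \<Otimes>\<^sub>M borel)"
  unfolding heat_def case_prod_beta by measurable

lemma f_slice_meas [measurable]: "(\<lambda>y. f y t) \<in> borel_measurable borel" by measurable

lemma heat_source_bound: "\<bar>heat (\<kappa> \<tau>) (\<lambda>y. f y (t + \<tau>)) x\<bar> \<le> M"
  by (rule heat_integrable(2)) (auto simp: f_bound)

lemma src_meas [measurable]: "src t L \<in> borel_measurable borel"
proof -
  have "sigma_finite_measure (ivl L)" by (rule ivl.sigma_finite_measure_axioms)
  then interpret sigma_finite_measure "ivl L" .
  show ?thesis unfolding src_def[abs_def] by measurable
qed

lemma src_integrable: "integrable (ivl L) (\<lambda>\<tau>. heat (\<kappa> \<tau>) (\<lambda>y. f y (t + \<tau>)) x)"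
  by (rule abs_integral_le_bound(1)[OF finite_measure_ivl _ heat_source_bound]) measurable

lemma src_bound: "0 \<le> L \<Longrightarrow> \<bar>src t L x\<bar> \<le> M * L"
proof -
  assume L: "0 \<le> L"
  have "\<bar>src t L x\<bar> \<le> M * measure (ivl L) (space (ivl L))"
    unfolding src_def by (rule abs_integral_le_bound(2)[OF finite_measure_ivl _ heat_source_bound]) measurable
  then show ?thesis using L by (simp add: measure_ivl)
qed

lemma src_periodic: "torus_periodic (src t L)"
  using heat_periodic[OF f_per] unfolding src_def[abs_def] torus_periodic_def by simp

text \<open>
  At the time \<open>\<tau>\<close> the semigroup produces an expansion with the constant \<open>M K \<tau>\<^bsup>-a/(2s)\<^esup>\<close>, which is
  integrable at \<open>0\<close> because \<open>a < 2s\<close>.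
\<close>
lemma src_taylor:
  assumes L: "0 \<le> L"
  shows "\<exists>V. taylor a (M * smooth_const L) (src t L) V"
proof -
  define V where "V = (\<lambda>\<tau> x. (1 / \<kappa> \<tau>) *\<^sub>R (\<integral>\<omega>. f (x - \<kappa> \<tau> *\<^sub>R Y \<omega>) (t + \<tau>) *\<^sub>R \<Psi> \<omega> \<partial>N))"
  have "taylor a (\<integral>\<tau>. M * (K * \<kappa> \<tau> powr (- a)) \<partial>ivl L) (\<lambda>x. \<integral>\<tau>. heat (\<kappa> \<tau>) (\<lambda>y. f y (t + \<tau>)) x \<partial>ivl L) (\<lambda>x. \<integral>\<tau>. V \<tau> x \<partial>ivl L)"
  proof (rule taylor_average[where W = "\<lambda>\<tau>. heat (\<kappa> \<tau>) (\<lambda>y. f y (t + \<tau>))" and V = V and A = "\<lambda>\<tau>. M * (K * \<kappa> \<tau> powr (- a))"])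
    show "integrable (ivl L) (\<lambda>\<tau>. heat (\<kappa> \<tau>) (\<lambda>y. f y (t + \<tau>)) x)" for x by (rule src_integrable)
    show "AE \<tau> in ivl L. taylor a (M * (K * \<kappa> \<tau> powr (- a))) (heat (\<kappa> \<tau>) (\<lambda>y. f y (t + \<tau>))) (V \<tau>)"
      using AE_ivl_pos[of L]
    proof eventually_elim
      case (elim \<tau>)
      then show ?case unfolding V_def by (intro heat_smoothing) (auto simp: f_bound \<kappa>_pos)
    qed
    have "integrable (ivl L) (\<lambda>\<tau>. \<kappa> \<tau> powr (- a))"
    proof (rule integrable_cong_AE_imp[OF integrable_ivl_powr(1)])
      show "AE \<tau> in ivl L. \<tau> powr (- decay) = \<kappa> \<tau> powr (- a)"
        using AE_ivl_pos[of L] by eventually_elim (simp add: \<kappa>_powr decay_def)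
    qed (use decay L in auto)
    then show "integrable (ivl L) (\<lambda>\<tau>. M * (K * \<kappa> \<tau> powr (- a)))" by simp
    fix x
    have nb: "norm (\<integral>\<omega>. f (x - \<kappa> \<tau> *\<^sub>R Y \<omega>) (t + \<tau>) *\<^sub>R \<Psi> \<omega> \<partial>N) \<le> M * (\<integral>\<omega>. norm (\<Psi> \<omega>) \<partial>N)" for \<tau>
    proof -
      have "norm (\<integral>\<omega>. f (x - \<kappa> \<tau> *\<^sub>R Y \<omega>) (t + \<tau>) *\<^sub>R \<Psi> \<omega> \<partial>N) \<le> (\<integral>\<omega>. norm (f (x - \<kappa> \<tau> *\<^sub>R Y \<omega>) (t + \<tau>) *\<^sub>R \<Psi> \<omega>) \<partial>N)"
        by (rule integral_norm_bound)
      also have "\<dots> \<le> (\<integral>\<omega>. M * norm (\<Psi> \<omega>) \<partial>N)"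
        using f_bound M_nonneg by (intro integral_mono') (auto intro!: mult_right_mono \<Psi>_integrable)
      finally show ?thesis by simp
    qed
    show "integrable (ivl L) (\<lambda>\<tau>. V \<tau> x)"
    proof (rule Bochner_Integration.integrable_bound)
      show "integrable (ivl L) (\<lambda>\<tau>. \<tau> powr (- (1 / (2 * s))) * (M * (\<integral>\<omega>. norm (\<Psi> \<omega>) \<partial>N)))"
        using exponents L by (intro integrable_mult_left integrable_ivl_powr(1)) auto
      show "(\<lambda>\<tau>. V \<tau> x) \<in> borel_measurable (ivl L)" unfolding V_def by measurable
      show "AE \<tau> in ivl L. norm (V \<tau> x) \<le> norm (\<tau> powr (- (1 / (2 * s))) * (M * (\<integral>\<omega>. norm (\<Psi> \<omega>) \<partial>N)))"
        using AE_ivl_pos[of L]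
      proof eventually_elim
        case (elim \<tau>)
        have "norm (V \<tau> x) = \<tau> powr (- (1 / (2 * s))) * norm (\<integral>\<omega>. f (x - \<kappa> \<tau> *\<^sub>R Y \<omega>) (t + \<tau>) *\<^sub>R \<Psi> \<omega> \<partial>N)"
          using elim by (simp add: V_def \<kappa>_def powr_minus_divide)
        also have "\<dots> \<le> \<tau> powr (- (1 / (2 * s))) * (M * (\<integral>\<omega>. norm (\<Psi> \<omega>) \<partial>N))"
          by (intro mult_left_mono nb) simp
        finally show ?case by (rule order_trans) simp
      qed
    qed
  qed
  moreover have "(\<integral>\<tau>. M * (K * \<kappa> \<tau> powr (- a)) \<partial>ivl L) = M * smooth_const L"
  proof -
    have "(\<integral>\<tau>. \<kappa> \<tau> powr (- a) \<partial>ivl L) = (\<integral>\<tau>. \<tau> powr (- decay) \<partial>ivl L)"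
      using AE_ivl_pos[of L] by (intro integral_cong_AE) (auto simp: \<kappa>_powr decay_def)
    also have "\<dots> = L powr (1 - decay) / (1 - decay)" using decay L by (intro integrable_ivl_powr(2)) auto
    finally show ?thesis by (simp add: smooth_const_def)
  qed
  ultimately show ?thesis unfolding src_def[abs_def] by auto
qed

lemma fcoef_f_meas [measurable]: "(\<lambda>t. fcoef (\<lambda>y. f y t) k) \<in> borel_measurable borel"
  unfolding fcoef_def by measurable

lemma fcoef_src:
  assumes L: "0 \<le> L"
  shows "fcoef (src t L) k = (\<integral>\<tau>. complex_of_real (exp (- (\<tau> * symbol k))) * fcoef (\<lambda>y. f y (t + \<tau>)) k \<partial>ivl L)"
proof -
  interpret P: pair_sigma_finite "cell_measure :: (real ^ 'd) measure" "ivl L" ..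
  interpret F: finite_measure "cell_measure \<Otimes>\<^sub>M ivl L :: ((real ^ 'd) \<times> real) measure"
    by (rule finite_measure_pair_measure) unfold_locales
  have "fcoef (src t L) k = (\<integral>x. (\<integral>\<tau>. complex_of_real (heat (\<kappa> \<tau>) (\<lambda>y. f y (t + \<tau>)) x) * character k x \<partial>ivl L) \<partial>cell_measure)"
    by (simp add: fcoef_def src_def)
  also have "\<dots> = (\<integral>\<tau>. fcoef (heat (\<kappa> \<tau>) (\<lambda>y. f y (t + \<tau>))) k \<partial>ivl L)"
    unfolding fcoef_def
  proof (rule P.Fubini_integral[symmetric], rule F.integrable_const_bound[where B = M])
    show "AE p in cell_measure \<Otimes>\<^sub>M ivl L. norm (case p of (x, \<tau>) \<Rightarrow> complex_of_real (heat (\<kappa> \<tau>) (\<lambda>y. f y (t + \<tau>)) x) * character k x) \<le> M"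
      by (intro AE_I2) (auto simp: norm_mult heat_source_bound)
  qed measurable
  also have "\<dots> = (\<integral>\<tau>. complex_of_real (exp (- (\<tau> * symbol k))) * fcoef (\<lambda>y. f y (t + \<tau>)) k \<partial>ivl L)"
  proof (rule integral_cong_AE)
    show "(\<lambda>\<tau>. fcoef (heat (\<kappa> \<tau>) (\<lambda>y. f y (t + \<tau>))) k) \<in> borel_measurable (ivl L)"
      unfolding fcoef_def by measurable
    show "AE \<tau> in ivl L. fcoef (heat (\<kappa> \<tau>) (\<lambda>y. f y (t + \<tau>))) k = complex_of_real (exp (- (\<tau> * symbol k))) * fcoef (\<lambda>y. f y (t + \<tau>)) k"
      using AE_ivl_pos[of L]
    proof eventually_elim
      case (elim \<tau>)
      then show ?case
        using fcoef_heat[of "\<lambda>y. f y (t + \<tau>)" M "\<kappa> \<tau>" k] by (simp add: f_bound f_per \<kappa>_nonneg \<kappa>_powr_2s)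
    qed
  qed measurable
  finally show ?thesis .
qed

text \<open>
  Duhamel's formula, with time running backwards from \<open>T\<close>.
\<close>
definition mild :: "real \<Rightarrow> real ^ 'd \<Rightarrow> real" where
  "mild t x = heat (\<kappa> (T - t)) uT x - src t (T - t) x"

definition grad_const :: real where "grad_const = A + M * smooth_const T"

lemma mild_meas [measurable]: "mild t \<in> borel_measurable borel"
  unfolding mild_def[abs_def] by measurable

lemma mild_bound: "0 \<le> t \<Longrightarrow> t \<le> T \<Longrightarrow> \<bar>mild t x\<bar> \<le> B + M * T"
proof -
  assume t: "0 \<le> t" "t \<le> T"
  have "\<bar>heat (\<kappa> (T - t)) uT x\<bar> \<le> B" by (rule heat_integrable(2)) (auto simp: uT_bound)
  moreover have "\<bar>src t (T - t) x\<bar> \<le> M * (T - t)" using t by (intro src_bound) simp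
  moreover have "M * (T - t) \<le> M * T" using t M_nonneg by (intro mult_left_mono) auto
  ultimately show ?thesis unfolding mild_def by linarith
qed

lemma mild_periodic: "torus_periodic (mild t)"
  using heat_periodic[OF uT_per, of "\<kappa> (T - t)"] src_periodic[of t "T - t"]
  by (simp add: mild_def[abs_def] torus_periodic_def)

lemma mild_taylor: "0 \<le> t \<Longrightarrow> t \<le> T \<Longrightarrow> \<exists>V. taylor a grad_const (mild t) V"
proof -
  assume t: "0 \<le> t" "t \<le> T"
  obtain V where V: "taylor a (M * smooth_const (T - t)) (src t (T - t)) V" using src_taylor[of "T - t" t] t by auto
  have "taylor a (A + M * smooth_const (T - t)) (mild t) (\<lambda>x. (\<integral>\<omega>. U (x - \<kappa> (T - t) *\<^sub>R Y \<omega>) \<partial>N) - V x)"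
    unfolding mild_def[abs_def] by (intro taylor_diff V heat_taylor[OF uT_meas uT_bound uT_taylor])
  moreover have "A + M * smooth_const (T - t) \<le> grad_const"
    unfolding grad_const_def using t M_nonneg by (intro add_left_mono mult_left_mono smooth_const_mono) auto
  ultimately show ?thesis using taylor_mono by blast
qed

lemma fcoef_diff:
  assumes "g \<in> borel_measurable borel" "\<And>x. \<bar>g x\<bar> \<le> C" "g' \<in> borel_measurable borel" "\<And>x. \<bar>g' x\<bar> \<le> D"
  shows "fcoef (\<lambda>x. g x - g' x) k = fcoef g k - fcoef g' k"
  using fcoef_bound(2)[OF assms(1,2)] fcoef_bound(2)[OF assms(3,4)]
  by (simp add: fcoef_def left_diff_distrib)

lemma fcoef_mild:
  assumes t: "t \<le> T"
  shows "fcoef (mild t) k = complex_of_real (exp (- ((T - t) * symbol k))) * fcoef uT k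
    - (\<integral>\<tau>. complex_of_real (exp (- (\<tau> * symbol k))) * fcoef (\<lambda>y. f y (t + \<tau>)) k \<partial>ivl (T - t))"
proof -
  have "fcoef (mild t) k = fcoef (heat (\<kappa> (T - t)) uT) k - fcoef (src t (T - t)) k"
    unfolding mild_def[abs_def]
    by (rule fcoef_diff[where C = B and D = "M * (T - t)"])
       (use t uT_bound in \<open>auto intro: src_bound heat_integrable(2)\<close>)
  then show ?thesis
    using t fcoef_src[of "T - t" t k] fcoef_heat[OF uT_meas uT_bound uT_per \<kappa>_nonneg, of "T - t" k]
    by (simp add: \<kappa>_powr_2s)
qed

lemma symbol_nonneg: "0 \<le> symbol k" by (simp add: symbol_def)

text \<open>
  Both sides are continuous and periodic, and the identity of their Fourier coefficients is the
  elementary flow property of a scalar linear equation.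
\<close>
lemma mild_semigroup:
  assumes t: "0 \<le> t" "0 \<le> h" "t + h \<le> T"
  shows "mild t x = heat (\<kappa> h) (mild (t + h)) x - src t h x"
proof (rule continuous_periodic_eqI)
  let ?g = "\<lambda>x. heat (\<kappa> h) (mild (t + h)) x - src t h x"
  have th: "0 \<le> t" "t \<le> T" "0 \<le> t + h" using t by auto
  have wb: "\<And>x. \<bar>mild (t + h) x\<bar> \<le> B + M * T" using mild_bound[of "t + h"] t by simp
  have hb: "\<And>x. \<bar>heat (\<kappa> h) (mild (t + h)) x\<bar> \<le> B + M * T" by (rule heat_integrable(2)) (auto simp: wb)
  have sb: "\<And>x. \<bar>src t h x\<bar> \<le> M * h" by (rule src_bound) (use t in simp)
  have gb: "\<bar>?g x\<bar> \<le> B + M * T + M * h" for x using hb[of x] sb[of x] by linarith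
  show "continuous_on UNIV (mild t)"
    using mild_taylor[of t] taylor_continuous exponents(3) th by blast
  obtain V where "taylor a grad_const (mild (t + h)) V" using mild_taylor[of "t + h"] t by auto
  then have "continuous_on UNIV (heat (\<kappa> h) (mild (t + h)))"
    by (intro taylor_continuous[OF heat_taylor[OF mild_meas wb] exponents(3)])
  moreover have "continuous_on UNIV (src t h)" using src_taylor[of h t] taylor_continuous exponents(3) t by blast
  ultimately show "continuous_on UNIV ?g" by (rule continuous_on_diff)
  show "torus_periodic (mild t)" by (rule mild_periodic)
  show "torus_periodic ?g"
    using heat_periodic[OF mild_periodic, of "\<kappa> h" "t + h"] src_periodic[of t h] by (simp add: torus_periodic_def)
  show "integrable cell_measure (mild t)"
    using mild_bound[of t] th by (intro cell.integrable_const_bound[where B = "B + M * T"]) auto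
  show "integrable cell_measure ?g"
    using gb by (intro cell.integrable_const_bound[where B = "B + M * T + M * h"]) auto
  fix k
  let ?F = "\<lambda>\<tau>. complex_of_real (exp (- (\<tau> * symbol k))) * fcoef (\<lambda>y. f y (t + \<tau>)) k"
  have "AE \<tau> in ivl L. norm (?F \<tau>) \<le> M" for L
    using AE_ivl_pos[of L]
  proof eventually_elim
    case (elim \<tau>)
    have "exp (- (\<tau> * symbol k)) * norm (fcoef (\<lambda>y. f y (t + \<tau>)) k) \<le> 1 * M"
      using elim symbol_nonneg[of k] by (intro mult_mono fcoef_bound) (auto simp: f_bound)
    then show ?case by (simp add: norm_mult)
  qed
  then have Fint: "integrable (ivl L) ?F" for L
    by (intro ivl.integrable_const_bound[where B = M]) auto
  have e: "exp (- (h * symbol k)) * exp (- ((T - (t + h)) * symbol k)) = exp (- ((T - t) * symbol k))"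
    by (simp add: mult_exp_exp algebra_simps)
  have "fcoef ?g k = fcoef (heat (\<kappa> h) (mild (t + h))) k - fcoef (src t h) k"
    by (rule fcoef_diff[OF _ hb _ sb]) auto
  also have "\<dots> = complex_of_real (exp (- (h * symbol k))) * fcoef (mild (t + h)) k - (\<integral>\<tau>. ?F \<tau> \<partial>ivl h)"
    using t fcoef_heat[OF mild_meas wb mild_periodic \<kappa>_nonneg, of h k] by (simp add: \<kappa>_powr_2s fcoef_src)
  also have "fcoef (mild (t + h)) k = complex_of_real (exp (- ((T - (t + h)) * symbol k))) * fcoef uT k
    - (\<integral>\<tau>. complex_of_real (exp (- (\<tau> * symbol k))) * fcoef (\<lambda>y. f y (t + h + \<tau>)) k \<partial>ivl (T - (t + h)))"
    using t by (intro fcoef_mild) simp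
  also have "complex_of_real (exp (- (h * symbol k))) * (complex_of_real (exp (- ((T - (t + h)) * symbol k))) * fcoef uT k
    - (\<integral>\<tau>. complex_of_real (exp (- (\<tau> * symbol k))) * fcoef (\<lambda>y. f y (t + h + \<tau>)) k \<partial>ivl (T - (t + h))))
    = complex_of_real (exp (- ((T - t) * symbol k))) * fcoef uT k - (\<integral>\<tau>. ?F (h + \<tau>) \<partial>ivl (T - (t + h)))"
  proof -
    have "?F (h + \<tau>) = complex_of_real (exp (- (h * symbol k))) * (complex_of_real (exp (- (\<tau> * symbol k))) * fcoef (\<lambda>y. f y (t + h + \<tau>)) k)" for \<tau>
      by (simp add: distrib_right exp_add[symmetric] add.assoc flip: of_real_mult)
    then show ?thesis
      unfolding e[symmetric] by (simp add: right_diff_distrib)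
  qed
  also have "complex_of_real (exp (- ((T - t) * symbol k))) * fcoef uT k - (\<integral>\<tau>. ?F (h + \<tau>) \<partial>ivl (T - (t + h))) - (\<integral>\<tau>. ?F \<tau> \<partial>ivl h)
     = complex_of_real (exp (- ((T - t) * symbol k))) * fcoef uT k - (\<integral>\<tau>. ?F \<tau> \<partial>ivl (T - t))"
    using integral_ivl_split[OF Fint, of h "T - (t + h)"] t by simp
  also have "\<dots> = fcoef (mild t) k" using th by (simp add: fcoef_mild)
  finally show "fcoef (mild t) k = fcoef ?g k" by simp
qed

definition time_const :: real where "time_const = grad_const * moment + M * T powr (1 - decay)"

text \<open>
  By the flow property the time increment consists of the displacement by \<open>P(h)\<close> of a function with
  an expansion, and of a source term of order \<open>h\<close>.
\<close>
lemma mild_time: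
  assumes t: "0 \<le> t" "0 \<le> h" "t + h \<le> T"
  shows "\<bar>mild t x - mild (t + h) x\<bar> \<le> time_const * \<kappa> h powr a"
proof (cases "h = 0")
  case False
  then have h: "0 < h" using t by simp
  have wb: "\<And>x. \<bar>mild (t + h) x\<bar> \<le> B + M * T" using mild_bound[of "t + h"] t by simp
  obtain V where V: "taylor a grad_const (mild (t + h)) V" using mild_taylor[of "t + h"] t by auto
  have "\<bar>mild t x - mild (t + h) x\<bar> \<le> \<bar>heat (\<kappa> h) (mild (t + h)) x - mild (t + h) x\<bar> + \<bar>src t h x\<bar>"
    unfolding mild_semigroup[OF t] by linarith
  also have "\<dots> \<le> grad_const * (\<kappa> h powr a * moment) + M * h"
    by (intro add_mono heat_close[OF mild_meas wb V] src_bound \<kappa>_nonneg t)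
  \<comment> \<open>One part of \<open>h = h powr (1 - decay) * h powr decay\<close> is bounded by the length of the time interval.\<close>
  also have "M * h \<le> M * (T powr (1 - decay) * \<kappa> h powr a)"
  proof (intro mult_left_mono M_nonneg)
    have "h = h powr (1 - decay) * h powr decay" using h by (simp add: powr_add[symmetric])
    also have "\<dots> \<le> T powr (1 - decay) * h powr decay" using h t decay by (intro mult_right_mono powr_mono2) auto
    finally show "h \<le> T powr (1 - decay) * \<kappa> h powr a" using h by (simp add: \<kappa>_powr decay_def)
  qed
  finally show ?thesis by (simp add: time_const_def algebra_simps)
qed (use t in \<open>simp add: \<kappa>_def\<close>)

end

section \<open>A linear integral equation in time\<close>

lemma exp_integral_Icc:
  fixes t r l :: real
  assumes "t \<le> r"
  shows "(\<integral>\<tau>. indicator {t..r} \<tau> * (l * exp (- (l * (\<tau> - t)))) \<partial>lborel) = 1 - exp (- (l * (r - t)))"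
proof -
  have "(\<integral>\<tau>. (l * exp (- (l * (\<tau> - t)))) * indicator {t..r} \<tau> \<partial>lborel) = - exp (- (l * (r - t))) - - exp (- (l * (t - t)))"
    by (rule integral_FTC_Icc_real[OF assms, where F = "\<lambda>\<tau>. - exp (- (l * (\<tau> - t)))"])
       (auto intro!: derivative_eq_intros continuous_intros)
  then show ?thesis by (simp add: mult.commute)
qed

text \<open>
  The variation of constants formula for \<open>c' = p = l c + q\<close>, where \<open>c(t) = A - \<integral> p\<close> is only
  absolutely continuous. The integration by parts of \<open>exp (- l (\<tau> - t)) c(\<tau>)\<close> is replaced by
  Fubini's theorem on the triangle \<open>t \<le> \<tau> \<le> r \<le> T\<close>.
\<close>
lemma duhamel_of_integral_equation:
  fixes p q :: "real \<Rightarrow> complex" and l :: real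
  assumes p: "integrable lborel (\<lambda>\<tau>. indicator {0..T} \<tau> *\<^sub>R p \<tau>)" and [measurable]: "p \<in> borel_measurable borel"
    and [measurable]: "q \<in> borel_measurable borel"
    and eq: "AE \<tau> in lborel. 0 \<le> \<tau> \<and> \<tau> \<le> T \<longrightarrow> p \<tau> = complex_of_real l * (A - (\<integral>r. indicator {\<tau>..T} r *\<^sub>R p r \<partial>lborel)) + q \<tau>"
    and t: "0 \<le> t" "t \<le> T" and l: "0 \<le> l"
  shows "A - (\<integral>r. indicator {t..T} r *\<^sub>R p r \<partial>lborel)
    = complex_of_real (exp (- (l * (T - t)))) * A - (\<integral>\<tau>. indicator {t..T} \<tau> *\<^sub>R (complex_of_real (exp (- (l * (\<tau> - t)))) * q \<tau>) \<partial>lborel)"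
proof -
  define e where "e = (\<lambda>\<tau>. complex_of_real (exp (- (l * (\<tau> - t)))))"
  have [measurable]: "e \<in> borel_measurable borel" unfolding e_def by measurable
  define J where "J = (\<lambda>\<tau>. \<integral>r. indicator {\<tau>..T} r *\<^sub>R p r \<partial>lborel)"
  have J_meas [measurable]: "J \<in> borel_measurable borel"
  proof -
    have "J = (\<lambda>\<tau>. \<integral>r. (if \<tau> \<le> r \<and> r \<le> T then 1 else 0) *\<^sub>R p r \<partial>lborel)"
      unfolding J_def by (intro ext Bochner_Integration.integral_cong) (auto simp: indicator_def)
    then show ?thesis by simp
  qed
  have e1: "norm (e \<tau>) \<le> 1" if "t \<le> \<tau>" for \<tau> using that l by (simp add: e_def)
  have ind: "integrable lborel (\<lambda>\<tau>. indicator {t..T} \<tau> :: real)"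
    using integrable_real_indicator[of "{t..T}" lborel] by (auto simp: emeasure_lborel_Icc_eq)
  have pt: "integrable lborel (\<lambda>\<tau>. indicator {t..T} \<tau> *\<^sub>R p \<tau>)"
    by (rule Bochner_Integration.integrable_bound[OF p]) (use t in \<open>auto simp: indicator_def\<close>)
  have ept: "integrable lborel (\<lambda>\<tau>. indicator {t..T} \<tau> *\<^sub>R (e \<tau> * p \<tau>))"
  proof (rule Bochner_Integration.integrable_bound[OF pt])
    show "AE \<tau> in lborel. norm (indicator {t..T} \<tau> *\<^sub>R (e \<tau> * p \<tau>)) \<le> norm (indicator {t..T} \<tau> *\<^sub>R p \<tau>)"
      using e1 by (intro AE_I2) (auto simp: indicator_def norm_mult intro!: mult_left_le_one_le)
  qed measurable
  have le: "integrable lborel (\<lambda>\<tau>. indicator {t..T} \<tau> *\<^sub>R (complex_of_real l * e \<tau>))"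
  proof (rule Bochner_Integration.integrable_bound)
    show "integrable lborel (\<lambda>\<tau>. l * indicator {t..T} \<tau> :: real)" by (intro integrable_mult_right ind)
    show "AE \<tau> in lborel. norm (indicator {t..T} \<tau> *\<^sub>R (complex_of_real l * e \<tau>)) \<le> norm (l * indicator {t..T} \<tau> :: real)"
      using e1 l by (intro AE_I2) (auto simp: indicator_def norm_mult intro!: mult_left_le)
  qed measurable
  define P where "P = (\<integral>r. indicator {t..T} r *\<^sub>R norm (p r) \<partial>lborel)"
  have Jb: "norm (J \<tau>) \<le> P" if \<tau>: "t \<le> \<tau>" for \<tau>
  proof -
    have "norm (J \<tau>) \<le> (\<integral>r. norm (indicator {\<tau>..T} r *\<^sub>R p r) \<partial>lborel)" unfolding J_def by (rule integral_norm_bound)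
    also have "\<dots> \<le> P"
      unfolding P_def using integrable_norm[OF pt] \<tau>
      by (intro integral_mono') (auto simp: indicator_def)
    finally show ?thesis .
  qed
  have leJ: "integrable lborel (\<lambda>\<tau>. indicator {t..T} \<tau> *\<^sub>R (complex_of_real l * e \<tau> * J \<tau>))"
  proof (rule Bochner_Integration.integrable_bound)
    show "integrable lborel (\<lambda>\<tau>. (l * P) * indicator {t..T} \<tau> :: real)" by (intro integrable_mult_right ind)
    show "AE \<tau> in lborel. norm (indicator {t..T} \<tau> *\<^sub>R (complex_of_real l * e \<tau> * J \<tau>)) \<le> norm ((l * P) * indicator {t..T} \<tau> :: real)"
    proof (rule AE_I2)
      fix \<tau>
      show "norm (indicator {t..T} \<tau> *\<^sub>R (complex_of_real l * e \<tau> * J \<tau>)) \<le> norm ((l * P) * indicator {t..T} \<tau> :: real)"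
      proof (cases "\<tau> \<in> {t..T}")
        case True
        then have "l * norm (e \<tau>) * norm (J \<tau>) \<le> l * 1 * P"
          using e1[of \<tau>] Jb[of \<tau>] l by (intro mult_mono mult_left_mono) auto
        moreover have "0 \<le> P" using Jb[of t] norm_ge_zero[of "J t"] by linarith
        ultimately show ?thesis using l True by (simp add: norm_mult)
      qed simp
    qed
  qed measurable
  have re: "complex_of_real l * e \<tau> = complex_of_real (l * exp (- (l * (\<tau> - t))))" for \<tau> by (simp add: e_def)
  have E1: "(\<integral>\<tau>. indicator {t..r} \<tau> *\<^sub>R (complex_of_real l * e \<tau>) \<partial>lborel) = complex_of_real (1 - exp (- (l * (r - t))))" if "t \<le> r" for r
  proof -
    have "(\<integral>\<tau>. indicator {t..r} \<tau> *\<^sub>R (complex_of_real l * e \<tau>) \<partial>lborel) = complex_of_real (\<integral>\<tau>. indicator {t..r} \<tau> * (l * exp (- (l * (\<tau> - t)))) \<partial>lborel)"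
      unfolding re by (simp add: scaleR_conv_of_real flip: integral_complex_of_real of_real_mult)
    then show ?thesis using exp_integral_Icc[OF that, of l] by simp
  qed
  have third: "(\<integral>\<tau>. indicator {t..T} \<tau> *\<^sub>R (complex_of_real l * e \<tau> * J \<tau>) \<partial>lborel)
     = (\<integral>r. indicator {t..T} r *\<^sub>R p r \<partial>lborel) - (\<integral>r. indicator {t..T} r *\<^sub>R (e r * p r) \<partial>lborel)"
  proof -
    define G where "G = (\<lambda>\<tau> r. (if t \<le> \<tau> \<and> \<tau> \<le> r \<and> r \<le> T then 1 else 0) *\<^sub>R (complex_of_real l * e \<tau> * p r))"
    have [measurable]: "case_prod G \<in> borel_measurable (lborel \<Otimes>\<^sub>M lborel)" unfolding G_def case_prod_beta by measurable
    have Gint: "integrable (lborel \<Otimes>\<^sub>M lborel) (case_prod G)"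
    proof (rule Bochner_Integration.integrable_bound)
      show "integrable (lborel \<Otimes>\<^sub>M lborel) (\<lambda>(\<tau>, r). (indicator {t..T} \<tau> * l) *\<^sub>R (indicator {t..T} r *\<^sub>R p r))"
        by (rule lborel_pair.integrable_scaleR_product[OF _ pt]) (intro integrable_mult_left ind)
      show "AE z in lborel \<Otimes>\<^sub>M lborel. norm (case_prod G z) \<le> norm (case z of (\<tau>, r) \<Rightarrow> (indicator {t..T} \<tau> * l) *\<^sub>R (indicator {t..T} r *\<^sub>R p r))"
      proof (rule AE_I2, clarify)
        fix \<tau> r :: real
        show "norm (G \<tau> r) \<le> norm ((indicator {t..T} \<tau> * l) *\<^sub>R (indicator {t..T} r *\<^sub>R p r))"
        proof (cases "t \<le> \<tau> \<and> \<tau> \<le> r \<and> r \<le> T")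
          case True
          then have "l * (norm (e \<tau>) * norm (p r)) \<le> l * (1 * norm (p r))"
            using e1[of \<tau>] l by (intro mult_left_mono mult_right_mono) auto
          then show ?thesis using True l by (simp add: G_def norm_mult mult.assoc)
        next
          case False
          then have "G \<tau> r = 0" unfolding G_def by (simp only: if_False scaleR_zero_left)
          then show ?thesis by (simp only: norm_zero norm_ge_zero)
        qed
      qed
    qed measurable
    have "(\<integral>\<tau>. indicator {t..T} \<tau> *\<^sub>R (complex_of_real l * e \<tau> * J \<tau>) \<partial>lborel) = (\<integral>\<tau>. (\<integral>r. G \<tau> r \<partial>lborel) \<partial>lborel)"
    proof (rule Bochner_Integration.integral_cong[OF refl])
      fix \<tau> :: real
      have "G \<tau> r = (indicator {t..T} \<tau> *\<^sub>R (complex_of_real l * e \<tau>)) * (indicator {\<tau>..T} r *\<^sub>R p r)" for r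
        by (auto simp: G_def indicator_def)
      then show "indicator {t..T} \<tau> *\<^sub>R (complex_of_real l * e \<tau> * J \<tau>) = (\<integral>r. G \<tau> r \<partial>lborel)"
        by (simp only: J_def integral_mult_right_zero) simp
    qed
    also have "\<dots> = (\<integral>r. (\<integral>\<tau>. G \<tau> r \<partial>lborel) \<partial>lborel)"
      by (rule lborel_pair.Fubini_integral[OF Gint, symmetric])
    also have "\<dots> = (\<integral>r. indicator {t..T} r *\<^sub>R p r - indicator {t..T} r *\<^sub>R (e r * p r) \<partial>lborel)"
    proof (rule Bochner_Integration.integral_cong[OF refl])
      fix r :: real
      have "G \<tau> r = (indicator {t..r} \<tau> *\<^sub>R (complex_of_real l * e \<tau>)) * (indicator {..T} r *\<^sub>R p r)" for \<tau>
        by (auto simp: G_def indicator_def)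
      then have "(\<integral>\<tau>. G \<tau> r \<partial>lborel) = (\<integral>\<tau>. indicator {t..r} \<tau> *\<^sub>R (complex_of_real l * e \<tau>) \<partial>lborel) * (indicator {..T} r *\<^sub>R p r)"
        by (simp only: integral_mult_left_zero)
      also have "\<dots> = indicator {t..T} r *\<^sub>R p r - indicator {t..T} r *\<^sub>R (e r * p r)"
      proof (cases "t \<le> r")
        case True
        then show ?thesis unfolding E1[OF True] by (auto simp: indicator_def e_def left_diff_distrib)
      qed (auto simp: indicator_def)
      finally show "(\<integral>\<tau>. G \<tau> r \<partial>lborel) = indicator {t..T} r *\<^sub>R p r - indicator {t..T} r *\<^sub>R (e r * p r)" .
    qed
    also have "\<dots> = (\<integral>r. indicator {t..T} r *\<^sub>R p r \<partial>lborel) - (\<integral>r. indicator {t..T} r *\<^sub>R (e r * p r) \<partial>lborel)"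
      by (rule Bochner_Integration.integral_diff[OF pt ept])
    finally show ?thesis .
  qed
  have "(\<integral>\<tau>. indicator {t..T} \<tau> *\<^sub>R (e \<tau> * q \<tau>) \<partial>lborel)
     = (\<integral>\<tau>. indicator {t..T} \<tau> *\<^sub>R (e \<tau> * p \<tau>) - (indicator {t..T} \<tau> *\<^sub>R (complex_of_real l * e \<tau>)) * A + indicator {t..T} \<tau> *\<^sub>R (complex_of_real l * e \<tau> * J \<tau>) \<partial>lborel)"
  proof (rule integral_cong_AE)
    show "AE \<tau> in lborel. indicator {t..T} \<tau> *\<^sub>R (e \<tau> * q \<tau>) = indicator {t..T} \<tau> *\<^sub>R (e \<tau> * p \<tau>) - (indicator {t..T} \<tau> *\<^sub>R (complex_of_real l * e \<tau>)) * A + indicator {t..T} \<tau> *\<^sub>R (complex_of_real l * e \<tau> * J \<tau>)"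
      using eq
    proof eventually_elim
      case (elim \<tau>)
      show ?case
      proof (cases "\<tau> \<in> {t..T}")
        case True
        then have q: "q \<tau> = p \<tau> - complex_of_real l * (A - J \<tau>)" using elim t unfolding J_def by simp
        show ?thesis using True unfolding q by (simp add: algebra_simps)
      qed simp
    qed
  qed measurable
  also have "\<dots> = (\<integral>\<tau>. indicator {t..T} \<tau> *\<^sub>R (e \<tau> * p \<tau>) \<partial>lborel) - complex_of_real (1 - exp (- (l * (T - t)))) * A
     + ((\<integral>r. indicator {t..T} r *\<^sub>R p r \<partial>lborel) - (\<integral>r. indicator {t..T} r *\<^sub>R (e r * p r) \<partial>lborel))"
  proof -
    have leA: "integrable lborel (\<lambda>\<tau>. (indicator {t..T} \<tau> *\<^sub>R (complex_of_real l * e \<tau>)) * A)"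
      by (rule integrable_mult_left[OF le])
    have "(\<integral>\<tau>. (indicator {t..T} \<tau> *\<^sub>R (complex_of_real l * e \<tau>)) * A \<partial>lborel) = complex_of_real (1 - exp (- (l * (T - t)))) * A"
      by (simp only: integral_mult_left_zero E1[OF t(2)])
    then show ?thesis
      unfolding Bochner_Integration.integral_add[OF Bochner_Integration.integrable_diff[OF ept leA] leJ]
        Bochner_Integration.integral_diff[OF ept leA] third by simp
  qed
  finally show ?thesis by (simp add: e_def algebra_simps)
qed

section \<open>Hoelder continuous terminal data\<close>

lemma frechet_derivative_partial_deriv:
  fixes g :: "real ^ 'd \<Rightarrow> real"
  assumes "g differentiable (at x)"
  shows "(g has_derivative (\<lambda>h. \<Sum>i\<in>UNIV. partial_deriv i g x * h $ i)) (at x)"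
proof -
  let ?D = "frechet_derivative g (at x)"
  have D: "(g has_derivative ?D) (at x)" using assms frechet_derivative_works by blast
  then interpret bounded_linear ?D by (rule has_derivative_bounded_linear)
  have "?D h = (\<Sum>i\<in>UNIV. partial_deriv i g x * h $ i)" for h
  proof -
    have "?D h = ?D (\<Sum>i\<in>UNIV. h $ i *\<^sub>R axis i 1)" using basis_expansion[of h] by (simp add: scalar_mult_eq_scaleR)
    also have "\<dots> = (\<Sum>i\<in>UNIV. partial_deriv i g x * h $ i)"
      by (simp add: sum scaleR partial_deriv_def mult.commute)
    finally show ?thesis .
  qed
  then have "?D = (\<lambda>h. \<Sum>i\<in>UNIV. partial_deriv i g x * h $ i)" by (rule ext)
  with D show ?thesis by simp
qed

lemma mean_value_partial_deriv:
  fixes g :: "real ^ 'd \<Rightarrow> real"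
  assumes g: "\<And>x. g differentiable (at x)"
  obtains \<theta> where "0 < \<theta>" "\<theta> < 1" "g (x + h) - g x = (\<Sum>i\<in>UNIV. partial_deriv i g (x + \<theta> *\<^sub>R h) * h $ i)"
proof -
  let ?\<phi> = "\<lambda>\<theta>. g (x + \<theta> *\<^sub>R h)"
  have "((\<lambda>y. g (x + y *\<^sub>R h)) has_derivative (\<lambda>d. \<Sum>i\<in>UNIV. partial_deriv i g (x + \<theta> *\<^sub>R h) * (d *\<^sub>R h) $ i)) (at \<theta>)" for \<theta>
    by (rule has_derivative_compose[of "\<lambda>\<theta>. x + \<theta> *\<^sub>R h" _ _ _ g, OF _ frechet_derivative_partial_deriv[OF g]])
       (auto intro!: derivative_eq_intros)
  then have "\<exists>\<theta>\<in>{0<..<1}. ?\<phi> 1 - ?\<phi> 0 = (\<Sum>i\<in>UNIV. partial_deriv i g (x + \<theta> *\<^sub>R h) * ((1 - 0) *\<^sub>R h) $ i)"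
    by (intro mvt_simple) (auto intro: has_derivative_at_withinI)
  then show thesis using that by auto
qed

lemma lipschitz_of_partial_deriv_bound:
  fixes g :: "real ^ 'd \<Rightarrow> real"
  assumes g: "\<And>x. g differentiable (at x)" and N: "\<And>i x. \<bar>partial_deriv i g x\<bar> \<le> N"
  shows "\<bar>g (x + h) - g x\<bar> \<le> real CARD('d) * N * norm h"
proof -
  obtain \<theta> where "g (x + h) - g x = (\<Sum>i\<in>UNIV. partial_deriv i g (x + \<theta> *\<^sub>R h) * h $ i)"
    using mean_value_partial_deriv[OF g] by metis
  also have "\<bar>\<dots>\<bar> \<le> (\<Sum>i\<in>(UNIV :: 'd set). N * norm h)"
    by (rule order_trans[OF sum_abs sum_mono])
       (use N order_trans[OF abs_ge_zero N] in \<open>auto simp: abs_mult intro!: mult_mono component_le_norm_cart\<close>)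
  finally show ?thesis by simp
qed

text \<open>
  Lowers a Hoelder exponent: for \<open>d \<le> 1\<close> the smaller power is larger, and for \<open>d > 1\<close> the trivial
  bound suffices.
\<close>
lemma powr_interpolate:
  fixes D :: real
  assumes "D \<le> 2 * N" "D \<le> L * d powr b" "0 < d" "0 < \<beta>" "\<beta> \<le> b" "0 \<le> N" "N \<le> L"
  shows "D \<le> 2 * L * d powr \<beta>"
proof (cases "d \<le> 1")
  case True
  have "L * d powr b \<le> L * d powr \<beta>" using True assms by (intro mult_left_mono powr_mono') auto
  moreover have "0 \<le> L * d powr \<beta>" using assms by simp
  ultimately show ?thesis using assms by linarith
next
  case False
  have "2 * N * 1 \<le> 2 * L * d powr \<beta>" using False assms by (intro mult_mono) (auto intro: ge_one_powr_ge_zero)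
  then show ?thesis using assms by linarith
qed

lemma taylor_of_holder_gradient:
  fixes g :: "real ^ 'd \<Rightarrow> real"
  assumes g: "\<And>x. g differentiable (at x)" and \<beta>: "0 < \<beta>" and L0: "0 \<le> L"
    and L: "\<And>i x y. \<bar>partial_deriv i g y - partial_deriv i g x\<bar> \<le> L * norm (y - x) powr \<beta>"
  shows "taylor (1 + \<beta>) (real CARD('d) * L) g (\<lambda>x. \<chi> i. partial_deriv i g x)"
  unfolding taylor_def
proof (intro allI)
  fix x h :: "real ^ 'd"
  obtain \<theta> where \<theta>: "0 < \<theta>" "\<theta> < 1" and e: "g (x + h) - g x = (\<Sum>i\<in>UNIV. partial_deriv i g (x + \<theta> *\<^sub>R h) * h $ i)"
    using mean_value_partial_deriv[OF g] by metis
  have "g (x + h) - g x - (\<chi> i. partial_deriv i g x) \<bullet> h = (\<Sum>i\<in>UNIV. (partial_deriv i g (x + \<theta> *\<^sub>R h) - partial_deriv i g x) * h $ i)"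
    unfolding e by (simp add: inner_vec_def left_diff_distrib sum_subtractf)
  also have "\<bar>\<dots>\<bar> \<le> (\<Sum>i\<in>(UNIV :: 'd set). L * norm h powr \<beta> * norm h)"
  proof (rule order_trans[OF sum_abs sum_mono])
    fix i :: 'd
    have "\<bar>partial_deriv i g (x + \<theta> *\<^sub>R h) - partial_deriv i g x\<bar> \<le> L * norm (\<theta> *\<^sub>R h) powr \<beta>"
      using L[of i "x + \<theta> *\<^sub>R h" x] by simp
    also have "\<dots> \<le> L * norm h powr \<beta>"
      using \<theta> \<beta> L0 by (intro mult_left_mono powr_mono2) (auto simp: mult_left_le_one_le)
    finally show "\<bar>(partial_deriv i g (x + \<theta> *\<^sub>R h) - partial_deriv i g x) * h $ i\<bar> \<le> L * norm h powr \<beta> * norm h"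
      unfolding abs_mult by (intro mult_mono component_le_norm_cart) (use L0 in auto)
  qed
  also have "\<dots> = real CARD('d) * L * norm h powr (1 + \<beta>)"
    by (cases "h = 0") (auto simp: powr_add)
  finally show "\<bar>g (x + h) - g x - (\<chi> i. partial_deriv i g x) \<bullet> h\<bar> \<le> real CARD('d) * L * norm h powr (1 + \<beta>)" .
qed

lemma holder_seminormD:
  assumes "holder_seminorm b UNIV g \<le> ennreal N" "0 \<le> N"
  shows "norm (g y - g x) \<le> N * dist y x powr b"
proof (cases "y = x")
  case False
  have "ennreal (norm (g y - g x) / dist y x powr b) \<le> holder_seminorm b UNIV g"
    unfolding holder_seminorm_def by (rule SUP_upper2[of "(y, x)"]) (use False in auto)
  then have "norm (g y - g x) / dist y x powr b \<le> N" using assms by (meson ennreal_le_iff order_trans)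
  then show ?thesis using False by (simp add: field_simps)
qed (use assms in simp)

text \<open>
  For orders at most \<open>2\<close> the first derivatives are Hoelder continuous of order \<open>\<sigma> - 1\<close> by
  definition of the norm; for larger orders they are Lipschitz, since the second derivatives are
  bounded. In both cases the exponent can be lowered to \<open>\<beta>\<close>.
\<close>
lemma in_holder_taylor:
  fixes g :: "real ^ 'd \<Rightarrow> real"
  assumes g: "in_holder \<sigma> g" and \<sigma>: "1 < \<sigma>" and \<beta>: "0 < \<beta>" "\<beta> < 1" "\<beta> \<le> \<sigma> - 1"
  defines "N \<equiv> enn2real (holder_norm \<sigma> g)"
  shows "\<And>x. \<bar>g x\<bar> \<le> N" "taylor (1 + \<beta>) (2 * (real CARD('d))\<^sup>2 * N) g (\<lambda>x. \<chi> i. partial_deriv i g x)"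
proof -
  define k where "k = holder_order \<sigma>"
  have k: "1 \<le> k" "real k < \<sigma>" "\<sigma> \<le> real k + 1" using \<sigma> unfolding k_def holder_order_def by linarith+
  have N: "holder_norm \<sigma> g = ennreal N" "0 \<le> N"
    using g by (auto simp: in_holder_def N_def)
  have hn: "Ck_holder_norm k (\<sigma> - real k) g = ennreal N" using N by (simp add: holder_norm_def k_def)
  have bd: "\<bar>iter_partial js g x\<bar> \<le> N" if "length js \<le> k" for js x
  proof -
    have "ennreal \<bar>iter_partial js g x\<bar> \<le> (SUP x. ennreal \<bar>iter_partial js g x\<bar>)" by (rule SUP_upper) simp
    also have "\<dots> \<le> (SUP js \<in> {js. length js \<le> k}. SUP x. ennreal \<bar>iter_partial js g x\<bar>)"
      by (rule SUP_upper) (use that in simp)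
    also have "\<dots> \<le> ennreal N" unfolding hn[symmetric] Ck_holder_norm_def by simp
    finally show ?thesis using N by simp
  qed
  have sn: "holder_seminorm (\<sigma> - real k) UNIV (iter_partial js g) \<le> ennreal N" if "length js = k" for js
  proof -
    have "holder_seminorm (\<sigma> - real k) UNIV (iter_partial js g) \<le> (SUP js \<in> {js. length js = k}. holder_seminorm (\<sigma> - real k) UNIV (iter_partial js g))"
      by (rule SUP_upper) (use that in simp)
    also have "\<dots> \<le> ennreal N" unfolding hn[symmetric] Ck_holder_norm_def by simp
    finally show ?thesis .
  qed
  show "\<bar>g x\<bar> \<le> N" for x using bd[of "[]" x] by simp
  obtain k' where k': "k = Suc k'" using k by (cases k) auto
  have Ck: "is_Ck (Suc k') g" using g by (simp add: in_holder_def k_def k'[symmetric])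
  then have diff: "\<And>x. g differentiable (at x)" by simp
  have p: "\<bar>partial_deriv i g x\<bar> \<le> N" for i x using bd[of "[i]" x] k by simp
  have CARD: "1 \<le> real CARD('d)" using zero_less_card_finite[where 'a = 'd] by linarith
  then have NL: "N \<le> real CARD('d) * N" using N mult_right_mono[of 1 "real CARD('d)" N] by simp
  have "\<bar>partial_deriv i g y - partial_deriv i g x\<bar> \<le> 2 * (real CARD('d) * N) * norm (y - x) powr \<beta>" for i x y
  proof (cases "y = x")
    case False
    let ?D = "\<bar>partial_deriv i g y - partial_deriv i g x\<bar>"
    have D2: "?D \<le> 2 * N" using p[of i x] p[of i y] by linarith
    show ?thesis
    proof (cases "k = 1")
      case True
      have "?D \<le> N * dist y x powr (\<sigma> - 1)"
        using holder_seminormD[OF sn[of "[i]"] N(2), of y x] True by simp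
      also have "\<dots> \<le> real CARD('d) * N * dist y x powr (\<sigma> - 1)" using NL by (intro mult_right_mono) auto
      finally show ?thesis
        using False \<beta> N NL D2 by (intro powr_interpolate[of _ N _ _ "\<sigma> - 1"]) (auto simp: dist_norm)
    next
      case False': False
      then obtain k'' where k'': "k' = Suc k''" using k k' by (cases k') auto
      then have d2: "\<And>x. partial_deriv i g differentiable (at x)" using Ck by simp
      have "\<bar>partial_deriv j (partial_deriv i g) x\<bar> \<le> N" for j x using bd[of "[i, j]" x] k' k'' by simp
      from lipschitz_of_partial_deriv_bound[OF d2 this, of x "y - x"]
      have "?D \<le> real CARD('d) * N * norm (y - x) powr 1" by simp
      then show ?thesis
        using False \<beta> N NL D2 by (intro powr_interpolate[of _ N _ _ 1]) auto
    qed
  qed simp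
  from taylor_of_holder_gradient[OF diff \<beta>(1) _ this]
  show "taylor (1 + \<beta>) (2 * (real CARD('d))\<^sup>2 * N) g (\<lambda>x. \<chi> i. partial_deriv i g x)"
    using N by (simp add: power2_eq_square mult_ac)
qed

section \<open>Borel representatives\<close>

text \<open>
  The exceptional set need not be measurable in either order of the slices, so it is first enclosed
  in a Borel null set.
\<close>
lemma AE_lborel_slices:
  fixes P :: "'a::euclidean_space \<times> 'b::euclidean_space \<Rightarrow> bool"
  assumes "AE p in lborel. P p"
  shows "AE x in lborel. AE y in lborel. P (x, y)" "AE y in lborel. AE x in lborel. P (x, y)"
proof -
  obtain N where N: "{p. \<not> P p} \<subseteq> N" "N \<in> null_sets lborel"
    using assms by (auto elim!: AE_E simp: null_sets_def)
  then have [measurable]: "N \<in> sets (lborel \<Otimes>\<^sub>M lborel)" by (simp only: lborel_prod null_setsD2)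
  have "AE p in lborel \<Otimes>\<^sub>M lborel. p \<notin> N" unfolding lborel_prod by (rule AE_not_in[OF N(2)])
  then have 1: "AE x in lborel. AE y in lborel. (x, y) \<notin> N" by (rule lborel_pair.AE_pair)
  then have 2: "AE y in lborel. AE x in lborel. (x, y) \<notin> N"
  proof (rule lborel_pair.AE_commute[THEN iffD1, rotated])
    show "{p \<in> space (lborel \<Otimes>\<^sub>M lborel). (fst p, snd p) \<notin> N} \<in> sets (lborel \<Otimes>\<^sub>M lborel)"
      unfolding prod.collapse by measurable
  qed
  show "AE x in lborel. AE y in lborel. P (x, y)"
    using 1 by (rule eventually_mono) (erule eventually_mono, use N in auto)
  show "AE y in lborel. AE x in lborel. P (x, y)"
    using 2 by (rule eventually_mono) (erule eventually_mono, use N in auto)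
qed

lemma AE_lborel_prodI:
  fixes P :: "'a::euclidean_space \<times> 'b::euclidean_space \<Rightarrow> bool"
  assumes "Measurable.pred (borel \<Otimes>\<^sub>M borel) P" "AE y in lborel. AE x in lborel. P (x, y)"
  shows "AE p in lborel. P p"
proof -
  have [measurable]: "Measurable.pred (lborel \<Otimes>\<^sub>M lborel) P"
    using assms(1) by (simp only: lborel_prod borel_prod) simp
  have m: "{p \<in> space (lborel \<Otimes>\<^sub>M lborel). P (fst p, snd p)} \<in> sets (lborel \<Otimes>\<^sub>M lborel)"
    unfolding prod.collapse by measurable
  have "AE x in lborel. AE y in lborel. P (x, y)"
    using lborel_pair.AE_commute[OF m] assms(2) by blast
  then have "AE p in lborel \<Otimes>\<^sub>M lborel. P p" by (rule lborel_pair.AE_pair_measure[OF m[unfolded prod.collapse]])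
  then show ?thesis by (simp only: lborel_prod)
qed

lemma AE_lborel_fst:
  assumes "AE x in (lborel :: 'a::euclidean_space measure). R x"
  shows "AE p in (lborel :: ('a \<times> 'b::euclidean_space) measure). R (fst p)"
proof -
  obtain N where N: "{x. \<not> R x} \<subseteq> N" "N \<in> null_sets lborel"
    using assms by (auto elim!: AE_E simp: null_sets_def)
  then have [measurable]: "N \<in> sets borel" by (simp add: null_sets_def)
  have "AE y in (lborel :: 'b measure). AE x in lborel. fst (x, y) \<notin> N" using AE_not_in[OF N(2)] by simp
  then have "AE p in (lborel :: ('a \<times> 'b) measure). fst p \<notin> N" by (intro AE_lborel_prodI) auto
  then show ?thesis by (rule eventually_mono) (use N in auto)
qed

lemma AE_lebesgue_on_iff:
  fixes S :: "'a::euclidean_space set"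
  assumes "S \<in> sets borel"
  shows "(AE x in lebesgue_on S. P x) \<longleftrightarrow> (AE x in lborel. x \<in> S \<longrightarrow> P x)"
  using assms by (subst AE_restrict_space_iff) (auto simp: AE_completion_iff)

lemma lebesgue_on_borel_rep:
  fixes g :: "'a::euclidean_space \<Rightarrow> real"
  assumes S: "S \<in> sets borel" and g: "g \<in> borel_measurable (lebesgue_on S)"
  obtains g' where "g' \<in> borel_measurable borel" "AE x in lborel. x \<in> S \<longrightarrow> g x = g' x"
proof -
  have "(\<lambda>x. if x \<in> S then g x else 0) \<in> borel_measurable (completion lborel)"
    using S g by (subst borel_measurable_if) auto
  from completion_ex_borel_measurable_real[OF this]
  obtain g' where "g' \<in> borel_measurable borel" "AE x in lborel. (if x \<in> S then g x else 0) = g' x" by auto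
  then show thesis by (intro that[of g']) (auto elim: eventually_mono)
qed

text \<open>
  Lebesgue measurability of \<open>g\<close> comes for free from completeness, so that integrals over the
  completed measure can be replaced by Borel integrals of a representative.
\<close>
lemma lebesgue_on_integral_rep:
  fixes g g' :: "'a::euclidean_space \<Rightarrow> 'b::euclidean_space"
  assumes S: "S \<in> sets borel" and g' [measurable]: "g' \<in> borel_measurable borel" and AE: "AE x in lborel. x \<in> S \<longrightarrow> g x = g' x"
  shows "(LINT x|lebesgue_on S. g x) = (\<integral>x. indicator S x *\<^sub>R g' x \<partial>lborel)"
    and "integrable (lebesgue_on S) g \<longleftrightarrow> integrable lborel (\<lambda>x. indicator S x *\<^sub>R g' x)"
proof -
  have m': "(\<lambda>x. indicator S x *\<^sub>R g' x) \<in> borel_measurable lborel" using S by measurable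
  then have m: "(\<lambda>x. indicator S x *\<^sub>R g' x) \<in> borel_measurable lebesgue" by (rule measurable_completion)
  have AE': "AE x in lebesgue. indicator S x *\<^sub>R g' x = indicator S x *\<^sub>R g x"
    unfolding AE_completion_iff using AE by (rule eventually_mono) (auto simp: indicator_def)
  have n: "(\<lambda>x. indicator S x *\<^sub>R g x) \<in> borel_measurable lebesgue" by (rule borel_measurable_AE[OF m AE'])
  have SL: "S \<inter> space lebesgue \<in> sets lebesgue" using S by simp
  have "(LINT x|lebesgue_on S. g x) = (\<integral>x. indicator S x *\<^sub>R g x \<partial>lebesgue)"
    by (rule integral_restrict_space[OF SL])
  also have "\<dots> = (\<integral>x. indicator S x *\<^sub>R g' x \<partial>lebesgue)"
    by (rule integral_cong_AE[OF n m]) (use AE' in \<open>auto elim: eventually_mono\<close>)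
  also have "\<dots> = (\<integral>x. indicator S x *\<^sub>R g' x \<partial>lborel)" by (rule integral_completion[OF m'])
  finally show "(LINT x|lebesgue_on S. g x) = (\<integral>x. indicator S x *\<^sub>R g' x \<partial>lborel)" .
  have "integrable (lebesgue_on S) g \<longleftrightarrow> integrable lebesgue (\<lambda>x. indicator S x *\<^sub>R g x)"
    by (rule integrable_restrict_space[OF SL])
  also have "\<dots> \<longleftrightarrow> integrable lebesgue (\<lambda>x. indicator S x *\<^sub>R g' x)"
    by (rule integrable_cong_AE[OF n m]) (use AE' in \<open>auto elim: eventually_mono\<close>)
  also have "\<dots> \<longleftrightarrow> integrable lborel (\<lambda>x. indicator S x *\<^sub>R g' x)" by (rule integrable_completion[OF m'])
  finally show "integrable (lebesgue_on S) g \<longleftrightarrow> integrable lborel (\<lambda>x. indicator S x *\<^sub>R g' x)" .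
qed

lemma AE_torus_iff: "(AE x in torus_measure. P x) \<longleftrightarrow> (AE x in cell_measure. P x)"
proof -
  have "(AE x in torus_measure. P x) \<longleftrightarrow> (AE x in lborel. x \<in> cbox 0 (\<chi> i. 1) \<longrightarrow> P x)"
    unfolding torus_measure_def by (rule AE_lebesgue_on_iff) simp
  also have "\<dots> \<longleftrightarrow> (AE x in lborel. x \<in> unit_cell \<longrightarrow> P x)"
  proof
    assume "AE x in lborel. x \<in> cbox 0 (\<chi> i. 1) \<longrightarrow> P x"
    with AE_cbox_unit_cell show "AE x in lborel. x \<in> unit_cell \<longrightarrow> P x" by eventually_elim auto
  next
    assume "AE x in lborel. x \<in> unit_cell \<longrightarrow> P x"
    with AE_cbox_unit_cell show "AE x in lborel. x \<in> cbox 0 (\<chi> i. 1) \<longrightarrow> P x" by eventually_elim auto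
  qed
  finally show ?thesis by (simp add: AE_cell_measure)
qed

lemma integral_cell:
  fixes g :: "real ^ 'd \<Rightarrow> 'b::{banach, second_countable_topology}"
  assumes "g \<in> borel_measurable borel"
  shows "(\<integral>x. g x \<partial>cell_measure) = (\<integral>x. indicator unit_cell x *\<^sub>R g x \<partial>lborel)"
    and "integrable cell_measure g \<longleftrightarrow> integrable lborel (\<lambda>x. indicator unit_cell x *\<^sub>R g x)"
proof -
  have eq: "cell_measure = density lborel (\<lambda>x::real^'d. ennreal (indicator unit_cell x))"
    unfolding cell_measure_def by (simp add: ennreal_indicator)
  show "(\<integral>x. g x \<partial>cell_measure) = (\<integral>x. indicator unit_cell x *\<^sub>R g x \<partial>lborel)"
    unfolding eq using assms by (subst integral_density) auto
  show "integrable cell_measure g \<longleftrightarrow> integrable lborel (\<lambda>x. indicator unit_cell x *\<^sub>R g x)"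
    unfolding eq using assms by (subst integrable_density) auto
qed

lemma torus_integral_rep:
  fixes g g' :: "real ^ 'd \<Rightarrow> 'b::euclidean_space"
  assumes g' [measurable]: "g' \<in> borel_measurable borel" and AE: "AE x in cell_measure. g x = g' x"
  shows "(LINT x|torus_measure. g x) = (\<integral>x. g' x \<partial>cell_measure)"
    and "integrable torus_measure g \<longleftrightarrow> integrable cell_measure g'"
proof -
  have "AE x in torus_measure. g x = g' x" using AE by (simp add: AE_torus_iff)
  then have AE': "AE x in lborel. x \<in> cbox 0 (\<chi> i. 1) \<longrightarrow> g x = g' x"
    unfolding torus_measure_def by (subst (asm) AE_lebesgue_on_iff) auto
  have ind: "AE x in lborel. indicator (cbox 0 (\<chi> i. 1)) x *\<^sub>R g' x = indicator unit_cell x *\<^sub>R g' x"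
    using AE_cbox_unit_cell by (rule eventually_mono) (auto simp: indicator_def)
  have "(LINT x|torus_measure. g x) = (\<integral>x. indicator (cbox 0 (\<chi> i. 1)) x *\<^sub>R g' x \<partial>lborel)"
    unfolding torus_measure_def by (rule lebesgue_on_integral_rep[OF _ g' AE']) simp
  also have "\<dots> = (\<integral>x. indicator unit_cell x *\<^sub>R g' x \<partial>lborel)" by (rule integral_cong_AE[OF _ _ ind]) simp_all
  finally show "(LINT x|torus_measure. g x) = (\<integral>x. g' x \<partial>cell_measure)" by (simp add: integral_cell)
  have "integrable torus_measure g \<longleftrightarrow> integrable lborel (\<lambda>x. indicator (cbox 0 (\<chi> i. 1)) x *\<^sub>R g' x)"
    unfolding torus_measure_def by (rule lebesgue_on_integral_rep[OF _ g' AE']) simp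
  also have "\<dots> \<longleftrightarrow> integrable lborel (\<lambda>x. indicator unit_cell x *\<^sub>R g' x)" by (rule integrable_cong_AE[OF _ _ ind]) simp_all
  finally show "integrable torus_measure g \<longleftrightarrow> integrable cell_measure g'" by (simp add: integral_cell)
qed

lemma fourier_coeff_rep:
  fixes g g' :: "real ^ 'd \<Rightarrow> real"
  assumes [measurable]: "g' \<in> borel_measurable borel" and AE: "AE x in cell_measure. g x = g' x"
  shows "fourier_coeff g k = fcoef g' k"
  unfolding fourier_coeff_def fcoef_def character_def[symmetric]
  by (rule torus_integral_rep) (use AE in \<open>auto elim: eventually_mono\<close>)

lemma torus_integrable_rep:
  fixes g :: "real ^ 'd \<Rightarrow> real"
  assumes "integrable torus_measure g"
  obtains g' where "g' \<in> borel_measurable borel" "AE x in cell_measure. g x = g' x" "integrable cell_measure g'"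
proof -
  have "g \<in> borel_measurable (lebesgue_on (cbox 0 (\<chi> i. 1)))"
    using borel_measurable_integrable[OF assms] by (simp add: torus_measure_def)
  then obtain g' where g': "g' \<in> borel_measurable borel" "AE x in lborel. x \<in> cbox 0 (\<chi> i. 1) \<longrightarrow> g x = g' x"
    by (rule lebesgue_on_borel_rep[rotated]) auto
  have "AE x in torus_measure. g x = g' x"
    unfolding torus_measure_def using g'(2) by (subst AE_lebesgue_on_iff) auto
  then have AE: "AE x in cell_measure. g x = g' x" by (simp add: AE_torus_iff)
  show thesis using that[OF g'(1) AE] torus_integral_rep(2)[OF g'(1) AE] assms by simp
qed

abbreviation in_cylinder :: "real \<Rightarrow> (real ^ 'd) \<times> real \<Rightarrow> bool" where
  "in_cylinder T p \<equiv> fst p \<in> unit_cell \<and> 0 \<le> snd p \<and> snd p \<le> T"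

lemma AE_cylinder_iff:
  fixes P :: "(real ^ 'd) \<times> real \<Rightarrow> bool"
  shows "(AE p in cylinder_measure T. P p) \<longleftrightarrow> (AE p in lborel. in_cylinder T p \<longrightarrow> P p)"
proof -
  have c: "AE p in (lborel :: ((real ^ 'd) \<times> real) measure). fst p \<in> cbox 0 (\<chi> i. 1) \<longleftrightarrow> fst p \<in> unit_cell"
    by (rule AE_lborel_fst[OF AE_cbox_unit_cell])
  have "(AE p in cylinder_measure T. P p) \<longleftrightarrow> (AE p in lborel. p \<in> cbox 0 (\<chi> i. 1) \<times> {0..T} \<longrightarrow> P p)"
    unfolding cylinder_measure_def by (rule AE_lebesgue_on_iff) (auto intro!: borel_closed closed_Times)
  also have "\<dots> \<longleftrightarrow> (AE p in lborel. in_cylinder T p \<longrightarrow> P p)"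
  proof
    assume "AE p in lborel. p \<in> cbox 0 (\<chi> i. 1) \<times> {0..T} \<longrightarrow> P p"
    with c show "AE p in lborel. in_cylinder T p \<longrightarrow> P p"
      by eventually_elim (auto simp: mem_Times_iff)
  next
    assume "AE p in lborel. in_cylinder T p \<longrightarrow> P p"
    with c show "AE p in lborel. p \<in> cbox 0 (\<chi> i. 1) \<times> {0..T} \<longrightarrow> P p"
      by eventually_elim (auto simp: mem_Times_iff)
  qed
  finally show ?thesis .
qed

lemma cylinder_borel_rep:
  fixes g :: "real ^ 'd \<Rightarrow> real \<Rightarrow> real"
  assumes "(\<lambda>(x, t). g x t) \<in> borel_measurable (cylinder_measure T)"
  obtains G where "case_prod G \<in> borel_measurable (borel \<Otimes>\<^sub>M borel)"
    "AE p in lborel. in_cylinder T p \<longrightarrow> g (fst p) (snd p) = G (fst p) (snd p)"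
    "integrable (cylinder_measure T) (\<lambda>(x, t). g x t) \<Longrightarrow>
      integrable lborel (\<lambda>p. (indicator unit_cell (fst p) * indicator {0..T} (snd p)) *\<^sub>R G (fst p) (snd p))"
proof -
  let ?S = "cbox 0 ((\<chi> i. 1) :: real ^ 'd) \<times> {0..T}"
  have S: "?S \<in> sets borel" by (auto intro!: borel_closed closed_Times)
  obtain G' where G': "G' \<in> borel_measurable borel" "AE p in lborel. p \<in> ?S \<longrightarrow> (case p of (x, t) \<Rightarrow> g x t) = G' p"
    using lebesgue_on_borel_rep[OF S assms[unfolded cylinder_measure_def]] by blast
  define G where "G = (\<lambda>x t. G' (x, t))"
  have "case_prod G = G'" by (rule ext) (simp add: G_def split: prod.split)
  then have m: "case_prod G \<in> borel_measurable (borel \<Otimes>\<^sub>M borel)" using G'(1) by (simp only: borel_prod)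
  have "AE p in cylinder_measure T. g (fst p) (snd p) = G (fst p) (snd p)"
    unfolding cylinder_measure_def AE_lebesgue_on_iff[OF S] using G'(2)
    by (rule eventually_mono) (auto simp: G_def)
  then have AE: "AE p in lborel. in_cylinder T p \<longrightarrow> g (fst p) (snd p) = G (fst p) (snd p)"
    by (simp add: AE_cylinder_iff)
  show thesis
  proof (rule that[OF m AE])
    assume "integrable (cylinder_measure T) (\<lambda>(x, t). g x t)"
    then have I: "integrable lborel (\<lambda>p. indicator ?S p *\<^sub>R G' p)"
      using lebesgue_on_integral_rep(2)[OF S G'] by (simp add: cylinder_measure_def)
    have c: "AE p in (lborel :: ((real ^ 'd) \<times> real) measure). fst p \<in> cbox 0 (\<chi> i. 1) \<longleftrightarrow> fst p \<in> unit_cell"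
      by (rule AE_lborel_fst[OF AE_cbox_unit_cell])
    show "integrable lborel (\<lambda>p. (indicator unit_cell (fst p) * indicator {0..T} (snd p)) *\<^sub>R G (fst p) (snd p))"
    proof (rule integrable_cong_AE_imp[OF I])
      show "(\<lambda>p. (indicator unit_cell (fst p) * indicator {0..T} (snd p)) *\<^sub>R G (fst p) (snd p)) \<in> borel_measurable lborel"
        using m unfolding lborel_prod[symmetric] by measurable
      show "AE p in lborel. indicator ?S p *\<^sub>R G' p = (indicator unit_cell (fst p) * indicator {0..T} (snd p)) *\<^sub>R G (fst p) (snd p)"
        using c by eventually_elim (auto simp: indicator_def mem_Times_iff G_def)
    qed
  qed
qed

section \<open>Identification of the solution\<close>

context duhamel
begin

lemma mild_joint_meas: "(\<lambda>(x, t). mild t x) \<in> borel_measurable (borel \<Otimes>\<^sub>M borel)"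
proof -
  have "src t L x = (\<integral>\<tau>. (if 0 \<le> \<tau> \<and> \<tau> \<le> L then 1 else 0) * heat (\<kappa> \<tau>) (\<lambda>y. f y (t + \<tau>)) x \<partial>lborel)" for t L x
  proof -
    have "(\<lambda>\<tau>. heat (\<kappa> \<tau>) (\<lambda>y. f y (t + \<tau>)) x) \<in> borel_measurable borel" by measurable
    then show ?thesis unfolding src_def by (subst integral_ivl) (auto simp: indicator_def intro!: Bochner_Integration.integral_cong)
  qed
  then have "(\<lambda>(x, t). mild t x) = (\<lambda>p. (\<integral>\<omega>. uT (fst p - \<kappa> (T - snd p) *\<^sub>R Y \<omega>) \<partial>N) -
    (\<integral>\<tau>. (if 0 \<le> \<tau> \<and> \<tau> \<le> T - snd p then 1 else 0) * (\<integral>\<omega>. f (fst p - \<kappa> \<tau> *\<^sub>R Y \<omega>) (snd p + \<tau>) \<partial>N) \<partial>lborel))"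
    by (auto simp: mild_def heat_def)
  also have "\<dots> \<in> borel_measurable (borel \<Otimes>\<^sub>M borel)" by measurable
  finally show ?thesis .
qed

text \<open>
  Let \<open>c(x,t) = u\<^sub>T(x) - \<integral> V(x,\<tau>) d\<tau>\<close> with a Borel representative \<open>V\<close> of the weak time derivative
  that is cut off outside the cylinder. Then \<open>u = c\<close> almost everywhere, and by Fubini's theorem the
  Fourier coefficients of \<open>c\<close> are primitives of those of \<open>V\<close>. The equation makes them solutions of a
  scalar linear integral equation, which identifies them with those of the mild solution at every
  time.
\<close>
lemma solution_eq_mild:
  assumes sol: "is_solution s T f0 uT u"
    and f0: "AE p in lborel. in_cylinder T p \<longrightarrow> f0 (fst p) (snd p) = f (fst p) (snd p)"
  shows "AE p in lborel. in_cylinder T p \<longrightarrow> mild (snd p) (fst p) = u (fst p) (snd p)"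
proof -
  obtain v where v_int: "integrable (cylinder_measure T) (\<lambda>(x, t). v x t)"
    and v_eq: "AE (x, t) in cylinder_measure T. u x t = uT x - (LINT \<tau>|lebesgue_on {t..T}. v x \<tau>)"
    and v_pde: "AE t in lebesgue_on {0..T}. \<exists>g. is_frac_laplacian s (\<lambda>x. u x t) g \<and> (AE x in torus_measure. - v x t + g x + f0 x t = 0)"
    using sol unfolding is_solution_def by blast
  obtain G where G [measurable]: "case_prod G \<in> borel_measurable (borel \<Otimes>\<^sub>M borel)"
    and G_eq: "AE p in lborel. in_cylinder T p \<longrightarrow> v (fst p) (snd p) = G (fst p) (snd p)"
    and G_int: "integrable lborel (\<lambda>p. (indicator unit_cell (fst p) * indicator {0..T} (snd p)) *\<^sub>R G (fst p) (snd p))"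
  proof (rule cylinder_borel_rep[OF borel_measurable_integrable[OF v_int]], goal_cases)
    case (1 H)
    show ?case by (rule 1(1)[OF 1(2,3) 1(4)[OF v_int]])
  qed
  \<comment> \<open>The cut-off makes \<open>V\<close> integrable over the whole space and replaces integrals over the cylinder.\<close>
  define V where "V = (\<lambda>x t. (indicator unit_cell x * indicator {0..T} t) * G x t)"
  have V [measurable]: "case_prod V \<in> borel_measurable (borel \<Otimes>\<^sub>M borel)" unfolding V_def by measurable
  have V_int: "integrable (lborel \<Otimes>\<^sub>M lborel) (case_prod V)"
    unfolding lborel_prod case_prod_beta' using G_int by (simp add: V_def)
  have V_eq: "AE p in lborel. in_cylinder T p \<longrightarrow> v (fst p) (snd p) = V (fst p) (snd p)"
    using G_eq by (rule eventually_mono) (simp add: V_def)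
  have V_out: "V x t = 0" if "x \<notin> unit_cell \<or> t < 0 \<or> T < t" for x t
    using that by (auto simp: V_def indicator_def)
  define I where "I = (\<lambda>x t. \<integral>\<tau>. indicator {t..T} \<tau> * V x \<tau> \<partial>lborel)"
  define c where "c = (\<lambda>t x. uT x - I x t)"
  have I_if: "I x t = (\<integral>\<tau>. (if t \<le> \<tau> \<and> \<tau> \<le> T then 1 else 0) * V x \<tau> \<partial>lborel)" for x t
    unfolding I_def by (intro Bochner_Integration.integral_cong) (auto simp: indicator_def)
  have I_meas [measurable]: "(\<lambda>(x, t). I x t) \<in> borel_measurable (borel \<Otimes>\<^sub>M borel)"
    unfolding I_if by measurable
  have c_meas: "(\<lambda>(x, t). c t x) \<in> borel_measurable (borel \<Otimes>\<^sub>M borel)" unfolding c_def by measurable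
  have ct_meas [measurable]: "c t \<in> borel_measurable borel" for t unfolding c_def by measurable

  have u_c: "AE p in lborel. in_cylinder T p \<longrightarrow> u (fst p) (snd p) = c (snd p) (fst p)"
  proof -
    have "AE x in lborel. AE \<tau> in lborel. x \<in> unit_cell \<and> 0 \<le> \<tau> \<and> \<tau> \<le> T \<longrightarrow> v x \<tau> = V x \<tau>"
      using AE_lborel_slices(1)[OF V_eq] by simp
    from AE_lborel_fst[OF this]
    have 1: "AE p in (lborel :: ((real ^ 'd) \<times> real) measure). AE \<tau> in lborel. fst p \<in> unit_cell \<and> 0 \<le> \<tau> \<and> \<tau> \<le> T \<longrightarrow> v (fst p) \<tau> = V (fst p) \<tau>" .
    have 2: "AE p in lborel. in_cylinder T p \<longrightarrow> u (fst p) (snd p) = uT (fst p) - (LINT \<tau>|lebesgue_on {snd p..T}. v (fst p) \<tau>)"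
      using v_eq unfolding AE_cylinder_iff by (rule eventually_mono) auto
    from 1 2 show ?thesis
    proof eventually_elim
      case (elim p)
      show ?case
      proof (intro impI, elim conjE)
        assume p: "fst p \<in> unit_cell" "0 \<le> snd p" "snd p \<le> T"
        have "AE \<tau> in lborel. \<tau> \<in> {snd p..T} \<longrightarrow> v (fst p) \<tau> = V (fst p) \<tau>"
          using elim(1) by (rule eventually_mono) (use p in auto)
        then have "(LINT \<tau>|lebesgue_on {snd p..T}. v (fst p) \<tau>) = I (fst p) (snd p)"
          using lebesgue_on_integral_rep(1)[of "{snd p..T}" "V (fst p)" "v (fst p)"] by (simp add: I_def)
        then show "u (fst p) (snd p) = c (snd p) (fst p)" using elim(2) p by (simp add: c_def)
      qed
    qed
  qed

  define pk where "pk = (\<lambda>k \<tau>. \<integral>x. complex_of_real (V x \<tau>) * character k x \<partial>lborel)"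
  have Vc_int: "integrable (lborel \<Otimes>\<^sub>M lborel) (\<lambda>(x, \<tau>). complex_of_real (V x \<tau>) * character k x)" for k
    by (rule Bochner_Integration.integrable_bound[OF V_int]) (auto simp: norm_mult case_prod_beta)
  have pk_meas [measurable]: "pk k \<in> borel_measurable borel" for k unfolding pk_def by measurable
  have pk_int: "integrable lborel (pk k)" for k
    using lborel_pair.integrable_snd[OF Vc_int[of k]] by (simp add: pk_def)
  have pk_fcoef: "pk k t = fcoef (\<lambda>x. V x t) k" for k t
    unfolding fcoef_def pk_def by (subst integral_cell) (auto intro!: Bochner_Integration.integral_cong simp: indicator_def V_out)

  have fcoef_c: "integrable cell_measure (c t)" "fcoef (c t) k = fcoef uT k - (\<integral>\<tau>. indicator {t..T} \<tau> *\<^sub>R pk k \<tau> \<partial>lborel)"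
    for t k
  proof -
    have Jint: "integrable (lborel \<Otimes>\<^sub>M lborel) (\<lambda>(x, \<tau>). indicator {t..T} \<tau> * V x \<tau>)"
      by (rule Bochner_Integration.integrable_bound[OF V_int]) (auto simp: indicator_def case_prod_beta)
    have JCint: "integrable (lborel \<Otimes>\<^sub>M lborel) (\<lambda>(x, \<tau>). indicator {t..T} \<tau> *\<^sub>R (complex_of_real (V x \<tau>) * character k x))"
      by (rule Bochner_Integration.integrable_bound[OF Vc_int[of k]]) (auto simp: indicator_def case_prod_beta norm_mult)
    have I_out: "x \<notin> unit_cell \<Longrightarrow> I x t = 0" for x by (simp add: I_def V_out)
    have "integrable lborel (\<lambda>x. I x t)" using lborel_pair.integrable_fst[OF Jint] by (simp add: I_def)
    also have "(\<lambda>x. I x t) = (\<lambda>x. indicator unit_cell x *\<^sub>R I x t)"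
    proof (rule ext)
      show "I x t = indicator unit_cell x *\<^sub>R I x t" for x by (cases "x \<in> unit_cell") (simp_all add: I_out)
    qed
    finally have Icell: "integrable cell_measure (\<lambda>x. I x t)" by (subst integral_cell) auto
    have uTcell: "integrable cell_measure uT"
      using uT_bound by (intro cell.integrable_const_bound[where B = B]) auto
    show "integrable cell_measure (c t)" unfolding c_def using Icell uTcell by simp
    have cI: "integrable cell_measure (\<lambda>x. complex_of_real (I x t) * character k x)"
      using Icell by (intro integrable_mult_character) (simp add: complex_of_real_integrable_eq)
    have "fcoef (\<lambda>x. I x t) k = (\<integral>x. complex_of_real (I x t) * character k x \<partial>lborel)"
      unfolding fcoef_def by (subst integral_cell) (auto intro!: Bochner_Integration.integral_cong simp: indicator_def I_out)
    also have "\<dots> = (\<integral>x. (\<integral>\<tau>. indicator {t..T} \<tau> *\<^sub>R (complex_of_real (V x \<tau>) * character k x) \<partial>lborel) \<partial>lborel)"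
    proof (rule Bochner_Integration.integral_cong[OF refl])
      fix x :: "real ^ 'd"
      have "complex_of_real (I x t) * character k x = (\<integral>\<tau>. complex_of_real (indicator {t..T} \<tau> * V x \<tau>) \<partial>lborel) * character k x"
        unfolding I_def by (simp only: integral_complex_of_real)
      also have "\<dots> = (\<integral>\<tau>. complex_of_real (indicator {t..T} \<tau> * V x \<tau>) * character k x \<partial>lborel)"
        by (simp only: integral_mult_left_zero)
      also have "\<dots> = (\<integral>\<tau>. indicator {t..T} \<tau> *\<^sub>R (complex_of_real (V x \<tau>) * character k x) \<partial>lborel)"
        by (simp add: scaleR_conv_of_real mult.assoc)
      finally show "complex_of_real (I x t) * character k x = (\<integral>\<tau>. indicator {t..T} \<tau> *\<^sub>R (complex_of_real (V x \<tau>) * character k x) \<partial>lborel)" .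
    qed
    also have "\<dots> = (\<integral>\<tau>. (\<integral>x. indicator {t..T} \<tau> *\<^sub>R (complex_of_real (V x \<tau>) * character k x) \<partial>lborel) \<partial>lborel)"
      by (rule lborel_pair.Fubini_integral[OF JCint, symmetric])
    also have "\<dots> = (\<integral>\<tau>. indicator {t..T} \<tau> *\<^sub>R pk k \<tau> \<partial>lborel)" by (simp add: pk_def)
    finally have "fcoef (\<lambda>x. I x t) k = (\<integral>\<tau>. indicator {t..T} \<tau> *\<^sub>R pk k \<tau> \<partial>lborel)" .
    moreover have "fcoef (c t) k = fcoef uT k - fcoef (\<lambda>x. I x t) k"
      using fcoef_bound(2)[OF uT_meas uT_bound, of k] cI
      by (simp add: fcoef_def c_def left_diff_distrib)
    ultimately show "fcoef (c t) k = fcoef uT k - (\<integral>\<tau>. indicator {t..T} \<tau> *\<^sub>R pk k \<tau> \<partial>lborel)" by simp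
  qed

  have pde: "AE t in lborel. 0 \<le> t \<and> t \<le> T \<longrightarrow> (\<forall>k. pk k t = complex_of_real (symbol k) * fcoef (c t) k + fcoef (\<lambda>x. f x t) k)"
  proof -
    have 1: "AE t in lborel. t \<in> {0..T} \<longrightarrow> (\<exists>g. is_frac_laplacian s (\<lambda>x. u x t) g \<and> (AE x in torus_measure. - v x t + g x + f0 x t = 0))"
      using v_pde by (subst (asm) AE_lebesgue_on_iff) auto
    show ?thesis
      using 1 AE_lborel_slices(2)[OF u_c] AE_lborel_slices(2)[OF V_eq] AE_lborel_slices(2)[OF f0]
    proof eventually_elim
      case (elim t)
      show ?case
      proof (intro impI allI, elim conjE)
        fix k assume t: "0 \<le> t" "t \<le> T"
        have uc: "AE x in cell_measure. u x t = c t x" unfolding AE_cell_measure using elim(2) by (rule eventually_mono) (use t in auto)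
        have vV: "AE x in cell_measure. v x t = V x t" unfolding AE_cell_measure using elim(3) by (rule eventually_mono) (use t in auto)
        have ff: "AE x in cell_measure. f0 x t = f x t" unfolding AE_cell_measure using elim(4) by (rule eventually_mono) (use t in auto)
        obtain g where g: "is_frac_laplacian s (\<lambda>x. u x t) g" and eq: "AE x in torus_measure. - v x t + g x + f0 x t = 0"
          using elim(1) t by auto
        have gi: "integrable torus_measure g" and gk: "fourier_coeff g k = complex_of_real (symbol k) * fourier_coeff (\<lambda>x. u x t) k"
          using g by (auto simp: is_frac_laplacian_def multiplier_image_def symbol_def)
        obtain g' where g': "g' \<in> borel_measurable borel" "AE x in cell_measure. g x = g' x" "integrable cell_measure g'"
          using torus_integrable_rep[OF gi] by blast
        have [measurable]: "g' \<in> borel_measurable borel" by fact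
        have fk: "fcoef g' k = complex_of_real (symbol k) * fcoef (c t) k"
          using gk fourier_coeff_rep[OF g'(1,2)] fourier_coeff_rep[OF ct_meas uc] by simp
        have "AE x in cell_measure. V x t = g' x + f x t"
          using eq[unfolded AE_torus_iff] vV ff g'(2) by eventually_elim simp
        then have "fcoef (\<lambda>x. V x t) k = (\<integral>x. complex_of_real (g' x) * character k x + complex_of_real (f x t) * character k x \<partial>cell_measure)"
          unfolding fcoef_def by (intro integral_cong_AE) (auto elim: eventually_mono simp: distrib_right)
        also have "\<dots> = fcoef g' k + fcoef (\<lambda>x. f x t) k"
          unfolding fcoef_def
          using g'(3) fcoef_bound(2)[OF f_slice_meas f_bound, of t k]
          by (subst Bochner_Integration.integral_add) (auto simp: complex_of_real_integrable_eq intro: integrable_mult_character)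
        finally show "pk k t = complex_of_real (symbol k) * fcoef (c t) k + fcoef (\<lambda>x. f x t) k"
          by (simp add: pk_fcoef fk)
      qed
    qed
  qed

  have coeffs: "fcoef (c t) k = fcoef (mild t) k" if t: "0 \<le> t" "t \<le> T" for t k
  proof -
    have "fcoef (c t) k = fcoef uT k - (\<integral>r. indicator {t..T} r *\<^sub>R pk k r \<partial>lborel)" by (rule fcoef_c)
    also have "\<dots> = complex_of_real (exp (- (symbol k * (T - t)))) * fcoef uT k
      - (\<integral>\<tau>. indicator {t..T} \<tau> *\<^sub>R (complex_of_real (exp (- (symbol k * (\<tau> - t)))) * fcoef (\<lambda>x. f x \<tau>) k) \<partial>lborel)"
    proof (rule duhamel_of_integral_equation)
      show "integrable lborel (\<lambda>\<tau>. indicator {0..T} \<tau> *\<^sub>R pk k \<tau>)"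
        by (rule Bochner_Integration.integrable_bound[OF pk_int[of k]]) (auto simp: indicator_def)
      show "AE \<tau> in lborel. 0 \<le> \<tau> \<and> \<tau> \<le> T \<longrightarrow> pk k \<tau> = complex_of_real (symbol k) * (fcoef uT k - (\<integral>r. indicator {\<tau>..T} r *\<^sub>R pk k r \<partial>lborel)) + fcoef (\<lambda>x. f x \<tau>) k"
        using pde by (rule eventually_mono) (simp add: fcoef_c)
    qed (use t symbol_nonneg in auto)
    also have "(\<integral>\<tau>. indicator {t..T} \<tau> *\<^sub>R (complex_of_real (exp (- (symbol k * (\<tau> - t)))) * fcoef (\<lambda>x. f x \<tau>) k) \<partial>lborel)
      = (\<integral>\<tau>. indicator {t..T} (\<tau> + t) *\<^sub>R (complex_of_real (exp (- (symbol k * (\<tau> + t - t)))) * fcoef (\<lambda>x. f x (\<tau> + t)) k) \<partial>lborel)"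
      by (rule lborel_integral_translate[symmetric]) measurable
    also have "\<dots> = (\<integral>\<tau>. indicator {0..T - t} \<tau> *\<^sub>R (complex_of_real (exp (- (\<tau> * symbol k))) * fcoef (\<lambda>y. f y (t + \<tau>)) k) \<partial>lborel)"
      by (intro Bochner_Integration.integral_cong) (auto simp: indicator_def add.commute mult.commute)
    also have "\<dots> = (\<integral>\<tau>. complex_of_real (exp (- (\<tau> * symbol k))) * fcoef (\<lambda>y. f y (t + \<tau>)) k \<partial>ivl (T - t))"
      by (subst integral_ivl) simp_all
    finally show ?thesis using fcoef_mild[OF t(2), of k] by (simp add: mult.commute)
  qed

  have cw: "AE p in lborel. in_cylinder T p \<longrightarrow> c (snd p) (fst p) = mild (snd p) (fst p)"
  proof (rule AE_lborel_prodI)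
    note [measurable] = mild_joint_meas c_meas
    show "Measurable.pred (borel \<Otimes>\<^sub>M borel) (\<lambda>p. in_cylinder T p \<longrightarrow> c (snd p) (fst p) = mild (snd p) (fst p))"
    proof -
      have [measurable]: "(\<lambda>p. c (snd p) (fst p)) \<in> borel_measurable (borel \<Otimes>\<^sub>M borel)" using c_meas by (simp add: case_prod_beta')
      have [measurable]: "(\<lambda>p. mild (snd p) (fst p)) \<in> borel_measurable (borel \<Otimes>\<^sub>M borel)" using mild_joint_meas by (simp add: case_prod_beta')
      show ?thesis by measurable
    qed
    show "AE t in lborel. AE x in lborel. in_cylinder T (x, t) \<longrightarrow> c (snd (x, t)) (fst (x, t)) = mild (snd (x, t)) (fst (x, t))"
    proof (rule AE_I2)
      fix t :: real
      show "AE x in lborel. in_cylinder T (x, t) \<longrightarrow> c (snd (x, t)) (fst (x, t)) = mild (snd (x, t)) (fst (x, t))"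
      proof (cases "0 \<le> t \<and> t \<le> T")
        case True
        have wi: "integrable cell_measure (mild t)"
          using mild_bound[of t] True by (intro cell.integrable_const_bound[where B = "B + M * T"]) auto
        have i: "integrable cell_measure (\<lambda>x. complex_of_real (h x) * character k x)" if "integrable cell_measure h" for h :: "real ^ 'd \<Rightarrow> real" and k
          using that by (intro integrable_mult_character) (simp add: complex_of_real_integrable_eq)
        have "AE x in cell_measure. c t x - mild t x = 0"
        proof (rule fourier_uniqueness)
          show "integrable cell_measure (\<lambda>x. c t x - mild t x)" using fcoef_c(1)[of t] wi by simp
          fix k
          show "(\<integral>x. complex_of_real (c t x - mild t x) * character k x \<partial>cell_measure) = 0"
            using coeffs[of t k] True i[OF fcoef_c(1)[of t], of k] i[OF wi, of k]
            by (simp add: fcoef_def left_diff_distrib)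
        qed
        then show ?thesis unfolding AE_cell_measure by (rule eventually_mono) auto
      qed auto
    qed
  qed
  from cw u_c show ?thesis by eventually_elim auto
qed

end

section \<open>The gradient estimate\<close>

text \<open>
  A Borel representative is truncated at the essential supremum and extended periodically from the
  cell, so that the bound and the periodicity hold everywhere.
\<close>
lemma Linf_borel_rep:
  fixes f0 :: "real ^ 'd \<Rightarrow> real \<Rightarrow> real"
  assumes f0: "in_Linf T f0"
  defines "M \<equiv> enn2real (Linf_norm T f0)"
  obtains f where "case_prod f \<in> borel_measurable (borel \<Otimes>\<^sub>M borel)" "\<And>x t. \<bar>f x t\<bar> \<le> M" "\<And>t. torus_periodic (\<lambda>x. f x t)"
    "AE p in lborel. in_cylinder T p \<longrightarrow> f0 (fst p) (snd p) = f (fst p) (snd p)"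
proof -
  have meas: "(\<lambda>(x, t). f0 x t) \<in> borel_measurable (cylinder_measure T)" and fin: "Linf_norm T f0 < \<infinity>"
    using f0 by (auto simp: in_Linf_def)
  have M: "Linf_norm T f0 = ennreal M" "0 \<le> M" using fin by (auto simp: M_def)
  obtain G where G [measurable]: "case_prod G \<in> borel_measurable (borel \<Otimes>\<^sub>M borel)"
    and G_eq: "AE p in lborel. in_cylinder T p \<longrightarrow> f0 (fst p) (snd p) = G (fst p) (snd p)"
    by (rule cylinder_borel_rep[OF meas])
  have "AE p in cylinder_measure T. (case p of (x, t) \<Rightarrow> ennreal \<bar>f0 x t\<bar>) \<le> Linf_norm T f0"
    unfolding Linf_norm_def by (rule esssup_AE)
  then have bd: "AE p in lborel. in_cylinder T p \<longrightarrow> \<bar>f0 (fst p) (snd p)\<bar> \<le> M"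
    unfolding AE_cylinder_iff by (rule eventually_mono) (use M in auto)
  define f where "f = (\<lambda>x t. max (- M) (min M (G (frac_vec x) t)))"
  have 1: "case_prod f \<in> borel_measurable (borel \<Otimes>\<^sub>M borel)" unfolding f_def by measurable
  have 2: "\<bar>f x t\<bar> \<le> M" for x t using M by (auto simp: f_def)
  have 3: "torus_periodic (\<lambda>x. f x t)" for t by (simp add: f_def torus_periodic_def frac_vec_lattice_shift)
  have 4: "AE p in lborel. in_cylinder T p \<longrightarrow> f0 (fst p) (snd p) = f (fst p) (snd p)"
    using G_eq bd by eventually_elim (auto simp: f_def frac_vec_eq)
  show thesis by (rule that[OF 1 2 3 4])
qed

lemma continuous_on_prod_of_modulus:
  fixes F :: "'a::metric_space \<Rightarrow> real \<Rightarrow> 'b::metric_space"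
  assumes x: "\<And>t. t \<in> I \<Longrightarrow> continuous_on UNIV (\<lambda>x. F x t)"
    and t: "\<And>x t t'. t \<in> I \<Longrightarrow> t' \<in> I \<Longrightarrow> dist (F x t) (F x t') \<le> C * dist t t' powr b" and b: "0 < b"
  shows "continuous_on (UNIV \<times> I) (\<lambda>(x, t). F x t)"
  unfolding continuous_on_def
proof
  fix p0 :: "'a \<times> real" assume "p0 \<in> UNIV \<times> I"
  then obtain x0 t0 where p0: "p0 = (x0, t0)" and t0: "t0 \<in> I" by auto
  let ?A = "at (x0, t0) within (UNIV \<times> I)"
  have snd: "((\<lambda>p. snd p) \<longlongrightarrow> t0) ?A" by (rule tendsto_eq_intros | simp)+
  have fst: "((\<lambda>p. fst p) \<longlongrightarrow> x0) ?A" by (rule tendsto_eq_intros | simp)+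
  have "((\<lambda>p. dist (snd p) t0 powr b) \<longlongrightarrow> dist t0 t0 powr b) ?A"
    using b by (intro tendsto_powr' tendsto_dist snd tendsto_const) auto
  then have 1: "((\<lambda>p. C * dist (snd p) t0 powr b) \<longlongrightarrow> 0) ?A"
    using tendsto_mult_right_zero[of _ ?A C] by simp
  have "isCont (\<lambda>x. F x t0) x0" using x[OF t0] by (simp add: continuous_on_eq_continuous_at)
  then have "((\<lambda>p. F (fst p) t0) \<longlongrightarrow> F x0 t0) ?A" by (rule isCont_tendsto_compose[OF _ fst])
  then have 2: "((\<lambda>p. dist (F (fst p) t0) (F x0 t0)) \<longlongrightarrow> 0) ?A" by (rule tendsto_dist_iff[THEN iffD1])
  have lim: "((\<lambda>p. C * dist (snd p) t0 powr b + dist (F (fst p) t0) (F x0 t0)) \<longlongrightarrow> 0) ?A"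
    using tendsto_add[OF 1 2] by simp
  have ev: "\<forall>\<^sub>F p in ?A. norm (dist (F (fst p) (snd p)) (F x0 t0)) \<le> C * dist (snd p) t0 powr b + dist (F (fst p) t0) (F x0 t0)"
    unfolding eventually_at_filter
  proof (intro always_eventually allI impI)
    fix p :: "'a \<times> real" assume "p \<in> UNIV \<times> I"
    then have "snd p \<in> I" by auto
    from t[OF this t0, of "fst p"] show "norm (dist (F (fst p) (snd p)) (F x0 t0)) \<le> C * dist (snd p) t0 powr b + dist (F (fst p) t0) (F x0 t0)"
      using dist_triangle[of "F (fst p) (snd p)" "F x0 t0" "F (fst p) t0"] by simp
  qed
  have "((\<lambda>p. dist (F (fst p) (snd p)) (F x0 t0)) \<longlongrightarrow> 0) ?A"
    by (rule Lim_null_comparison[OF ev lim])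
  then have "((\<lambda>p. F (fst p) (snd p)) \<longlongrightarrow> F x0 t0) ?A" by (rule tendsto_dist_iff[THEN iffD2])
  then show "((\<lambda>(x, t). F x t) \<longlongrightarrow> (case p0 of (x, t) \<Rightarrow> F x t)) (at p0 within UNIV \<times> I)"
    by (simp add: p0 case_prod_beta')
qed

lemma holder_seminorm_le:
  assumes "\<And>x y. x \<in> S \<Longrightarrow> y \<in> S \<Longrightarrow> norm (g x - g y) \<le> C * dist x y powr b"
  shows "holder_seminorm b S g \<le> ennreal C"
  unfolding holder_seminorm_def
proof (rule SUP_least, clarify)
  fix x y assume "x \<in> S" "y \<in> S" "x \<noteq> y"
  then show "ennreal (norm (g x - g y) / dist x y powr b) \<le> ennreal C"
    using assms[of x y] by (intro ennreal_leI) (simp add: field_simps)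
qed

lemma parabolic_holder_norm_le:
  assumes T: "0 \<le> T" and C: "0 \<le> C1" "0 \<le> C2" "0 \<le> C3"
    and 1: "\<And>x t. t \<in> {0..T} \<Longrightarrow> norm (v x t) \<le> C1"
    and 2: "\<And>x y t. t \<in> {0..T} \<Longrightarrow> norm (v x t - v y t) \<le> C2 * dist x y powr \<alpha>"
    and 3: "\<And>x t t'. t \<in> {0..T} \<Longrightarrow> t' \<in> {0..T} \<Longrightarrow> norm (v x t - v x t') \<le> C3 * dist t t' powr \<gamma>"
  shows "parabolic_holder_norm T \<alpha> \<gamma> v \<le> ennreal (C1 + (C2 + C3))"
proof -
  have "parabolic_holder_norm T \<alpha> \<gamma> v \<le> ennreal C1 + (ennreal C2 + ennreal C3)"
    unfolding parabolic_holder_norm_def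
  proof (intro add_mono)
    show "(SUP (x, t) \<in> UNIV \<times> {0..T}. ennreal (norm (v x t))) \<le> ennreal C1"
      by (rule SUP_least) (use 1 in \<open>auto intro!: ennreal_leI\<close>)
    show "(SUP t \<in> {0..T}. holder_seminorm \<alpha> UNIV (\<lambda>x. v x t)) \<le> ennreal C2"
      by (rule SUP_least, rule holder_seminorm_le) (use 2 in auto)
    show "(SUP x. holder_seminorm \<gamma> {0..T} (v x)) \<le> ennreal C3"
      by (rule SUP_least, rule holder_seminorm_le) (use 3 in auto)
  qed
  then show ?thesis using C by (simp add: ennreal_plus[symmetric] del: ennreal_plus)
qed

context duhamel
begin

text \<open>
  The gradient is chosen from the expansion, which determines it.
\<close>
definition mild_gradient :: "real ^ 'd \<Rightarrow> real \<Rightarrow> real ^ 'd" where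
  "mild_gradient x t = (SOME V. taylor a grad_const (mild t) V) x"

lemma grad_taylor: "t \<in> {0..T} \<Longrightarrow> taylor a grad_const (mild t) (\<lambda>x. mild_gradient x t)"
  using someI_ex[OF mild_taylor[of t]] unfolding mild_gradient_def by auto

lemma grad_const_nonneg: "0 \<le> grad_const"
  using grad_taylor[of 0] T_pos by (intro taylor_const_nonneg[of a _ "mild 0"]) auto

lemma time_const_nonneg: "0 \<le> time_const"
  unfolding time_const_def using grad_const_nonneg moment_nonneg M_nonneg by simp

lemma mild_time_sym:
  assumes "t \<in> {0..T}" "t' \<in> {0..T}"
  shows "\<bar>mild t x - mild t' x\<bar> \<le> time_const * \<kappa> (dist t t') powr a"
proof (cases "t \<le> t'")
  case True
  then show ?thesis using mild_time[of t "t' - t" x] assms by (simp add: dist_real_def)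
next
  case False
  then show ?thesis using mild_time[of t' "t - t'" x] assms by (simp add: dist_real_def abs_minus_commute)
qed

lemma mild_continuous: "continuous_on (UNIV \<times> {0..T}) (\<lambda>(x, t). mild t x)"
proof (rule continuous_on_prod_of_modulus)
  show "continuous_on UNIV (mild t)" if "t \<in> {0..T}" for t
    using taylor_continuous[OF grad_taylor[OF that] exponents(3)] .
  show "dist (mild t x) (mild t' x) \<le> time_const * dist t t' powr decay" if "t \<in> {0..T}" "t' \<in> {0..T}" for x t t'
    using mild_time_sym[OF that, of x] by (cases "t = t'") (auto simp: dist_real_def \<kappa>_powr decay_def)
qed (rule decay)

lemma grad_bound: "t \<in> {0..T} \<Longrightarrow> norm (mild_gradient x t) \<le> 2 * (B + M * T) + grad_const"
  using taylor_gradient_bound[OF grad_taylor[of t], of "B + M * T" 1 x] mild_bound[of t] by simp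

lemma grad_space: "t \<in> {0..T} \<Longrightarrow> norm (mild_gradient x t - mild_gradient y t) \<le> 6 * grad_const * dist x y powr (a - 1)"
  using taylor_gradient_holder[OF grad_taylor[of t] exponents(3) a_le_2, of x y] by simp

lemma grad_time:
  assumes "t \<in> {0..T}" "t' \<in> {0..T}"
  shows "norm (mild_gradient x t - mild_gradient x t') \<le> 2 * (grad_const + time_const) * dist t t' powr ((a - 1) / (2 * s))"
proof (cases "t = t'")
  case False
  then have d: "0 < \<kappa> (dist t t')" by (intro \<kappa>_pos) simp
  have "norm (mild_gradient x t - mild_gradient x t') \<le> 2 * (grad_const + time_const) * \<kappa> (dist t t') powr (a - 1)"
    by (rule taylor_gradient_close[OF grad_taylor grad_taylor mild_time_sym d]) (use assms in auto)
  then show ?thesis using False by (simp add: \<kappa>_powr)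
qed simp

lemma grad_norm: "parabolic_holder_norm T (a - 1) ((a - 1) / (2 * s)) mild_gradient
   \<le> ennreal (2 * (B + M * T) + grad_const + (6 * grad_const + 2 * (grad_const + time_const)))"
  using T_pos grad_const_nonneg time_const_nonneg B_nonneg M_nonneg
  by (intro parabolic_holder_norm_le grad_bound grad_space grad_time) auto

lemma grad_gderiv: "t \<in> {0..T} \<Longrightarrow> GDERIV (mild t) x :> mild_gradient x t"
  using taylor_gderiv[OF grad_taylor exponents(3)] .

lemma grad_continuous: "continuous_on (UNIV \<times> {0..T}) (\<lambda>(x, t). mild_gradient x t)"
proof (rule continuous_on_prod_of_modulus)
  show "continuous_on UNIV (\<lambda>x. mild_gradient x t)" if "t \<in> {0..T}" for t
    using taylor_gradient_continuous[OF grad_taylor[OF that] exponents(3) a_le_2] .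
  show "dist (mild_gradient x t) (mild_gradient x t') \<le> 2 * (grad_const + time_const) * dist t t' powr ((a - 1) / (2 * s))" if "t \<in> {0..T}" "t' \<in> {0..T}" for x t t'
    using grad_time[OF that] by (simp add: dist_norm)
  show "0 < (a - 1) / (2 * s)" using exponents s_pos by simp
qed

text \<open>
  The shifted gradient belongs to an expansion of the same function, and expansions of one function
  have the same gradient: the interpolation inequality holds with \<open>D = 0\<close> at every scale.
\<close>
lemma grad_periodic:
  assumes t: "t \<in> {0..T}"
  shows "torus_periodic (\<lambda>x. mild_gradient x t)"
  unfolding torus_periodic_def
proof (intro allI)
  fix x :: "real ^ 'd" and k
  have "taylor a grad_const (mild t) (\<lambda>x. mild_gradient (x + lattice_vec k) t)"
    unfolding taylor_def
  proof (intro allI)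
    fix y h :: "real ^ 'd"
    have "y + lattice_vec k + h = (y + h) + lattice_vec k" by (simp add: algebra_simps)
    moreover have "mild t (z + lattice_vec k) = mild t z" for z
      using mild_periodic[of t] unfolding torus_periodic_def by blast
    ultimately have "mild t (y + lattice_vec k + h) = mild t (y + h)" "mild t (y + lattice_vec k) = mild t y"
      by (simp_all only:)
    then show "\<bar>mild t (y + h) - mild t y - mild_gradient (y + lattice_vec k) t \<bullet> h\<bar> \<le> grad_const * norm h powr a"
      using taylorD[OF grad_taylor[OF t], of "y + lattice_vec k" h] by simp
  qed
  from taylor_gradient_close[OF this grad_taylor[OF t], of 0]
  have *: "norm (mild_gradient (x + lattice_vec k) t - mild_gradient x t) \<le> 2 * grad_const * d powr (a - 1)" if "0 < d" for d
    using that by simp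
  have "((\<lambda>d::real. 2 * grad_const * d powr (a - 1)) \<longlongrightarrow> 2 * grad_const * 0 powr (a - 1)) (at_right 0)"
    using exponents(3) by (intro tendsto_intros tendsto_powr') (auto simp: eventually_at_filter)
  then have "norm (mild_gradient (x + lattice_vec k) t - mild_gradient x t) \<le> 2 * grad_const * 0 powr (a - 1)"
  proof (rule tendsto_lowerbound)
    show "\<forall>\<^sub>F d in at_right 0. norm (mild_gradient (x + lattice_vec k) t - mild_gradient x t) \<le> 2 * grad_const * d powr (a - 1)"
      using eventually_at_right_less by (rule eventually_mono) (rule *)
  qed simp
  then show "mild_gradient (x + lattice_vec k) t = mild_gradient x t" by simp
qed

end

theorem lemma2p3:
  fixes s \<epsilon> T :: real
  assumes "1 / 2 < s" and "s < 1" and "\<epsilon> > 0" and "T > 0"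
  shows "\<exists>C::real. \<exists>\<beta>::real. C > 0 \<and> 0 < \<beta> \<and> \<beta> < 1 \<and>
    (\<forall>(f :: real ^ 'd \<Rightarrow> real \<Rightarrow> real) uT u.
      in_Linf T f \<longrightarrow> in_holder (2 * s + \<epsilon>) uT \<longrightarrow> is_solution s T f uT u \<longrightarrow>
      (\<exists>w Du. is_continuous_rep T u w \<and>
        (\<forall>x. \<forall>t \<in> {0..T}. GDERIV (\<lambda>y. w y t) x :> Du x t) \<and>
        in_parabolic_holder T \<beta> (\<beta> / (2 * s)) Du \<and>
        parabolic_holder_norm T \<beta> (\<beta> / (2 * s)) Du
          \<le> ennreal C * (Linf_norm T f + holder_norm (2 * s + \<epsilon>) uT)))"
proof -
  \<comment> \<open>The midpoint of the admissible range \<open>1 < a < 2 * s\<close>; since \<open>a - 1 < 2 * s - 1\<close>, every \<open>\<epsilon> > 0\<close> suffices for the terminal data.\<close>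
  define a where "a = s + 1 / 2"
  have a: "1 < a" "a < 2 * s" "0 < a - 1" "a - 1 < 1" "a - 1 \<le> 2 * s + \<epsilon> - 1" using assms by (auto simp: a_def)
  obtain N :: "(real \<times> (real ^ 'd)) measure" and Y \<Psi> K where "stable_kernel N Y (\<Psi> :: _ \<Rightarrow> real ^ 'd) s a K"
    using stable_kernel_exists[OF assms(1,2) a(1,2)] by blast
  then interpret kernel: torus_kernel N Y \<Psi> s a K by (rule torus_kernel.intro)
  define d where "d = real CARD('d)"
  define c1 where "c1 = 2 * d\<^sup>2 + kernel.smooth_const T"
  define C where "C = 2 + 2 * T + 9 * c1 + 2 * (c1 * kernel.moment + T powr (1 - kernel.decay))"
  have cK0: "0 \<le> kernel.smooth_const T"
    unfolding kernel.smooth_const_def using kernel.K_nonneg kernel.decay by simp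
  then have c1: "0 \<le> c1" by (simp add: c1_def)
  have C: "0 < C"
    unfolding C_def using c1 assms(4) kernel.moment_nonneg by (intro add_pos_nonneg) auto
  show ?thesis
  proof (rule exI[of _ C], rule exI[of _ "a - 1"], intro conjI allI impI C a(3,4))
    fix f0 :: "real ^ 'd \<Rightarrow> real \<Rightarrow> real" and uT u
    assume f0: "in_Linf T f0" and uT: "in_holder (2 * s + \<epsilon>) uT" and u: "is_solution s T f0 uT u"
    define M where "M = enn2real (Linf_norm T f0)"
    define B where "B = enn2real (holder_norm (2 * s + \<epsilon>) uT)"
    have M: "Linf_norm T f0 = ennreal M" "0 \<le> M" using f0 by (auto simp: in_Linf_def M_def)
    have B: "holder_norm (2 * s + \<epsilon>) uT = ennreal B" "0 \<le> B" using uT by (auto simp: in_holder_def B_def)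
    obtain f where f: "case_prod f \<in> borel_measurable (borel \<Otimes>\<^sub>M borel)" "\<And>x t. \<bar>f x t\<bar> \<le> M" "\<And>t. torus_periodic (\<lambda>x. f x t)"
      and f_eq: "AE p in lborel. in_cylinder T p \<longrightarrow> f0 (fst p) (snd p) = f (fst p) (snd p)"
      by (rule Linf_borel_rep[OF f0, folded M_def], rule that)
    have "1 < 2 * s + \<epsilon>" using assms by simp
    note uTt = in_holder_taylor[OF uT this a(3,4,5), folded B_def d_def]
    interpret duhamel N Y \<Psi> s a K f uT "\<lambda>x. \<chi> i. partial_deriv i uT x" M "2 * d\<^sup>2 * B" B T
    proof (unfold_locales)
      show "torus_periodic uT" using uT by (simp add: in_holder_def)
      show "taylor a (2 * d\<^sup>2 * B) uT (\<lambda>x. \<chi> i. partial_deriv i uT x)" using uTt(2) by simp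
    qed (use f uTt(1) assms in auto)
    have le: "2 * (B + M * T) + grad_const + (6 * grad_const + 2 * (grad_const + time_const)) \<le> C * (M + B)"
    proof -
      define S where "S = M + B"
      define e where "e = c1 * kernel.moment + T powr (1 - kernel.decay)"
      have "grad_const = 2 * d\<^sup>2 * B + M * kernel.smooth_const T" by (simp only: grad_const_def)
      also have "\<dots> \<le> (2 * d\<^sup>2 * B + M * kernel.smooth_const T) + (2 * d\<^sup>2 * M + kernel.smooth_const T * B)"
        using M(2) B(2) cK0 by simp
      also have "\<dots> = c1 * S" by (simp add: c1_def S_def algebra_simps)
      finally have grad_const: "grad_const \<le> c1 * S" .
      have "time_const \<le> c1 * S * kernel.moment + S * T powr (1 - kernel.decay)"
        unfolding time_const_def using grad_const kernel.moment_nonneg B(2)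
        by (intro add_mono mult_right_mono) (auto simp: S_def)
      also have "\<dots> = e * S" by (simp add: e_def algebra_simps)
      finally have time_const: "time_const \<le> e * S" .
      have "T * B \<ge> 0" using B(2) assms(4) by simp
      then have BM: "B + M * T \<le> (1 + T) * S" using M(2) by (simp add: S_def algebra_simps)
      have "C * S = 2 * ((1 + T) * S) + 9 * (c1 * S) + 2 * (e * S)" by (simp add: C_def e_def algebra_simps)
      moreover have "2 * x + y + (6 * y + 2 * (y + z)) \<le> W"
        if "x \<le> X" "y \<le> Y" "z \<le> Z" "W = 2 * X + 9 * Y + 2 * Z" for x y z X Y Z W :: real
        using that by (simp add: algebra_simps)
      ultimately have "2 * (B + M * T) + grad_const + (6 * grad_const + 2 * (grad_const + time_const)) \<le> C * S"
        using grad_const time_const BM by blast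
      then show ?thesis by (simp only: S_def)
    qed
    show "\<exists>w Du. is_continuous_rep T u w \<and>
        (\<forall>x. \<forall>t \<in> {0..T}. GDERIV (\<lambda>y. w y t) x :> Du x t) \<and>
        in_parabolic_holder T (a - 1) ((a - 1) / (2 * s)) Du \<and>
        parabolic_holder_norm T (a - 1) ((a - 1) / (2 * s)) Du
          \<le> ennreal C * (Linf_norm T f0 + holder_norm (2 * s + \<epsilon>) uT)"
    proof (rule exI[of _ "\<lambda>x t. mild t x"], rule exI[of _ mild_gradient], intro conjI)
      show "is_continuous_rep T u (\<lambda>x t. mild t x)"
        unfolding is_continuous_rep_def
      proof (intro conjI ballI mild_continuous mild_periodic)
        show "AE (x, t) in cylinder_measure T. mild t x = u x t"
          unfolding AE_cylinder_iff using solution_eq_mild[OF u f_eq] by (rule eventually_mono) auto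
      qed
      show "\<forall>x. \<forall>t \<in> {0..T}. GDERIV (mild t) x :> mild_gradient x t" using grad_gderiv by blast
      have "parabolic_holder_norm T (a - 1) ((a - 1) / (2 * s)) mild_gradient \<le> ennreal (C * (M + B))"
        using grad_norm le by (meson ennreal_leI order_trans)
      also have "\<dots> = ennreal C * (Linf_norm T f0 + holder_norm (2 * s + \<epsilon>) uT)"
        using M B C by (simp add: ennreal_mult)
      finally show bound: "parabolic_holder_norm T (a - 1) ((a - 1) / (2 * s)) mild_gradient
          \<le> ennreal C * (Linf_norm T f0 + holder_norm (2 * s + \<epsilon>) uT)" .
      have "parabolic_holder_norm T (a - 1) ((a - 1) / (2 * s)) mild_gradient < \<infinity>"
        using grad_norm by (rule le_less_trans) simp
      then show "in_parabolic_holder T (a - 1) ((a - 1) / (2 * s)) mild_gradient"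
        unfolding in_parabolic_holder_def using grad_continuous grad_periodic by blast
    qed
  qed
qed

end
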